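(* The following two inequalities hold: $$-\frac1\pi\int_0^\infty\frac{\log|\zeta(\tfrac12+iu)|}{(u^2+\tfrac14)^2}\,du\le \gamma-1,$$ $$\frac2\pi\int_0^\infty\frac{u\,\bigl(\pi N(u)-\vartheta(u)-2\arctan(2u)\bigr)}{(u^2+\tfrac14)^2}\,du\ge\gamma-1.$$ Moreover, in each of the two inequalities equality holds if and only if the Riemann hypothesis is true.
   Context: $\gamma$ is Euler's constant. For $t\ge 0$, $N(t)$ is the number of zeros $\rho=\sigma+i\tau$ of $\zeta$ with $0<\sigma<1$ and $0\le\tau\le t$, counted with multiplicity. The function $\vartheta:\mathbb R\to\mathbb R$ is $$\vartheta(t):=-\arctan(2t)-\frac t2(\gamma+\log\pi)+\sum_{k=1}^\infty\left\{\frac{t}{2k}-\arctan\frac{t}{2k+\frac12}\right\}.$$ *)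

theory Defs
  imports "HOL-Analysis.Analysis"
begin

text \<open>Riemann zeta function on the half-plane Re s > 0 (s not on the line Re s = 1
  where 2 powr (1 - s) = 1), via the Dirichlet eta function:
  zeta s = eta s / (1 - 2^(1-s)), eta s = sum_{n>=1} (-1)^(n-1) n^(-s).
  This is the analytic continuation of zeta to Re s > 0, which covers the critical strip
  and the critical line, the only places where the statement uses zeta.\<close>

definition dirichlet_eta :: "complex \<Rightarrow> complex" where
  "dirichlet_eta s = (\<Sum>n. (-1) ^ n / (of_nat (Suc n)) powr s)"

definition zeta :: "complex \<Rightarrow> complex" where
  "zeta s = dirichlet_eta s / (1 - 2 powr (1 - s))"

definition zeta_zero_mult :: "complex \<Rightarrow> nat" where
  "zeta_zero_mult z = (LEAST n. (deriv ^^ n) zeta z \<noteq> 0)"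

definition nontrivial_zeros :: "complex set" where
  "nontrivial_zeros = {\<rho>. 0 < Re \<rho> \<and> Re \<rho> < 1 \<and> zeta \<rho> = 0}"

definition zeta_N :: "real \<Rightarrow> real" where
  "zeta_N t = real (\<Sum>\<rho>\<in>{\<rho>\<in>nontrivial_zeros. 0 \<le> Im \<rho> \<and> Im \<rho> \<le> t}. zeta_zero_mult \<rho>)"

definition RH :: bool where
  "RH \<longleftrightarrow> (\<forall>\<rho>\<in>nontrivial_zeros. Re \<rho> = 1/2)"

definition theta_fun :: "real \<Rightarrow> real" where
  "theta_fun t = - arctan (2 * t) - t / 2 * (euler_mascheroni + ln pi)
     + (\<Sum>k. t / (2 * real (Suc k)) - arctan (t / (2 * real (Suc k) + 1/2)))"

end

theory Submission
  imports Defs "HOL-Probability.Probability" "HOL-Complex_Analysis.Complex_Analysis" "HOL-Real_Asymp.Real_Asymp"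
    "HOL-Computational_Algebra.Primes"
begin

text \<open>
  Write \<open>\<Xi> z = \<xi> (1/2 + z)\<close>, an even entire function; let \<open>r\<close> run over its zeros, with multiplicity,
  and let \<open>w = u\<^sup>2 + 1/4\<close>. Evenness and the growth of \<open>\<Xi>\<close> give \<open>\<Xi> z = \<Xi> 0 * (\<Prod>r. 1 - z / r)\<close> along
  growing discs, and the logarithmic derivative at \<open>1/2\<close> gives \<open>(\<Sum>r. \<beta> r) = 2 + \<gamma> - ln (4\<pi>)\<close> with
  \<open>\<beta> r = Re (1 / (1/4 - r\<^sup>2))\<close>.

  For the first integral, \<open>\<integral> ln \<bar>\<Xi> (iu)\<bar> / w\<^sup>2 du\<close> is computed zero by zero with Cauchy's formula on the
  half-plane \<open>Re s > 1/2\<close>, the interchange of sum and integral being monotone convergence after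
  \<open>ln \<bar>1 - w / (1/4 - r\<^sup>2)\<bar>\<close> is subtracted from its majorant \<open>w / \<bar>1/4 - r\<^sup>2\<bar>\<close>. This yields
  \<open>I1 = \<gamma> - 1 - (\<Sum>r. gain r + \<beta> r) / 2\<close>, where \<open>gain r + \<beta> r \<ge> 0\<close> vanishes exactly when \<open>Re r = 0\<close>.
  For the second integral, integrating the counting function zero by zero gives
  \<open>I2 = \<gamma> - 1 + (\<Sum>r. \<alpha> r - \<beta> r) / 2\<close> with \<open>\<alpha> r = 1 / ((Im r)\<^sup>2 + 1/4)\<close>, and \<open>\<alpha> r \<ge> \<beta> r\<close> with equality
  exactly when \<open>Re r = 0\<close>.
\<close>

section \<open>Even entire functions of subquadratic growth\<close>

text \<open>The obstacle is that nothing about the density of the zeros is known in advance. Of the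
  size of \<open>xi_even\<close> only the bound exp(e n^2), for every e > 0, is used. Evenness makes
  it suffice: it forces the exponent left over in the factorisation to vanish to second order at the
  origin, so that a bound o(R^2) for its real part on discs of radius R sends it to 0. The sums over
  zeros obtained in this way converge a priori only along discs. Dominated and monotone arguments
  become possible because \<open>zero_beta r\<close> is positive at every zero, so that its sum,
  evaluated at the edge s = 1, controls the other nonnegative sums by comparison. These comparisons
  rest on \<open>\<bar>Re r\<bar> < 1/2\<close> and \<open>\<bar>Im r\<bar> > 1/2\<close>. The
  strict first bound requires that zeta has no zero on Re s = 1, which also ensures that the zeros
  of \<open>xi_even\<close> are exactly the shifted nontrivial zeros. The weight is |s|^4 on Re s =
  1/2, the one for which Cauchy's formula yields only a value and a derivative at s = 1; the same
  sum of \<open>zero_beta\<close> then cancels ln(4 pi) in both integrals and leaves gamma -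
  1.\<close>

lemma entire_divide_power_zorder:
  assumes hol: "f holomorphic_on UNIV" and nz: "\<exists>z. f z \<noteq> 0"
  obtains h where "h holomorphic_on UNIV" "h r \<noteq> 0" "\<And>z. f z = (z - r) ^ nat (zorder f r) * h z"
proof -
  define k where "k = nat (zorder f r)"
  have "(if f r = 0 then 0 < zorder f r else zorder f r = 0) \<and> (\<exists>d>0. cball r d \<subseteq> UNIV \<and>
      zor_poly f r holomorphic_on cball r d \<and>
      (\<forall>w\<in>cball r d. f w = zor_poly f r w * (w - r) ^ nat (zorder f r) \<and> zor_poly f r w \<noteq> 0))"
    by (rule zorder_exist_zero[OF hol]) (use nz in auto)
  then obtain d where "d > 0" and d2: "zor_poly f r holomorphic_on cball r d"
    and d3: "\<forall>w\<in>cball r d. f w = zor_poly f r w * (w - r) ^ k \<and> zor_poly f r w \<noteq> 0"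
    unfolding k_def by blast
  then have d: "d > 0" "zor_poly f r holomorphic_on cball r d"
      "\<And>w. w \<in> cball r d \<Longrightarrow> f w = zor_poly f r w * (w - r) ^ k" "zor_poly f r r \<noteq> 0"
    by auto
  define h where "h = (\<lambda>z. if z = r then zor_poly f r r else f z / (z - r) ^ k)"
  have h_eq: "h w = zor_poly f r w" if "w \<in> cball r d" for w
    using d(3)[OF that] by (auto simp: h_def)
  have "h field_differentiable at z" for z
  proof (cases "z = r")
    case True
    have "zor_poly f r field_differentiable at r"
      using d by (meson ball_subset_cball centre_in_ball holomorphic_on_imp_differentiable_at holomorphic_on_subset open_ball)
    then obtain D where D: "(zor_poly f r has_field_derivative D) (at r)"
      by (auto simp: field_differentiable_def)
    have ev: "\<forall>\<^sub>F w in nhds r. zor_poly f r w = h w"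
      using eventually_nhds_ball[OF d(1), of r]
      by eventually_elim (use h_eq in auto)
    have "(h has_field_derivative D) (at r)"
      using DERIV_cong_ev[OF refl ev refl] D by simp
    then show ?thesis using True by (auto simp: field_differentiable_def)
  next
    case False
    have "(\<lambda>z. f z / (z - r) ^ k) holomorphic_on -{r}"
      by (intro holomorphic_intros holomorphic_on_subset[OF hol]) auto
    then have "(\<lambda>z. f z / (z - r) ^ k) field_differentiable at z"
      using False by (meson ComplI holomorphic_on_imp_differentiable_at open_Compl closed_singleton singletonD)
    then obtain D where D: "((\<lambda>z. f z / (z - r) ^ k) has_field_derivative D) (at z)"
      by (auto simp: field_differentiable_def)
    have "open (-{r})" by (simp add: open_Compl)
    then have "\<forall>\<^sub>F w in nhds z. w \<in> -{r}"
      using eventually_nhds_in_open[of "-{r}" z] False by simp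
    then have ev: "\<forall>\<^sub>F w in nhds z. f w / (w - r) ^ k = h w"
      by eventually_elim (simp add: h_def)
    have "(h has_field_derivative D) (at z)"
      using DERIV_cong_ev[OF refl ev refl] D by simp
    then show ?thesis by (auto simp: field_differentiable_def)
  qed
  then have "h holomorphic_on UNIV"
    by (simp add: holomorphic_on_def)
  moreover have "h r \<noteq> 0" using d(4) by (simp add: h_def)
  moreover have "f z = (z - r) ^ k * h z" for z
    using d(3)[of r] d(1) d(4) by (auto simp: h_def)
  ultimately show ?thesis using that unfolding k_def by blast
qed

text \<open>Factors are written \<open>1 - z / r\<close> so that the product is 1 at the origin. The
  clause \<open>g r \<noteq> 0\<close> says that each zero has been removed with its full order; at
  a new point the order of \<open>F\<close> is that of the current \<open>g\<close>, because the
  product over the other points does not vanish there.\<close>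

lemma entire_factor_finite_zeros:
  assumes hol: "F holomorphic_on UNIV" and nz: "F 0 \<noteq> 0" and "finite S" "0 \<notin> S"
  shows "\<exists>g. g holomorphic_on UNIV \<and> (\<forall>z. F z = (\<Prod>r\<in>S. (1 - z / r) ^ nat (zorder F r)) * g z) \<and> (\<forall>r\<in>S. g r \<noteq> 0)"
  using assms(3,4)
proof (induction S rule: finite_induct)
  case empty
  then show ?case using hol by (intro exI[of _ F]) auto
next
  case (insert r S)
  then obtain g where g: "g holomorphic_on UNIV"
    "\<And>z. F z = (\<Prod>r\<in>S. (1 - z / r) ^ nat (zorder F r)) * g z" "\<And>r. r \<in> S \<Longrightarrow> g r \<noteq> 0"
    by auto
  let ?P = "\<lambda>z. (\<Prod>r\<in>S. (1 - z / r) ^ nat (zorder F r))"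
  have r: "r \<noteq> 0" "r \<notin> S" using insert by auto
  have g0: "\<exists>z. g z \<noteq> 0"
    using g(2)[of 0] nz by (intro exI[of _ 0]) auto
  have P_ana: "?P analytic_on {r}"
    by (intro analytic_intros) (use insert in auto)
  have g_ana: "g analytic_on {r}"
    unfolding analytic_at using g(1) by (intro exI[of _ UNIV]) auto
  have Pr: "?P r \<noteq> 0"
    using insert r by (auto simp: prod_zero_iff)
  have ev: "eventually (\<lambda>z. ?P z * g z \<noteq> 0) (at r)"
  proof -
    have "eventually (\<lambda>z. F z \<noteq> 0 \<and> z \<in> UNIV) (at r)"
      by (rule non_zero_neighbour_alt[OF hol, where ?\<beta> = 0]) (use nz in auto)
    then show ?thesis by eventually_elim (use g(2) in auto)
  qed
  have "zorder F r = zorder (\<lambda>z. ?P z * g z) r"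
    using g(2) by (metis (no_types, lifting) ext)
  also have "\<dots> = zorder ?P r + zorder g r"
    by (rule zorder_times_analytic[OF P_ana g_ana ev])
  also have "zorder ?P r = 0" by (rule zorder_eq_0I[OF P_ana Pr])
  finally have zo: "zorder F r = zorder g r" by simp
  obtain h where h:
    "h holomorphic_on UNIV" "h r \<noteq> 0" "\<And>z. g z = (z - r) ^ nat (zorder g r) * h z"
    by (rule entire_divide_power_zorder[of g r, OF g(1) g0]) (rule that)
  define k where "k = nat (zorder F r)"
  define h' where "h' = (\<lambda>z. (- r) ^ k * h z)"
  have gh: "g z = (1 - z / r) ^ k * h' z" for z
  proof -
    have "z - r = (1 - z / r) * (- r)" using r by (simp add: field_simps)
    then have "(z - r) ^ k = (1 - z / r) ^ k * (- r) ^ k" by (simp only: power_mult_distrib)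
    then show ?thesis using h(3)[of z] zo unfolding h'_def k_def by simp
  qed
  have "F z = (\<Prod>r\<in>insert r S. (1 - z / r) ^ nat (zorder F r)) * h' z" for z
    using g(2)[of z] gh[of z] insert by (simp add: k_def mult_ac)
  moreover have "h' holomorphic_on UNIV" unfolding h'_def by (intro holomorphic_intros h)
  moreover have "h' q \<noteq> 0" if "q \<in> insert r S" for q
  proof (cases "q = r")
    case True
    then show ?thesis using h(2) r by (simp add: h'_def)
  next
    case False
    then have "g q \<noteq> 0" using that g(3) by auto
    then show ?thesis using gh[of q] by auto
  qed
  ultimately show ?case by blast
qed

text \<open>The map taking w to w / (2A - w) sends the half-plane Re w < A into the unit disc.
  Schwarz's lemma then gives \<open>norm (h w) \<le> 2 * A\<close> on half the disc, and Cauchy's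
  inequality on circles of radius R/4 bounds the second derivative by 2! * 2A / (R/4)^2 = 64 A /
  R^2. Two integrations from the double zero at 0 give both bounds with the same constant.\<close>

lemma borel_caratheodory_double_zero:
  assumes hol: "h holomorphic_on ball 0 R" and R: "R > 0" and h0: "h 0 = 0" "deriv h 0 = 0"
    and A: "A > 0" "\<And>z. norm z < R \<Longrightarrow> Re (h z) < A" and z: "norm z \<le> R / 4"
  shows "norm (deriv h z) \<le> 64 * A * norm z / R\<^sup>2" "norm (h z) \<le> 64 * A * (norm z)\<^sup>2 / R\<^sup>2"
proof -
  define p where "p = (\<lambda>z. h (of_real R * z) / (2 * of_real A - h (of_real R * z)))"
  have inb: "of_real R * w \<in> ball (0::complex) R" if "norm w < 1" for w
    using that R by (simp add: norm_mult)
  have den: "2 * of_real A - h w \<noteq> 0" if "norm w < R" for w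
  proof
    assume "2 * of_real A - h w = 0"
    then have "Re (2 * of_real A - h w) = 0" by simp
    then show False using A(2)[OF that] A(1) by simp
  qed
  have lt: "norm (h w) < norm (2 * of_real A - h w)" if "norm w < R" for w
  proof -
    have "(norm (h w))\<^sup>2 < (norm (2 * of_real A - h w))\<^sup>2"
    proof -
      have "0 < 4 * A * (A - Re (h w))" using A that by simp
      then show ?thesis
        unfolding cmod_power2 by (simp add: power2_eq_square algebra_simps)
    qed
    then show ?thesis using norm_ge_zero power2_less_imp_less by blast
  qed
  have p_hol: "p holomorphic_on ball 0 1"
  proof -
    have "(h \<circ> (\<lambda>z. of_real R * z)) holomorphic_on ball 0 1"
      by (rule holomorphic_on_compose_gen[OF _ hol]) (use inb in \<open>auto intro!: holomorphic_intros simp del: mem_ball\<close>)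
    then show ?thesis
      unfolding p_def using den inb by (intro holomorphic_intros) (auto simp: o_def)
  qed
  have p_lt: "norm (p w) < 1" if "norm w < 1" for w
    using lt[of "of_real R * w"] den[of "of_real R * w"] inb[OF that]
    by (auto simp: p_def norm_divide field_simps)
  have p_le: "norm (p w) \<le> norm w" if "norm w < 1" for w
    by (rule Schwarz_Lemma(1)[OF p_hol _ p_lt that]) (auto simp: p_def h0)
  have h_le: "norm (h w) \<le> 2 * A" if w: "norm w \<le> R / 2" for w
  proof -
    define v where "v = w / of_real R"
    have v: "norm v \<le> 1/2" "w = of_real R * v"
      using w R by (auto simp: v_def norm_divide field_simps)
    have "norm w < R" using w R by simp
    have "norm (p v) \<le> 1/2" using p_le[of v] v by simp
    then have "2 * norm (h w) \<le> norm (2 * of_real A - h w)"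
      using den[OF \<open>norm w < R\<close>] v(2) by (simp add: p_def norm_divide field_simps)
    also have "\<dots> \<le> 2 * A + norm (h w)"
      using norm_triangle_ineq4[of "2 * of_real A" "h w"] A(1) by (simp add: norm_mult)
    finally show ?thesis by simp
  qed
  have d2: "norm (deriv (deriv h) w) \<le> 64 * A / R\<^sup>2" if w: "norm w \<le> R / 4" for w
  proof -
    have sub: "cball w (R/4) \<subseteq> ball 0 R" "\<And>x. x \<in> cball w (R/4) \<Longrightarrow> norm x \<le> R/2"
    proof -
      show *: "norm x \<le> R/2" if "x \<in> cball w (R/4)" for x
      proof -
        have "norm x \<le> norm w + norm (w - x)"
          by (metis norm_minus_commute norm_triangle_sub)
        then show ?thesis using that w by (simp add: dist_norm)
      qed
      then show "cball w (R/4) \<subseteq> ball 0 R" using R by force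
    qed
    have "norm ((deriv ^^ 2) h w) \<le> fact 2 * (2 * A) / (R/4) ^ 2"
    proof (rule Cauchy_inequality)
      show "h holomorphic_on ball w (R/4)"
        by (rule holomorphic_on_subset[OF hol]) (use sub in \<open>meson ball_subset_cball order_trans\<close>)
      show "continuous_on (cball w (R/4)) h"
        by (rule continuous_on_subset[OF holomorphic_on_imp_continuous_on[OF hol] sub(1)])
      show "norm (h x) \<le> 2 * A" if "norm (w - x) = R/4" for x
        by (rule h_le, rule sub(2)) (use that in \<open>simp add: dist_norm\<close>)
    qed (use R in auto)
    then show ?thesis by (simp add: numeral_2_eq_2 power2_eq_square)
  qed
  have hol': "deriv h holomorphic_on ball 0 R" using hol by (intro holomorphic_intros) auto
  have sub: "cball 0 (R/4) \<subseteq> ball (0::complex) R" using R by auto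
  have d1: "norm (deriv h w) \<le> 64 * A / R\<^sup>2 * norm w" if w: "norm w \<le> R / 4" for w
  proof -
    have "norm (deriv h w - deriv h 0) \<le> 64 * A / R\<^sup>2 * norm (w - 0)"
    proof (rule field_differentiable_bound[where S = "cball 0 (R/4)"])
      show "(deriv h has_field_derivative deriv (deriv h) x) (at x within cball 0 (R/4))"
        if "x \<in> cball 0 (R/4)" for x
        using that sub by (intro holomorphic_derivI[OF hol']) auto
    qed (use w R d2 in auto)
    then show ?thesis using h0 by simp
  qed
  then show "norm (deriv h z) \<le> 64 * A * norm z / R\<^sup>2" using z by (simp add: field_simps)
  have "norm (h z - h 0) \<le> (64 * A / R\<^sup>2 * norm z) * norm (z - 0)"
  proof (rule field_differentiable_bound[where S = "cball 0 (norm z)"])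
    show "(h has_field_derivative deriv h x) (at x within cball 0 (norm z))"
      if "x \<in> cball 0 (norm z)" for x
      using that z R by (intro holomorphic_derivI[OF hol]) auto
    show "norm (deriv h x) \<le> 64 * A / R\<^sup>2 * norm z" if "x \<in> cball 0 (norm z)" for x
    proof -
      have "norm (deriv h x) \<le> 64 * A / R\<^sup>2 * norm x" using that z by (intro d1) auto
      also have "\<dots> \<le> 64 * A / R\<^sup>2 * norm z"
        by (rule mult_left_mono) (use that A in auto)
      finally show ?thesis .
    qed
  qed auto
  then show "norm (h z) \<le> 64 * A * (norm z)\<^sup>2 / R\<^sup>2" using h0 by (simp add: power2_eq_square field_simps)
qed

lemma zorder_even:
  assumes hol: "F holomorphic_on UNIV" and even: "\<And>z. F (- z) = F z" and nz: "F 0 \<noteq> 0"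
  shows "zorder F (- r) = zorder F r"
proof -
  obtain h where h:
    "h holomorphic_on UNIV" "h r \<noteq> 0" "\<And>z. F z = (z - r) ^ nat (zorder F r) * h z"
    by (rule entire_divide_power_zorder[of F r, OF hol]) (use nz in auto)
  define k where "k = nat (zorder F r)"
  have zF: "zorder F r = int k"
    by (rule zorder_eqI[OF open_UNIV _ h(1,2)]) (use h(3) in \<open>auto simp: k_def power_int_def\<close>)
  have "zorder F (- r) = int k"
  proof (rule zorder_eqI[where g = "\<lambda>z. (-1) ^ k * h (- z)"])
    have "(h \<circ> uminus) holomorphic_on UNIV"
      by (rule holomorphic_on_compose_gen[OF _ h(1)]) (auto intro: holomorphic_intros)
    then show "(\<lambda>z. (-1) ^ k * h (- z)) holomorphic_on UNIV"
      by (auto simp: o_def intro: holomorphic_intros)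
    show "F w = (-1) ^ k * h (- w) * (w - - r) powi int k" for w
    proof -
      have "F w = (- w - r) ^ k * h (- w)" using h(3)[of "-w"] even[of w] by (simp add: k_def)
      also have "- w - r = (-1) * (w + r)" by simp
      also have "\<dots> ^ k = (-1) ^ k * (w + r) ^ k" by (rule power_mult_distrib)
      finally show ?thesis by (simp add: mult_ac)
    qed
  qed (use h(2) in auto)
  then show ?thesis using zF by simp
qed

text \<open>A disc centred at 0 is stable under negation, so the truncated product over the zeros of
  an even function is again even.\<close>

definition zeros_upto :: "(complex \<Rightarrow> complex) \<Rightarrow> nat \<Rightarrow> complex set" where
  "zeros_upto F n = {z. F z = 0 \<and> norm z \<le> real n}"

lemma finite_zeros_upto:
  assumes "F holomorphic_on UNIV" "F 0 \<noteq> 0"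
  shows "finite (zeros_upto F n)"
proof (cases "\<exists>z. F z = 0")
  case True
  then obtain w where w: "F w = 0" by auto
  have "\<not> F constant_on UNIV"
  proof
    assume "F constant_on UNIV"
    then obtain c where c: "\<And>z. F z = c" by (auto simp: constant_on_def)
    show False using c[of w] c[of 0] w assms(2) by simp
  qed
  then have "finite {z \<in> cball 0 (real n). F z = 0}"
    using assms by (intro holomorphic_compact_finite_zeros[where S = UNIV]) auto
  then show ?thesis by (rule rev_finite_subset) (auto simp: zeros_upto_def)
next
  case False
  then show ?thesis by (simp add: zeros_upto_def)
qed

text \<open>Hadamard factorisation in genus at most one, with the exponential factor killed by evenness.\<close>
lemma even_entire_factorization:
  assumes hol: "F holomorphic_on UNIV" and even: "\<And>z. F (- z) = F z" and nz: "F 0 \<noteq> 0"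
    and growth: "\<And>e. e > 0 \<Longrightarrow> \<forall>\<^sub>F n in sequentially. \<forall>z. norm z \<le> real n \<longrightarrow> norm (F z) \<le> exp (e * (real n)\<^sup>2)"
  obtains h where "\<And>n. n > 0 \<Longrightarrow> h n holomorphic_on ball 0 (real n)"
    "\<And>n z. n > 0 \<Longrightarrow> norm z < real n \<Longrightarrow>
       F z = F 0 * (\<Prod>r\<in>zeros_upto F n. (1 - z / r) ^ nat (zorder F r)) * exp (h n z)"
    "\<And>z. (\<lambda>n. h n z) \<longlonglongrightarrow> 0" "\<And>z. (\<lambda>n. deriv (h n) z) \<longlonglongrightarrow> 0"
proof -
  define Z where "Z = zeros_upto F"
  define P where "P = (\<lambda>n z. \<Prod>r\<in>Z n. (1 - z / r) ^ nat (zorder F r))"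
  have finZ: "finite (Z n)" for n unfolding Z_def by (rule finite_zeros_upto[OF hol nz])
  have Z0: "0 \<notin> Z n" for n using nz by (auto simp: Z_def zeros_upto_def)
  have P_hol: "P n holomorphic_on A" for n A unfolding P_def by (intro holomorphic_intros) (use Z0 in auto)
  have P0: "P n 0 = 1" for n by (simp add: P_def)
  have P_even: "P n (- z) = P n z" for n z
  proof -
    have "P n (- z) = (\<Prod>r\<in>Z n. (1 - z / (- r)) ^ nat (zorder F (- r)))"
      unfolding P_def by (intro prod.cong refl) (simp add: zorder_even[OF hol even nz])
    also have "\<dots> = P n z"
      unfolding P_def
      by (rule prod.reindex_bij_witness[of _ uminus uminus]) (use even in \<open>auto simp: Z_def zeros_upto_def\<close>)
    finally show ?thesis .
  qed
  \<comment> \<open>The growth clause is quantified over all \<open>M\<close>, because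
    \<open>h n\<close> has to be chosen once and for all, before any rate \<open>e\<close> of the
    growth hypothesis is fixed.\<close>
  define G where "G = (\<lambda>n h. h holomorphic_on ball 0 (real n) \<and>
      (\<forall>z. norm z < real n \<longrightarrow> F z = F 0 * P n z * exp (h z)) \<and> h 0 = 0 \<and> deriv h 0 = 0 \<and>
      (\<forall>M. (\<forall>z. norm z \<le> 2 * real n \<longrightarrow> norm (F z) \<le> exp M) \<longrightarrow>
           (\<forall>z. norm z < real n \<longrightarrow> Re (h z) \<le> M - ln (norm (F 0)))))"
  have "\<exists>h. G n h" if n: "n > 0" for n
  proof -
    from entire_factor_finite_zeros[OF hol nz finZ Z0] obtain g where g: "g holomorphic_on UNIV"
      "\<And>z. F z = P n z * g z" "\<And>r. r \<in> Z n \<Longrightarrow> g r \<noteq> 0" unfolding P_def by metis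
    have g0: "g 0 = F 0" using g(2)[of 0] P0 by simp
    have g_nz: "g z \<noteq> 0" if "norm z < real n" for z
    proof
      assume "g z = 0"
      then have "z \<in> Z n" using that g(2)[of z] by (auto simp: Z_def zeros_upto_def)
      then show False using g(3) \<open>g z = 0\<close> by auto
    qed
    have "(\<lambda>z. g z / g 0) holomorphic_on ball 0 (real n)"
      by (intro holomorphic_intros holomorphic_on_subset[OF g(1)]) (use g0 nz in auto)
    then obtain q where q: "q holomorphic_on ball 0 (real n)" "\<And>z. z \<in> ball 0 (real n) \<Longrightarrow> exp (q z) = g z / g 0"
      using holomorphic_logarithm_exists[of "ball 0 (real n)" "\<lambda>z. g z / g 0" 0] g_nz n g0 nz
      by (metis (no_types, lifting) centre_in_ball convex_ball divide_eq_0_iff dist_0_norm mem_ball of_nat_0_less_iff open_ball)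
    define h where "h = (\<lambda>z. q z - q 0)"
    have h_hol: "h holomorphic_on ball 0 (real n)" unfolding h_def by (intro holomorphic_intros q)
    have exph: "exp (h z) = g z / g 0" if "norm z < real n" for z
      using q(2)[of z] q(2)[of 0] that n g0 nz by (simp add: h_def exp_diff)
    have Fh: "F z = F 0 * P n z * exp (h z)" if "norm z < real n" for z
      using g(2)[of z] exph[OF that] g0 nz by simp
    \<comment> \<open>\<open>F\<close> and the product are both even, hence
      \<open>exp (h (- z)) = exp (h z)\<close> near 0, and differentiating at 0 gives the claim.
      This is what removes the factor exp(b z) from the factorisation.\<close>
    have dh0: "deriv h 0 = 0"
    proof -
      have nn: "real n > 0" using n by simp
      have ev_P: "eventually (\<lambda>z. P n z \<noteq> 0) (nhds 0)"
      proof -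
        have "isCont (P n) 0"
          using P_hol[of n UNIV] holomorphic_on_imp_continuous_on continuous_on_eq_continuous_at open_UNIV by blast
        then have "(P n \<longlongrightarrow> P n 0) (nhds 0)" by (simp add: continuous_at tendsto_at_iff_tendsto_nhds)
        then show ?thesis by (rule tendsto_imp_eventually_ne) (simp add: P0)
      qed
      have ev: "eventually (\<lambda>z. exp (h (- z)) = exp (h z)) (nhds 0)"
        using ev_P eventually_nhds_ball[OF nn, of "0::complex"]
      proof eventually_elim
        case (elim z)
        then show ?case using Fh[of z] Fh[of "-z"] even[of z] P_even[of n z] nz by auto
      qed
      have "(h has_field_derivative deriv h 0) (at 0)"
        using h_hol n by (intro holomorphic_derivI[OF h_hol]) auto
      then have 1: "((\<lambda>z. exp (h z)) has_field_derivative exp (h 0) * deriv h 0) (at 0)"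
        by (auto intro!: derivative_eq_intros)
      then have "((\<lambda>z. exp (h (- z))) has_field_derivative exp (h 0) * deriv h 0 * (-1)) (at 0)"
        by (intro DERIV_chain2[where f = "\<lambda>z. exp (h z)" and g = uminus]) (auto intro!: derivative_eq_intros)
      then have "((\<lambda>z. exp (h z)) has_field_derivative exp (h 0) * deriv h 0 * (-1)) (at 0)"
        using DERIV_cong_ev[OF refl ev refl] by blast
      from DERIV_unique[OF 1 this] have "exp (h 0) * deriv h 0 + exp (h 0) * deriv h 0 = 0" by algebra
      then have "2 * (exp (h 0) * deriv h 0) = 0" by (simp only: mult_2)
      then show ?thesis by simp
    qed
    have bound: "Re (h z) \<le> M - ln (norm (F 0))"
      if M: "\<And>z. norm z \<le> 2 * real n \<Longrightarrow> norm (F z) \<le> exp M" and z: "norm z < real n" for M z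
    proof -
      \<comment> \<open>On the circle of radius \<open>2 * real n\<close> every factor
        \<open>1 - w / r\<close> with \<open>norm r \<le> real n\<close> has modulus at least 1, so
        there \<open>F\<close> bounds \<open>g\<close>; the maximum principle brings the bound
        inside.\<close>
      have "norm (g z) \<le> exp M"
      proof (rule maximum_modulus_frontier[where f = g and S = "cball 0 (2 * real n)"])
        show "norm (g w) \<le> exp M" if "w \<in> frontier (cball 0 (2 * real n))" for w
        proof -
          have w: "norm w = 2 * real n" using that n by (simp add: frontier_cball)
          have "1 \<le> norm (P n w)"
          proof -
            have "1 \<le> (\<Prod>r\<in>Z n. norm ((1 - w / r) ^ nat (zorder F r)))"
            proof (rule prod_ge_1)
              fix r assume r: "r \<in> Z n"
              then have "r \<noteq> 0" "norm r \<le> real n" using Z0[of n] by (auto simp: Z_def zeros_upto_def)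
              then have "2 \<le> norm (w / r)" using w n by (simp add: norm_divide field_simps)
              then have "1 \<le> norm (1 - w / r)"
                using norm_triangle_ineq2[of "w/r" 1] by (simp add: norm_minus_commute)
              then show "1 \<le> norm ((1 - w / r) ^ nat (zorder F r))" by (simp add: norm_power)
            qed
            then show ?thesis by (simp add: P_def prod_norm)
          qed
          then have "norm (g w) \<le> norm (P n w) * norm (g w)"
            by (metis mult_le_cancel_right1 norm_ge_zero not_less)
          also have "\<dots> = norm (F w)" using g(2)[of w] by (simp add: norm_mult)
          also have "\<dots> \<le> exp M" using M w by simp
          finally show ?thesis .
        qed
      qed (use g(1) z holomorphic_on_imp_continuous_on[OF g(1)] in 
           \<open>auto intro: holomorphic_on_subset continuous_on_subset\<close>)
      then have "exp (Re (h z)) \<le> exp M / norm (F 0)"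
        using exph[OF z] g0 nz by (metis divide_right_mono norm_divide norm_exp_eq_Re norm_ge_zero)
      also have "\<dots> = exp (M - ln (norm (F 0)))" using nz by (simp add: exp_diff)
      finally show ?thesis by simp
    qed
    show ?thesis
      unfolding G_def using h_hol Fh dh0 bound by (intro exI[of _ h]) (auto simp: h_def)
  qed
  then have G: "n > 0 \<Longrightarrow> G n (SOME h. G n h)" for n by (rule someI_ex)
  define h where "h = (\<lambda>n. SOME h. G n h)"
  have h: "\<And>n. n > 0 \<Longrightarrow> h n holomorphic_on ball 0 (real n)"
      "\<And>n z. n > 0 \<Longrightarrow> norm z < real n \<Longrightarrow> F z = F 0 * P n z * exp (h n z)"
      "\<And>n. n > 0 \<Longrightarrow> h n 0 = 0" "\<And>n. n > 0 \<Longrightarrow> deriv (h n) 0 = 0"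
      "\<And>n M z. n > 0 \<Longrightarrow> (\<And>z. norm z \<le> 2 * real n \<Longrightarrow> norm (F z) \<le> exp M) \<Longrightarrow> norm z < real n \<Longrightarrow>
            Re (h n z) \<le> M - ln (norm (F 0))"
    using G unfolding G_def h_def by blast+
  have small: "\<forall>\<^sub>F n in sequentially. norm (h n z) < e \<and> norm (deriv (h n) z) < e" if e: "e > 0" for e z
  proof -
    define C where "C = norm z + (norm z)\<^sup>2 + 1"
    have C: "C > 0" "norm z \<le> C" "(norm z)\<^sup>2 \<le> C" unfolding C_def by (auto intro: add_nonneg_pos)
    \<comment> \<open>64 is the constant of the Borel-Caratheodory bound and \<open>C\<close>
      dominates both \<open>norm z\<close> and its square. The 5 is 4 + 1: doubling the radius
      multiplies \<open>e' * (real n)\<^sup>2\<close> by 4, and one more copy absorbs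
      \<open>ln (norm (F 0))\<close>.\<close>
    define e' where "e' = e / (64 * C * 5)"
    have e': "e' > 0" using e C by (simp add: e'_def)
    have "filterlim (\<lambda>n::nat. 2 * n) at_top sequentially"
      by (rule filterlim_subseq) (auto simp: strict_mono_def)
    from eventually_compose_filterlim[OF growth[OF e'] this]
    have ev1: "\<forall>\<^sub>F n in sequentially. \<forall>z. norm z \<le> 2 * real n \<longrightarrow> norm (F z) \<le> exp (e' * (2 * real n)\<^sup>2)"
      by simp
    have ev2: "\<forall>\<^sub>F n in sequentially. \<bar>ln (norm (F 0))\<bar> + 1 < e' * (real n)\<^sup>2"
      using e' by real_asymp
    have ev3: "\<forall>\<^sub>F n in sequentially. norm z * 4 + 1 \<le> real n" by real_asymp
    show ?thesis using ev1 ev2 ev3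
    proof eventually_elim
      case (elim n)
      have n: "n > 0" using elim(3) norm_ge_zero[of z] by (cases "n = 0") auto
      define A where "A = 5 * e' * (real n)\<^sup>2"
      have A: "A > 0" using e' n by (simp add: A_def)
      have Re: "Re (h n w) < A" if "norm w < real n" for w
        using h(5)[OF n _ that, of "e' * (2 * real n)\<^sup>2"] elim by (auto simp: A_def power_mult_distrib)
      have z: "norm z \<le> real n / 4" using elim(3) by simp
      note bc = borel_caratheodory_double_zero[OF h(1)[OF n] _ h(3)[OF n] h(4)[OF n] A Re z]
      have *: "64 * A * x / (real n)\<^sup>2 < e" if "x \<le> C - 1" for x
      proof -
        have "64 * A * x / (real n)\<^sup>2 = 64 * 5 * e' * x" using n by (simp add: A_def)
        also have "\<dots> < 64 * 5 * e' * C" using e' that by simp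
        also have "\<dots> = e" using C by (simp add: e'_def)
        finally show ?thesis .
      qed
      have "norm (deriv (h n) z) < e" "norm (h n z) < e"
        using bc n *[of "norm z"] *[of "(norm z)\<^sup>2"] by (auto simp: C_def intro: le_less_trans)
      then show ?case by simp
    qed
  qed
  have lim: "(\<lambda>n. h n z) \<longlonglongrightarrow> 0" "(\<lambda>n. deriv (h n) z) \<longlonglongrightarrow> 0" for z
    unfolding tendsto_iff
  proof safe
    fix e :: real assume "e > 0"
    from small[OF this, of z]
    show "\<forall>\<^sub>F n in sequentially. dist (h n z) 0 < e" "\<forall>\<^sub>F n in sequentially. dist (deriv (h n) z) 0 < e"
      by (auto elim: eventually_mono)
  qed
  show ?thesis
    by (rule that[of h, OF h(1) h(2)[unfolded P_def Z_def] lim])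
qed

section \<open>Cauchy's formula on a half-plane\<close>

lemma Re_inverse_ge_half:
  assumes "norm z \<le> 1" "z \<noteq> 1"
  shows "Re (1 / (1 - z)) \<ge> 1/2"
proof -
  have "(norm z)\<^sup>2 \<le> 1" using assms by (simp add: power_le_one)
  then have le: "(Re z)\<^sup>2 + (Im z)\<^sup>2 \<le> 1" by (simp add: cmod_power2)
  have "0 < (1 - Re z)\<^sup>2 + (Im z)\<^sup>2"
    using assms by (metis complex_neq_0 diff_0 minus_complex.simps(1) minus_complex.simps(2) one_complex.simps(1) one_complex.simps(2) power2_minus right_minus_eq)
  then show ?thesis using le
    by (simp add: Re_divide field_simps power2_eq_square)
qed

lemma Re_inverse_gt_half:
  assumes "norm z < 1"
  shows "Re (1 / (1 - z)) > 1/2"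
proof -
  have "(norm z)\<^sup>2 < 1" using assms by (simp add: power_less_one_iff)
  then have le: "(Re z)\<^sup>2 + (Im z)\<^sup>2 < 1" by (simp add: cmod_power2)
  have "0 < (1 - Re z)\<^sup>2 + (Im z)\<^sup>2"
    using assms by (metis complex_neq_0 diff_0 minus_complex.simps(1) minus_complex.simps(2) one_complex.simps(1) one_complex.simps(2) power2_minus right_minus_eq norm_one less_irrefl)
  then show ?thesis using le
    by (simp add: Re_divide field_simps power2_eq_square)
qed

text \<open>Cauchy's formula for the derivative at the centre of the disc, transported by
  \<open>s = 1 / (1 - z)\<close>; on the boundary \<open>\<bar>s\<bar>\<^sup>4 = (u\<^sup>2 + 1/4)\<^sup>2\<close>.\<close>
lemma half_plane_integral:
  fixes g :: "complex \<Rightarrow> complex"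
  assumes hol: "g holomorphic_on {s. Re s > 1/2}"
    and cont: "continuous_on {s. Re s \<ge> 1/2} g"
    and growth: "\<And>e. e > 0 \<Longrightarrow> \<exists>R. \<forall>s. Re s \<ge> 1/2 \<longrightarrow> norm s \<ge> R \<longrightarrow> norm (g s) \<le> e * (norm s)\<^sup>2"
  shows "integrable lborel (\<lambda>u. g (Complex (1/2) u) / of_real ((u\<^sup>2 + 1/4)\<^sup>2))"
    and "(\<integral>u. g (Complex (1/2) u) / of_real ((u\<^sup>2 + 1/4)\<^sup>2) \<partial>lborel) = 2 * pi * (2 * g 1 - deriv g 1)"
proof -
  \<comment> \<open>The boundary point z = 1 corresponds to s at infinity. The factor
    \<open>(1 - z)\<^sup>2\<close> is \<open>1 / s\<^sup>2\<close>, so growth o(|s|^2) of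
    \<open>g\<close> is exactly what makes the value 0 at z = 1 a continuous extension.\<close>
  define Q where "Q = (\<lambda>z. if z = 1 then 0 else g (1 / (1 - z)) * (1 - z)\<^sup>2)"
  have cQ: "continuous_on (cball 0 1) Q"
    unfolding continuous_on_eq_continuous_within
  proof
    fix z :: complex assume z: "z \<in> cball 0 1"
    show "continuous (at z within cball 0 1) Q"
    proof (cases "z = 1")
      case True
      have "(Q \<longlongrightarrow> Q 1) (at 1 within cball 0 1)"
        unfolding tendsto_iff
      proof (intro allI impI)
        fix e :: real assume e: "e > 0"
        from growth[of "e/2"] e obtain R where R:
          "\<And>s. Re s \<ge> 1/2 \<Longrightarrow> norm s \<ge> R \<Longrightarrow> norm (g s) \<le> e/2 * (norm s)\<^sup>2" by auto
        define d where "d = 1 / (\<bar>R\<bar> + 1)"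
        have d: "d > 0" by (auto simp: d_def)
        have "\<forall>\<^sub>F z in at 1 within cball 0 1. z \<in> cball 0 1 \<and> z \<noteq> 1 \<and> dist z 1 < d"
          unfolding eventually_at using d by auto
        then show "\<forall>\<^sub>F z in at 1 within cball 0 1. dist (Q z) (Q 1) < e"
        proof eventually_elim
          case (elim z)
          define s where "s = 1 / (1 - z)"
          have z1: "1 - z \<noteq> 0" using elim by auto
          have "norm (1 - z) < d" using elim by (simp add: dist_norm norm_minus_commute)
          then have "1 / d \<le> norm s"
            using d z1 by (simp add: s_def norm_divide divide_left_mono)
          then have "norm s \<ge> R" by (simp add: d_def)
          then have "norm (g s) \<le> e/2 * (norm s)\<^sup>2"
            using R[of s] Re_inverse_ge_half[of z] elim by (simp add: s_def)
          then have "norm (g s) * (norm (1 - z))\<^sup>2 \<le> e/2 * (norm s)\<^sup>2 * (norm (1 - z))\<^sup>2"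
            by (rule mult_right_mono) auto
          also have "\<dots> = e/2" using z1 by (simp add: s_def norm_divide field_simps)
          finally show ?case using elim e by (simp add: Q_def s_def norm_mult norm_power)
        qed
      qed
      then show ?thesis by (simp add: True continuous_within)
    next
      case False
      have "continuous_on (cball 0 1 - {1}) (\<lambda>z. g (1 / (1 - z)) * (1 - z)\<^sup>2)"
        by (intro continuous_intros continuous_on_compose2[OF cont])
           (use Re_inverse_ge_half in \<open>auto\<close>)
      then have "continuous_on (cball 0 1 - {1}) Q"
        by (rule continuous_on_eq) (auto simp: Q_def)
      then have "continuous (at z within (cball 0 1 - {1})) Q"
        using z False by (auto simp: continuous_on_eq_continuous_within)
      moreover have "at z within (cball 0 1 - {1}) = at z within cball 0 1"
        by (rule at_within_nhd[where S = "-{1}"]) (use False in auto)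
      ultimately show ?thesis by simp
    qed
  qed
  have hQ: "Q holomorphic_on ball 0 1"
  proof -
    have "(\<lambda>z. g (1 / (1 - z)) * (1 - z)\<^sup>2) holomorphic_on ball 0 1"
    proof (intro holomorphic_intros)
      have "(g \<circ> (\<lambda>z. 1 / (1 - z))) holomorphic_on ball 0 1"
        by (rule holomorphic_on_compose_gen[OF _ hol])
           (use Re_inverse_gt_half in \<open>auto intro!: holomorphic_intros\<close>)
      then show "(\<lambda>z. g (1 / (1 - z))) holomorphic_on ball 0 1" by (simp add: o_def)
    qed
    then show ?thesis by (rule holomorphic_transform) (auto simp: Q_def)
  qed
  have dQ: "deriv Q 0 = deriv g 1 - 2 * g 1"
  proof (rule DERIV_imp_deriv)
    have dg: "(g has_field_derivative deriv g 1) (at 1)"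
      by (rule holomorphic_derivI[OF hol open_halfspace_Re_gt]) auto
    have "((\<lambda>z. g (1 / (1 - z))) has_field_derivative deriv g 1 * 1) (at 0)"
      by (rule DERIV_chain2[where f = g]) (use dg in \<open>auto intro!: derivative_eq_intros\<close>)
    then have "((\<lambda>z. g (1 / (1 - z)) * (1 - z)\<^sup>2) has_field_derivative deriv g 1 - 2 * g 1) (at 0)"
      by (auto intro!: derivative_eq_intros)
    then show "(Q has_field_derivative deriv g 1 - 2 * g 1) (at 0)"
    proof (rule DERIV_cong_ev[THEN iffD1, rotated 3])
      show "\<forall>\<^sub>F x in nhds 0. g (1 / (1 - x)) * (1 - x)\<^sup>2 = Q x"
        using eventually_nhds_ball[OF zero_less_one, of "0::complex"] by eventually_elim (auto simp: Q_def)
    qed auto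
  qed
  define e where "e = (\<lambda>x::real. exp (2 * of_real pi * \<i> * of_real x))"
  have e_norm: "norm (e x) = 1" for x by (simp add: e_def)
  have e_nz: "e x \<noteq> 0" for x by (simp add: e_def)
  have cE: "continuous_on A (\<lambda>x. Q (e x) / e x)" for A
    by (intro continuous_intros continuous_on_compose2[OF cQ])
       (auto simp: e_nz e_norm e_def intro!: continuous_intros)
  have int1: "((\<lambda>x. Q (e x) / e x) has_integral (deriv g 1 - 2 * g 1)) {0..1}"
  proof -
    have "((\<lambda>u. Q u / (u - 0) ^ Suc 1) has_contour_integral
        of_real (2 * pi) * \<i> / fact 1 * (deriv ^^ 1) Q 0) (circlepath 0 1)"
      by (rule Cauchy_has_contour_integral_higher_derivative_circlepath[OF cQ hQ]) auto
    then have "((\<lambda>x. Q (circlepath 0 1 x) / (circlepath 0 1 x)\<^sup>2 *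
        vector_derivative (circlepath 0 1) (at x within {0..1})) has_integral
        (2 * of_real pi * \<i> * deriv Q 0)) {0..1}"
      by (simp add: has_contour_integral_def power2_eq_square)
    then have "((\<lambda>x. Q (e x) / (e x)\<^sup>2 * (2 * of_real pi * \<i> * e x)) has_integral
        (2 * of_real pi * \<i> * deriv Q 0)) {0..1}"
      proof (rule has_integral_eq[rotated])
      fix x :: real assume x: "x \<in> {0..1}"
      show "Q (circlepath 0 1 x) / (circlepath 0 1 x)\<^sup>2 *
          vector_derivative (circlepath 0 1) (at x within {0..1}) =
          Q (e x) / (e x)\<^sup>2 * (2 * of_real pi * \<i> * e x)"
        using x by (subst vector_derivative_circlepath01) (auto simp: circlepath e_def)
    qed
    from has_integral_mult_right[OF this, of "1 / (2 * of_real pi * \<i>)"]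
    have "((\<lambda>x. 1 / (2 * of_real pi * \<i>) * (Q (e x) / (e x)\<^sup>2 * (2 * of_real pi * \<i> * e x))) has_integral
        1 / (2 * of_real pi * \<i>) * (2 * of_real pi * \<i> * deriv Q 0)) {0..1}" .
    also have "1 / (2 * of_real pi * \<i>) * (2 * of_real pi * \<i> * deriv Q 0) = deriv g 1 - 2 * g 1"
      using dQ by simp
    finally show ?thesis
      by (rule has_integral_eq[rotated]) (use e_nz in \<open>auto simp: power2_eq_square field_simps\<close>)
  qed
  have int2: "(\<lambda>x. Q (e x) / e x) absolutely_integrable_on {0<..<1} \<and>
      integral {0<..<1} (\<lambda>x. Q (e x) / e x) = deriv g 1 - 2 * g 1"
  proof -
    have "(\<lambda>x. Q (e x) / e x) absolutely_integrable_on {0..1}"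
      using absolutely_integrable_continuous[of 0 1 "\<lambda>x. Q (e x) / e x"] cE by simp
    then have "(\<lambda>x. Q (e x) / e x) absolutely_integrable_on {0<..<1}"
      by (rule set_integrable_subset) auto
    moreover have "((\<lambda>x. Q (e x) / e x) has_integral (deriv g 1 - 2 * g 1)) {0<..<1}"
      using int1 has_integral_Icc_iff_Ioo by blast
    ultimately show ?thesis by (auto simp: integral_unique)
  qed
  \<comment> \<open>\<open>x u\<close> is the circle parameter whose point corresponds to c = 1/2 +
    iu: from s = 1/(1 - z) one gets z = 1 - 1/c = - cnj c / c, and c has argument arctan(2u), so z
    has argument pi - 2 arctan(2u). The point z = 1 is omitted, hence the open interval as
    image.\<close>
  define x where "x = (\<lambda>u::real. 1/2 - arctan (2 * u) / pi)"
  define x' where "x' = (\<lambda>u::real. - (1 / (2 * pi * (u\<^sup>2 + 1/4))))"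
  have dx: "(x has_field_derivative x' u) (at u within S)" for u S
  proof -
    have "(x has_field_derivative - (2 / (1 + (2 * u)\<^sup>2)) / pi) (at u within S)"
    proof -
      have "((\<lambda>u. arctan (2 * u)) has_field_derivative inverse (1 + (2 * u)\<^sup>2) * 2) (at u within S)"
        by (rule DERIV_chain2[OF DERIV_arctan]) (auto intro!: derivative_eq_intros)
      then have "((\<lambda>u. 1/2 - arctan (2 * u) / pi) has_field_derivative 0 - inverse (1 + (2 * u)\<^sup>2) * 2 / pi) (at u within S)"
        by (intro DERIV_diff DERIV_const DERIV_cdivide)
      then show ?thesis unfolding x_def by (simp add: inverse_eq_divide)
    qed
    also have "- (2 / (1 + (2 * u)\<^sup>2)) / pi = x' u"
    proof -
      have 1: "1 + (2 * u)\<^sup>2 = 4 * (u\<^sup>2 + 1/4)" by (simp add: power_mult_distrib)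
      have "- (2 / (4 * q)) / pi = - (1 / (2 * pi * q))" for q :: real by simp
      then show ?thesis unfolding x'_def 1 .
    qed
    finally show ?thesis .
  qed
  have inj: "inj_on x UNIV"
  proof (rule inj_onI)
    fix a b assume "x a = x b"
    then have "tan (arctan (2 * a)) = tan (arctan (2 * b))" by (simp add: x_def)
    then show "a = b" by (simp only: tan_arctan)
  qed
  have img: "x ` UNIV = {0<..<1}"
  proof (intro equalityI subsetI)
    fix y assume "y \<in> x ` UNIV"
    then obtain u where "y = x u" by auto
    moreover have "\<bar>arctan (2 * u) / pi\<bar> < 1/2"
      using arctan_bounded[of "2*u"] by (auto simp: abs_if field_simps)
    ultimately show "y \<in> {0<..<1}" unfolding x_def abs_less_iff greaterThanLessThan_iff by linarith
  next
    fix y :: real assume "y \<in> {0<..<1}"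
    then have "arctan (tan (pi * (1/2 - y))) = pi * (1/2 - y)"
      by (intro arctan_tan) (auto simp: field_simps)
    then have "y = x (tan (pi * (1/2 - y)) / 2)" by (simp add: x_def)
    then show "y \<in> x ` UNIV" by blast
  qed
  define G where "G = (\<lambda>u. g (Complex (1/2) u) / of_real ((u\<^sup>2 + 1/4)\<^sup>2))"
  \<comment> \<open>One factor \<open>u\<^sup>2 + 1/4\<close> of the weight is
    \<open>c * cnj c\<close> in the quotient \<open>Q (e (x u)) / e (x u)\<close>; the other is the
    Jacobian \<open>x'\<close>.\<close>
  have eq: "\<bar>x' u\<bar> *\<^sub>R (Q (e (x u)) / e (x u)) = - (1 / (2 * pi)) *\<^sub>R G u" for u
  proof -
    define c where "c = Complex (1/2) u"
    have pos: "u\<^sup>2 + 1/4 > 0" by (auto intro: add_nonneg_pos)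
    have c: "c \<noteq> 0" "cnj c \<noteq> 0" "c * cnj c = of_real (u\<^sup>2 + 1/4)" "c + cnj c = 1"
      by (auto simp: c_def complex_eq_iff power2_eq_square)
    have ccis: "c = of_real (sqrt (1 + (2 * u)\<^sup>2) / 2) * cis (arctan (2 * u))"
      by (auto simp: c_def complex_eq_iff cos_arctan sin_arctan add_pos_nonneg[THEN less_imp_neq, symmetric])
    have "2 * pi * x u = pi + (- arctan (2 * u) - arctan (2 * u))"
      by (simp add: x_def right_diff_distrib)
    then have "e (x u) = cis (pi + (- arctan (2 * u) - arctan (2 * u)))"
      unfolding e_def cis_conv_exp by (metis mult.assoc mult.commute of_real_mult of_real_numeral)
    also have "\<dots> = - (cis (- arctan (2 * u)) / cis (arctan (2 * u)))"
      by (simp only: cis_divide flip: cis_mult) simp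
    also have "cis (- arctan (2 * u)) / cis (arctan (2 * u)) = cnj c / c"
    proof -
      have "sqrt (1 + (2 * u)\<^sup>2) / 2 \<noteq> 0" by (simp add: power_mult_distrib) (use zero_le_power2[of u] in linarith)
      then show ?thesis unfolding ccis by (simp add: cis_cnj)
    qed
    finally have ex: "e (x u) = - cnj c / c"  by simp
    have 1: "1 - e (x u) = 1 / c" using c ex by (simp add: field_simps)
    then have "e (x u) \<noteq> 1" using c by auto
    with 1 have "Q (e (x u)) / e (x u) = g c * (1/c)\<^sup>2 / (- cnj c / c)"
      using c ex by (simp add: Q_def)
    also have "\<dots> = - g c / (c * cnj c)" using c(1,2) by (simp add: field_simps power2_eq_square)
    finally have f1: "Q (e (x u)) / e (x u) = - g c / of_real (u\<^sup>2 + 1/4)" by (simp only: c)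
    have f2: "\<bar>x' u\<bar> = 1 / (2 * pi * (u\<^sup>2 + 1/4))"
      unfolding x'_def using pos by (simp add: abs_mult)
    have f3: "(1 / (2 * pi * q)) *\<^sub>R (- b / of_real q) = - (1 / (2 * pi)) *\<^sub>R (b / of_real (q\<^sup>2))" for q :: real and b :: complex
      by (simp add: scaleR_conv_of_real power2_eq_square)
    show ?thesis unfolding G_def c_def[symmetric] f1 f2 by (rule f3)
  qed
  have int3: "(\<lambda>u. - (1 / (2 * pi)) *\<^sub>R G u) absolutely_integrable_on UNIV \<and>
      integral UNIV (\<lambda>u. - (1 / (2 * pi)) *\<^sub>R G u) = deriv g 1 - 2 * g 1"
    using has_absolute_integral_change_of_variables_real[of UNIV x x' "\<lambda>x. Q (e x) / e x" "deriv g 1 - 2 * g 1"]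
      dx inj int2 by (simp add: img eq del: divide_minus_left scaleR_minus_left)
  have contG: "continuous_on UNIV G"
  proof -
    have nz: "u\<^sup>2 + 1/4 \<noteq> 0" for u :: real using zero_le_power2[of u] by linarith
    have "continuous_on UNIV (\<lambda>u. g (Complex (1/2) u))"
      by (intro continuous_on_compose2[OF cont]) (auto intro!: continuous_intros)
    then show ?thesis unfolding G_def
      by (intro continuous_intros) (auto simp only: of_real_eq_0_iff power_eq_0_iff nz simp_thms)
  qed
  have mG: "G \<in> borel_measurable lborel" using contG borel_measurable_continuous_onI by simp
  have "integrable lebesgue (\<lambda>u. - (1 / (2 * pi)) *\<^sub>R G u)"
    using int3 by (simp add: set_integrable_def)
  then have "integrable lborel (\<lambda>u. - (1 / (2 * pi)) *\<^sub>R G u)"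
    by (subst (asm) integrable_completion) (use mG in auto)
  then have "integrable lborel (\<lambda>u. (- 2 * pi) *\<^sub>R (- (1 / (2 * pi)) *\<^sub>R G u))"
    by (rule integrable_scaleR_right)
  then have iG: "integrable lborel G" by simp
  then show "integrable lborel (\<lambda>u. g (Complex (1/2) u) / of_real ((u\<^sup>2 + 1/4)\<^sup>2))"
    by (simp add: G_def)
  have "- (1 / (2 * pi)) *\<^sub>R integral UNIV G = deriv g 1 - 2 * g 1"
    using int3 by (simp del: scaleR_minus_left)
  then have "(- 2 * pi) *\<^sub>R (- (1 / (2 * pi)) *\<^sub>R integral UNIV G) = (- 2 * pi) *\<^sub>R (deriv g 1 - 2 * g 1)"
    by simp
  then have "integral UNIV G = 2 * pi * (2 * g 1 - deriv g 1)"
    by (simp add: scaleR_conv_of_real algebra_simps)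
  then show "(\<integral>u. g (Complex (1/2) u) / of_real ((u\<^sup>2 + 1/4)\<^sup>2) \<partial>lborel) = 2 * pi * (2 * g 1 - deriv g 1)"
    using integral_lborel[OF iG] by (simp add: G_def)
qed

section \<open>Poisson summation and the theta function\<close>

text \<open>A weak form of Jordan's inequality: t cos t \<le> sin t at t = x/2 gives sin x = 2
  sin(x/2) cos(x/2) \<ge> x cos(x/2)^2, and cos(x/2)^2 \<ge> 1/2 up to x = pi/2.\<close>

lemma sin_ge_half:
  assumes "0 \<le> x" "x \<le> pi / 2"
  shows "x / 2 \<le> sin x"
proof -
  have tc: "t * cos t \<le> sin t" if t: "0 \<le> t" "t \<le> pi / 2" for t :: real
  proof -
    have "sin 0 - 0 * cos 0 \<le> sin t - t * cos t"
    proof (rule DERIV_nonneg_imp_nondecreasing[OF t(1)])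
      fix y :: real assume y: "0 \<le> y" "y \<le> t"
      have "((\<lambda>t. sin t - t * cos t) has_real_derivative y * sin y) (at y)"
        by (auto intro!: derivative_eq_intros)
      moreover have "0 \<le> y * sin y" using y t by (intro mult_nonneg_nonneg sin_ge_zero) auto
      ultimately show "\<exists>z. ((\<lambda>t. sin t - t * cos t) has_real_derivative z) (at y) \<and> 0 \<le> z" by blast
    qed
    then show ?thesis by simp
  qed
  have c: "cos (pi / 4) \<le> cos (x / 2)" using assms by (intro cos_monotone_0_pi_le) auto
  have c0: "0 \<le> cos (x / 2)" by (rule order_trans[OF _ c]) (simp add: cos_45)
  have "(sqrt 2 / 2)\<^sup>2 \<le> (cos (x / 2))\<^sup>2"
    using c by (intro power_mono) (auto simp: cos_45)
  then have "1 / 2 \<le> (cos (x / 2))\<^sup>2" by (simp add: power_divide)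
  then have "x * (1 / 2) \<le> x * (cos (x / 2))\<^sup>2" using assms by (intro mult_left_mono) auto
  also have "\<dots> = 2 * (x / 2 * cos (x / 2)) * cos (x / 2)" by (simp add: power2_eq_square)
  also have "\<dots> \<le> 2 * sin (x / 2) * cos (x / 2)"
    using tc[of "x / 2"] assms c0 by (intro mult_right_mono mult_left_mono) auto
  also have "\<dots> = sin x" using sin_double[of "x / 2"] by simp
  finally show ?thesis by simp
qed

lemma integrable_inverse_1_plus_square_real: "integrable lborel (\<lambda>y::real. 1 / (1 + y\<^sup>2))"
  using integrable_inverse_1_plus_square by (simp add: set_integrable_def einterval_def inverse_eq_divide)

section \<open>The Dirichlet kernel and Poisson summation for even functions\<close>

definition dirichlet_kernel :: "nat \<Rightarrow> real \<Rightarrow> real" where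
  "dirichlet_kernel N y = 1 + 2 * (\<Sum>m=1..N. cos (2 * pi * real m * y))"

lemma sin_times_dirichlet_kernel: "sin (pi * y) * dirichlet_kernel N y = sin ((2 * real N + 1) * pi * y)"
proof (induction N)
  case (Suc N)
  have "2 * sin (pi * y) * cos (2 * pi * real (Suc N) * y) =
      sin ((2 * real (Suc N) + 1) * pi * y) - sin ((2 * real N + 1) * pi * y)"
    by (subst sin_diff_sin) (simp add: algebra_simps add_divide_distrib)
  then show ?case using Suc by (simp add: dirichlet_kernel_def algebra_simps)
qed (simp add: dirichlet_kernel_def)

lemma abs_dirichlet_kernel_le: "\<bar>dirichlet_kernel N y\<bar> \<le> 1 + 2 * real N"
proof -
  have "\<bar>\<Sum>m=1..N. cos (2 * pi * real m * y)\<bar> \<le> (\<Sum>m=1..N. 1)"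
    by (rule order_trans[OF sum_abs]) (intro sum_mono, simp)
  then show ?thesis unfolding dirichlet_kernel_def by (simp add: abs_le_iff)
qed

lemma dirichlet_kernel_measurable [measurable]: "dirichlet_kernel N \<in> borel_measurable borel"
  unfolding dirichlet_kernel_def by measurable

text \<open>Distance to the nearest integer is measured through \<open>\<bar>y\<bar>\<close>, so that even functions
  can be sampled at natural numbers.\<close>
definition near :: "real \<Rightarrow> nat" where "near y = nat \<lfloor>\<bar>y\<bar> + 1/2\<rfloor>"

lemma near_measurable [measurable]: "near \<in> measurable borel (count_space UNIV)"
  unfolding near_def by measurable

lemma near_bounds: "real (near y) - 1/2 \<le> \<bar>y\<bar>" "\<bar>y\<bar> < real (near y) + 1/2"
proof -
  have "0 \<le> \<lfloor>\<bar>y\<bar> + 1/2\<rfloor>" by simp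
  then have "real (near y) = of_int \<lfloor>\<bar>y\<bar> + 1/2\<rfloor>" by (simp add: near_def)
  then show "real (near y) - 1/2 \<le> \<bar>y\<bar>" "\<bar>y\<bar> < real (near y) + 1/2" by linarith+
qed

lemma near_eqI: "real n - 1/2 \<le> \<bar>y\<bar> \<Longrightarrow> \<bar>y\<bar> < real n + 1/2 \<Longrightarrow> near y = n"
  using near_bounds[of y] by linarith

text \<open>The sine has only simple zeros at the integers, so it can be divided into a difference
  \<open>g y - g (near y)\<close>, which is also of first order in the distance to the nearest
  integer.\<close>

lemma abs_sin_near: "\<bar>sin (pi * y)\<bar> \<ge> \<bar>\<bar>y\<bar> - real (near y)\<bar>"
proof -
  define t where "t = \<bar>\<bar>y\<bar> - real (near y)\<bar>"
  have t: "0 \<le> t" "t \<le> 1/2" using near_bounds[of y] unfolding t_def by linarith+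
  have "\<bar>sin (pi * y)\<bar> = \<bar>sin (pi * \<bar>y\<bar>)\<bar>" by (cases "y \<ge> 0") auto
  also have "pi * \<bar>y\<bar> = pi * (\<bar>y\<bar> - real (near y)) + pi * real (near y)" by (simp add: algebra_simps)
  also have "\<bar>sin \<dots>\<bar> = \<bar>sin (pi * (\<bar>y\<bar> - real (near y)))\<bar>"
    by (simp add: sin_add abs_mult mult.commute[of pi "real _"])
  also have "\<dots> = \<bar>sin (pi * t)\<bar>" proof (cases "\<bar>y\<bar> - real (near y) \<ge> 0")
    case False
    then have "t = - (\<bar>y\<bar> - real (near y))" by (simp add: t_def)
    then show ?thesis by (simp only: mult_minus_right sin_minus abs_minus_cancel)
  qed (simp add: t_def)
  finally have eq: "\<bar>sin (pi * y)\<bar> = \<bar>sin (pi * t)\<bar>" .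
  have "t \<le> pi * t / 2" using t pi_ge_two mult_right_mono[of 2 pi t] by simp
  also have "\<dots> \<le> sin (pi * t)" using t by (intro sin_ge_half) auto
  also have "\<dots> \<le> \<bar>sin (pi * t)\<bar>" by simp
  finally show ?thesis unfolding eq t_def .
qed

text \<open>Moving the argument by at most 1 costs a factor 3: \<open>1 + y\<^sup>2\<close> is at
  most 1 + (|x| + 1)^2, hence at most 3 + 2 x^2.\<close>

lemma inverse_1_plus_square_shift:
  fixes x y :: real
  assumes "\<bar>x\<bar> \<ge> \<bar>y\<bar> - 1"
  shows "1 / (1 + x\<^sup>2) \<le> 3 / (1 + y\<^sup>2)"
proof -
  have "\<bar>y\<bar>\<^sup>2 \<le> (\<bar>x\<bar> + 1)\<^sup>2" using assms by (intro power_mono) auto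
  also have "\<dots> \<le> 2 * x\<^sup>2 + 2" using zero_le_power2[of "\<bar>x\<bar> - 1"] by (simp add: power2_eq_square algebra_simps abs_mult_self)
  finally have "\<bar>y\<bar>\<^sup>2 \<le> 2 * x\<^sup>2 + 2" .
  then have "1 + y\<^sup>2 \<le> 1 + (2 * x\<^sup>2 + 2)" by (simp only: power2_abs add_left_mono)
  also have "\<dots> \<le> 3 * (1 + x\<^sup>2)" by simp
  finally have "1 + y\<^sup>2 \<le> 3 * (1 + x\<^sup>2)" .
  moreover have "1 + x\<^sup>2 > 0" "1 + y\<^sup>2 > 0" by (auto intro: add_pos_nonneg)
  ultimately show ?thesis by (simp add: field_simps)
qed

text \<open>The difference of \<open>g\<close> and its samples is \<open>\<phi> y * sin (\<pi> y)\<close> with \<open>\<phi>\<close> integrable; as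
  \<open>sin\<close> changes sign under the shift by half a period, \<open>\<integral> \<phi> y sin ((2N+1) \<pi> y)\<close> is half of
  \<open>\<integral> (\<phi> y - \<phi> (y + 1/(2N+1))) sin ((2N+1) \<pi> y)\<close>, which tends to 0.\<close>
lemma dirichlet_kernel_sampling_error:
  fixes g g' :: "real \<Rightarrow> real"
  assumes even: "\<And>y. g (- y) = g y" and der: "\<And>y. (g has_real_derivative g' y) (at y)"
    and bd: "\<And>y. \<bar>g y\<bar> \<le> C / (1 + y\<^sup>2)" and bd': "\<And>y. \<bar>g' y\<bar> \<le> C / (1 + y\<^sup>2)"
  shows "(\<lambda>N. \<integral>y. (g y - g (near y)) * dirichlet_kernel N y \<partial>lborel) \<longlonglongrightarrow> 0"
proof -
  define \<phi> where "\<phi> = (\<lambda>y. (g y - g (near y)) / sin (pi * y))"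
  have contg: "continuous_on UNIV g" using der DERIV_isCont continuous_at_imp_continuous_on by blast
  have [measurable]: "g \<in> borel_measurable borel" by (rule borel_measurable_continuous_onI[OF contg])
  have mphi [measurable]: "\<phi> \<in> borel_measurable borel"
    unfolding \<phi>_def by measurable
  have C0: "C \<ge> 0" using bd[of 0] by simp
  have gabs: "g \<bar>y\<bar> = g y" for y using even[of y] by (simp add: abs_if)
  have num: "\<bar>g y - g (near y)\<bar> \<le> \<bar>\<bar>y\<bar> - real (near y)\<bar> * (3 * C / (1 + y\<^sup>2))" for y
  proof -
    have "norm (g \<bar>y\<bar> - g (real (near y))) \<le> (3 * C / (1 + y\<^sup>2)) * norm (\<bar>y\<bar> - real (near y))"
    proof (rule field_differentiable_bound[where S = "closed_segment \<bar>y\<bar> (real (near y))" and f' = g'])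
      show "(g has_field_derivative g' z) (at z within closed_segment \<bar>y\<bar> (real (near y)))" for z
        using der by (rule has_field_derivative_at_within)
      show "norm (g' z) \<le> 3 * C / (1 + y\<^sup>2)" if "z \<in> closed_segment \<bar>y\<bar> (real (near y))" for z
      proof -
        have "\<bar>z\<bar> \<ge> \<bar>y\<bar> - 1"
          using that near_bounds[of y] by (auto simp: closed_segment_eq_real_ivl split: if_splits)
        from inverse_1_plus_square_shift[OF this]
        have "C * (1 / (1 + z\<^sup>2)) \<le> C * (3 / (1 + y\<^sup>2))" using C0 by (rule mult_left_mono)
        then show ?thesis using bd'[of z] by (simp add: mult.commute)
      qed
    qed auto
    then show ?thesis by (simp add: gabs mult.commute)
  qed
  \<comment> \<open>At an integer the quotient \<open>\<phi> y\<close> is 0 because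
    \<open>x / 0 = 0\<close>; the numerator vanishes there too, so that the bound here and the
    identity \<open>IN\<close> below hold without exception.\<close>
  have bphi: "\<bar>\<phi> y\<bar> \<le> 3 * C / (1 + y\<^sup>2)" for y
  proof (cases "sin (pi * y) = 0")
    case True
    then show ?thesis using C0 by (simp add: \<phi>_def add_nonneg_nonneg)
  next
    case False
    have p: "1 + y\<^sup>2 > 0" by (intro add_pos_nonneg) auto
    have "\<bar>g y - g (near y)\<bar> \<le> \<bar>sin (pi * y)\<bar> * (3 * C / (1 + y\<^sup>2))"
      using num[of y] abs_sin_near[of y] C0 p
      by (elim order_trans) (intro mult_right_mono divide_nonneg_nonneg, auto)
    then show ?thesis using False by (simp add: \<phi>_def abs_divide divide_le_eq mult.commute)
  qed
  have dom: "integrable lborel (\<lambda>y. K / (1 + y\<^sup>2))" for K :: real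
    using integrable_mult_right[OF integrable_inverse_1_plus_square_real, of K] by simp
  have iphi: "integrable lborel (\<lambda>y. \<phi> y * s y)" if [measurable]: "s \<in> borel_measurable borel" and "\<And>y. \<bar>s y\<bar> \<le> 1" for s
  proof (rule Bochner_Integration.integrable_bound[OF dom[of "3 * C"]])
    show "AE y in lborel. norm (\<phi> y * s y) \<le> norm (3 * C / (1 + y\<^sup>2))"
    proof (rule AE_I2)
      fix y
      have "\<bar>\<phi> y\<bar> * \<bar>s y\<bar> \<le> (3 * C / (1 + y\<^sup>2)) * 1"
        using bphi that(2) by (intro mult_mono) (auto intro: order_trans[OF _ bphi])
      then show "norm (\<phi> y * s y) \<le> norm (3 * C / (1 + y\<^sup>2))"
        using C0 by (simp add: abs_mult)
    qed
  qed measurable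
  define I where "I = (\<lambda>N::nat. \<integral>y. \<phi> y * sin ((2 * real N + 1) * pi * y) \<partial>lborel)"
  define h where "h = (\<lambda>N::nat. 1 / (2 * real N + 1))"
  have IN: "(\<integral>y. (g y - g (near y)) * dirichlet_kernel N y \<partial>lborel) = I N" for N
    unfolding I_def
  proof (rule Bochner_Integration.integral_cong[OF refl])
    fix y
    show "(g y - g (near y)) * dirichlet_kernel N y = \<phi> y * sin ((2 * real N + 1) * pi * y)"
    proof (cases "sin (pi * y) = 0")
      case True
      then have "\<bar>y\<bar> = real (near y)" using abs_sin_near[of y] by simp
      then have "g y = g (near y)" using gabs[of y] by simp
      then show ?thesis by (simp add: \<phi>_def)
    next
      case False
      then show ?thesis by (simp add: \<phi>_def flip: sin_times_dirichlet_kernel)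
    qed
  qed
  have shift: "2 * I N = (\<integral>y. (\<phi> y - \<phi> (y + h N)) * sin ((2 * real N + 1) * pi * y) \<partial>lborel)" for N
  proof -
    have "I N = (\<integral>y. \<phi> (h N + 1 * y) * sin ((2 * real N + 1) * pi * (h N + 1 * y)) \<partial>lborel)"
      unfolding I_def by (subst lborel_integral_real_affine[where c = 1 and t = "h N"]) auto
    also have "\<dots> = (\<integral>y. - (\<phi> (y + h N) * sin ((2 * real N + 1) * pi * y)) \<partial>lborel)"
    proof (rule Bochner_Integration.integral_cong[OF refl])
      fix y
      have "(2 * real N + 1) * pi * (h N + 1 * y) = (2 * real N + 1) * pi * y + pi"
        by (simp add: h_def field_simps)
      then show "\<phi> (h N + 1 * y) * sin ((2 * real N + 1) * pi * (h N + 1 * y)) =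
          - (\<phi> (y + h N) * sin ((2 * real N + 1) * pi * y))"
        by (simp add: add.commute)
    qed
    finally have 1: "I N = - (\<integral>y. \<phi> (y + h N) * sin ((2 * real N + 1) * pi * y) \<partial>lborel)" by simp
    have 2: "integrable lborel (\<lambda>y. \<phi> (y + h N) * sin ((2 * real N + 1) * pi * y))"
    proof -
      have "integrable lborel (\<lambda>y. \<phi> (h N + 1 * y) * sin ((2 * real N + 1) * pi * (h N + 1 * y - h N)))"
        by (rule lborel_integrable_real_affine[OF iphi]) auto
      then show ?thesis by (simp add: add.commute)
    qed
    have 3: "integrable lborel (\<lambda>y. \<phi> y * sin ((2 * real N + 1) * pi * y))" by (rule iphi) auto
    show ?thesis
      unfolding left_diff_distrib using 1 by (subst Bochner_Integration.integral_diff[OF 3 2]) (simp add: I_def)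
  qed
  \<comment> \<open>Continuity can fail at integers, where the sine vanishes, and at half-integers,
    where \<open>near\<close> jumps. Both kinds satisfy \<open>2 * y \<in> \<int>\<close>, a
    countable condition.\<close>
  have cont: "isCont \<phi> y" if y: "2 * y \<notin> \<int>" for y
  proof -
    have sn: "sin (pi * y) \<noteq> 0"
    proof
      assume "sin (pi * y) = 0"
      then obtain i :: int where "pi * y = of_int i * pi" by (auto simp: sin_zero_iff_int2)
      then have "2 * y = of_int (2 * i)" by simp
      then show False using y Ints_of_int by metis
    qed
    have "\<bar>y\<bar> \<noteq> real (near y) - 1/2"
    proof
      assume "\<bar>y\<bar> = real (near y) - 1/2"
      then have "2 * y = of_int (2 * int (near y) - 1) \<or> 2 * y = of_int (1 - 2 * int (near y))" by (auto simp: abs_if split: if_splits)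
      then show False using y Ints_of_int by metis
    qed
    then have "real (near y) - 1/2 < \<bar>y\<bar>" "\<bar>y\<bar> < real (near y) + 1/2" using near_bounds[of y] by auto
    then have "\<forall>\<^sub>F z in nhds y. real (near y) - 1/2 < \<bar>z\<bar>" "\<forall>\<^sub>F z in nhds y. \<bar>z\<bar> < real (near y) + 1/2"
      using order_tendstoD[OF tendsto_rabs[OF filterlim_ident[of "nhds y"]]] by auto
    then have ev: "\<forall>\<^sub>F z in nhds y. (g z - g (near y)) / sin (pi * z) = \<phi> z"
    proof eventually_elim
      case (elim z)
      then have "near z = near y" by (intro near_eqI) auto
      then show ?case by (simp add: \<phi>_def)
    qed
    moreover have "isCont (\<lambda>z. (g z - g (near y)) / sin (pi * z)) y"
      using sn DERIV_isCont[OF der] by (intro continuous_intros) auto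
    ultimately show ?thesis using isCont_cong[OF ev] by blast
  qed
  have "(\<lambda>N. \<integral>y. (\<phi> y - \<phi> (y + h N)) * sin ((2 * real N + 1) * pi * y) \<partial>lborel) \<longlonglongrightarrow> (\<integral>y. 0 \<partial>(lborel :: real measure))"
  proof (rule integral_dominated_convergence[where w = "\<lambda>y. 12 * C / (1 + y\<^sup>2)"])
    show "integrable lborel (\<lambda>y. 12 * C / (1 + y\<^sup>2))" by (rule dom)
    have cnt: "countable {y::real. 2 * y \<in> \<int>}"
    proof -
      have "{y::real. 2 * y \<in> \<int>} \<subseteq> (\<lambda>i::int. of_int i / 2) ` UNIV" by (auto elim!: Ints_cases simp: image_iff field_simps)
      then show ?thesis by (rule countable_subset) auto
    qed
    have "AE y in lborel. y \<notin> {y::real. 2 * y \<in> \<int>}"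
      by (rule AE_not_in[OF countable_imp_null_set_lborel[OF cnt]])
    then show "AE y in lborel. (\<lambda>N. (\<phi> y - \<phi> (y + h N)) * sin ((2 * real N + 1) * pi * y)) \<longlonglongrightarrow> 0"
    proof eventually_elim
      case (elim y)
      then have c: "isCont \<phi> y" using cont by auto
      have "h \<longlonglongrightarrow> 0" unfolding h_def by real_asymp
      then have "(\<lambda>N. y + h N) \<longlonglongrightarrow> y + 0" by (intro tendsto_intros)
      then have "(\<lambda>N. \<phi> (y + h N)) \<longlonglongrightarrow> \<phi> y" using isCont_tendsto_compose[OF c] by simp
      then have "(\<lambda>N. \<phi> y - \<phi> (y + h N)) \<longlonglongrightarrow> \<phi> y - \<phi> y" by (intro tendsto_intros)
      then show ?case by (intro lim_null_mult_right_bounded[where B = 1]) auto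
    qed
    \<comment> \<open>12 = 3 + 9: the shift by \<open>h N \<le> 1\<close> triples the bound
      \<open>3 * C / (1 + y\<^sup>2)\<close> for the second term.\<close>
    show "AE y in lborel. norm ((\<phi> y - \<phi> (y + h N)) * sin ((2 * real N + 1) * pi * y)) \<le> 12 * C / (1 + y\<^sup>2)" for N
    proof (rule AE_I2)
      fix y :: real
      have h: "0 \<le> h N" "h N \<le> 1" by (auto simp: h_def)
      have "1 / (1 + (y + h N)\<^sup>2) \<le> 3 / (1 + y\<^sup>2)"
        by (rule inverse_1_plus_square_shift) (use h in auto)
      then have "3 * C * (1 / (1 + (y + h N)\<^sup>2)) \<le> 3 * C * (3 / (1 + y\<^sup>2))" using C0 by (intro mult_left_mono) auto
      then have "\<bar>\<phi> y - \<phi> (y + h N)\<bar> \<le> 12 * C / (1 + y\<^sup>2)"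
        using bphi[of y] bphi[of "y + h N"] add_divide_distrib[of "3 * C" "9 * C" "1 + y\<^sup>2"] by simp
      then have "\<bar>\<phi> y - \<phi> (y + h N)\<bar> * \<bar>sin ((2 * real N + 1) * pi * y)\<bar> \<le> 12 * C / (1 + y\<^sup>2) * 1"
        by (intro mult_mono) (auto intro: order_trans[OF abs_ge_zero])
      then show "norm ((\<phi> y - \<phi> (y + h N)) * sin ((2 * real N + 1) * pi * y)) \<le> 12 * C / (1 + y\<^sup>2)"
        by (simp add: abs_mult)
    qed
  qed (measurable)
  then have "(\<lambda>N. 2 * I N) \<longlonglongrightarrow> 0" by (simp add: shift)
  then have "(\<lambda>N. 1/2 * (2 * I N)) \<longlonglongrightarrow> 1/2 * 0" by (rule tendsto_mult_left)
  then show ?thesis by (simp add: IN)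
qed

lemma AE_two_not_Ints: "AE y in lborel. 2 * (y::real) \<notin> \<int>"
proof -
  have "{y::real. 2 * y \<in> \<int>} \<subseteq> (\<lambda>i::int. of_int i / 2) ` UNIV"
    by (auto elim!: Ints_cases simp: image_iff field_simps)
  then have "countable {y::real. 2 * y \<in> \<int>}" by (rule countable_subset) auto
  from AE_not_in[OF countable_imp_null_set_lborel[OF this]] show ?thesis by simp
qed

text \<open>The antiderivative \<open>S\<close> is \<open>y\<close> plus sines of 2 pi m y, which
  vanish at half-integers; only the linear part survives between the endpoints.\<close>

lemma dirichlet_kernel_integral_Icc:
  fixes k :: int
  shows "has_bochner_integral lborel (\<lambda>y. indicator {of_int k - 1/2..of_int k + 1/2} y * dirichlet_kernel N y) 1"
proof -
  define S where "S = (\<lambda>y. y + 2 * (\<Sum>m=1..N. sin (2 * pi * real m * y) / (2 * pi * real m)))"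
  have der: "(S has_real_derivative dirichlet_kernel N y) (at y)" for y
    unfolding S_def dirichlet_kernel_def
    by (auto intro!: derivative_eq_intros sum.cong simp: field_simps)
  have cont: "isCont (dirichlet_kernel N) y" for y
    unfolding dirichlet_kernel_def by (intro continuous_intros)
  have Sk: "S (of_int j / 2) = of_int j / 2" if "odd j" for j :: int
  proof -
    have "sin (2 * pi * real m * (of_int j / 2)) = 0" for m
    proof -
      have "2 * pi * real m * (of_int j / 2) = of_int (int m * j) * pi" by simp
      then show ?thesis unfolding sin_zero_iff_int2 by (intro exI)
    qed
    then show ?thesis by (simp add: S_def)
  qed
  have "has_bochner_integral lborel (\<lambda>y. indicator {of_int k - 1/2..of_int k + 1/2} y *\<^sub>R dirichlet_kernel N y)
      (S (of_int k + 1/2) - S (of_int k - 1/2))"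
    by (rule has_bochner_integral_FTC_Icc)
       (use der cont in \<open>auto simp: has_real_derivative_iff_has_vector_derivative[symmetric]
          intro: has_field_derivative_at_within continuous_at_imp_continuous_on\<close>)
  also have "S (of_int k + 1/2) - S (of_int k - 1/2) = 1"
    using Sk[of "2 * k + 1"] Sk[of "2 * k - 1"] by (simp add: field_simps)
  finally show ?thesis by simp
qed

text \<open>Up to null endpoints, \<open>near y = n\<close> describes one unit interval for n = 0
  and two, around n and -n, otherwise. The values 1 and 2 become the weights of \<open>g 0\<close>
  and of the later samples in Poisson summation.\<close>

lemma dirichlet_kernel_integral_near:
  "has_bochner_integral lborel (\<lambda>y. indicator {y. near y = n} y * dirichlet_kernel N y) (if n = 0 then 1 else 2)"
proof (cases "n = 0")
  case True
  have "has_bochner_integral lborel (\<lambda>y. indicator {-1/2..1/2} y * dirichlet_kernel N y) 1"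
    using dirichlet_kernel_integral_Icc[of 0] by simp
  moreover have "AE y in lborel. indicator {-1/2..1/2} y * dirichlet_kernel N y =
      indicator {y. near y = n} y * dirichlet_kernel N y"
    using AE_two_not_Ints
  proof eventually_elim
    case (elim y)
    have "\<bar>y\<bar> \<noteq> 1/2"
    proof
      assume "\<bar>y\<bar> = 1/2"
      then have "2 * y = of_int 1 \<or> 2 * y = of_int (- 1)" by (auto simp: abs_if split: if_splits)
      then show False using elim Ints_of_int by metis
    qed
    moreover have "near y = 0 \<longleftrightarrow> \<bar>y\<bar> < 1/2"
      using near_bounds[of y] near_eqI[of 0 y] by auto
    ultimately show ?case using True by (auto simp: indicator_def abs_if split: if_splits)
  qed
  ultimately have "has_bochner_integral lborel (\<lambda>y. indicator {y. near y = n} y * dirichlet_kernel N y) 1"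
    by (subst (asm) has_bochner_integral_cong_AE) auto
  then show ?thesis using True by simp
next
  case False
  have "has_bochner_integral lborel (\<lambda>y. indicator {of_int (int n) - 1/2..of_int (int n) + 1/2} y * dirichlet_kernel N y +
      indicator {of_int (- int n) - 1/2..of_int (- int n) + 1/2} y * dirichlet_kernel N y) (1 + 1)"
    by (intro has_bochner_integral_add dirichlet_kernel_integral_Icc)
  moreover have "AE y in lborel. indicator {of_int (int n) - 1/2..of_int (int n) + 1/2} y * dirichlet_kernel N y +
      indicator {of_int (- int n) - 1/2..of_int (- int n) + 1/2} y * dirichlet_kernel N y =
      indicator {y. near y = n} y * dirichlet_kernel N y"
    using AE_two_not_Ints
  proof eventually_elim
    case (elim y)
    have ne: "\<bar>y\<bar> \<noteq> real n - 1/2" "\<bar>y\<bar> \<noteq> real n + 1/2"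
    proof -
      show "\<bar>y\<bar> \<noteq> real n - 1/2"
      proof
        assume "\<bar>y\<bar> = real n - 1/2"
        then have "2 * y = of_int (2 * int n - 1) \<or> 2 * y = of_int (1 - 2 * int n)" by (auto simp: abs_if split: if_splits)
        then show False using elim Ints_of_int by metis
      qed
      show "\<bar>y\<bar> \<noteq> real n + 1/2"
      proof
        assume "\<bar>y\<bar> = real n + 1/2"
        then have "2 * y = of_int (2 * int n + 1) \<or> 2 * y = of_int (- 1 - 2 * int n)" by (auto simp: abs_if split: if_splits)
        then show False using elim Ints_of_int by metis
      qed
    qed
    have "near y = n \<longleftrightarrow> real n - 1/2 \<le> \<bar>y\<bar> \<and> \<bar>y\<bar> < real n + 1/2"
      using near_bounds[of y] near_eqI[of n y] by auto
    moreover have "real n \<ge> 1" using False by simp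
    ultimately show ?case using ne by (auto simp: indicator_def abs_if split: if_splits)
  qed
  ultimately have "has_bochner_integral lborel (\<lambda>y. indicator {y. near y = n} y * dirichlet_kernel N y) (1 + 1)"
    by (subst (asm) has_bochner_integral_cong_AE) auto
  then show ?thesis using False by simp
qed

text \<open>The sampled function is constant on each set \<open>near y = n\<close>, so its integral
  is a sum of integrals of the kernel. \<open>N\<close> is fixed, and the crude bound 1 + 2N for the
  kernel justifies the exchange; the value of the integral is the same for every
  \<open>N\<close>.\<close>

lemma dirichlet_kernel_integral_samples:
  fixes g :: "real \<Rightarrow> real"
  assumes bd: "\<And>y. \<bar>g y\<bar> \<le> C / (1 + y\<^sup>2)"
  shows "integrable lborel (\<lambda>y. g (near y) * dirichlet_kernel N y)"
    and "(\<integral>y. g (near y) * dirichlet_kernel N y \<partial>lborel) = g 0 + 2 * (\<Sum>n. g (real (Suc n)))"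
    and "summable (\<lambda>n. g (real (Suc n)))"
proof -
  have C0: "C \<ge> 0" using bd[of 0] by simp
  have "summable (\<lambda>n. \<bar>g (real (Suc n))\<bar>)"
  proof (rule summable_comparison_test')
    show "summable (\<lambda>n. C * inverse (real (Suc n) ^ 2))"
      by (intro summable_mult summable_Suc_iff[THEN iffD2] inverse_power_summable) auto
    show "norm \<bar>g (real (Suc n))\<bar> \<le> C * inverse (real (Suc n) ^ 2)" for n
    proof -
      have "C / (1 + (real (Suc n))\<^sup>2) \<le> C / (real (Suc n))\<^sup>2"
        using C0 by (intro divide_left_mono mult_pos_pos add_pos_nonneg) auto
      then show ?thesis using bd[of "real (Suc n)"] by (simp add: divide_inverse)
    qed
  qed
  then have sumabs: "summable (\<lambda>n. \<bar>g (real n)\<bar>)" by (subst (asm) summable_Suc_iff)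
  define f where "f = (\<lambda>n y. g (real n) * (indicator {y. near y = n} y * dirichlet_kernel N y))"
  have if': "integrable lborel (f n)" for n
    unfolding f_def using dirichlet_kernel_integral_near[of n N] by (intro integrable_mult_right) (auto dest: integrable.intros)
  have fsum: "(\<lambda>n. f n y) sums (g (near y) * dirichlet_kernel N y)" for y
  proof -
    have "(\<lambda>n. if n = near y then g (near y) * dirichlet_kernel N y else 0) sums (g (near y) * dirichlet_kernel N y)"
      by (rule sums_single)
    moreover have "f n y = (if n = near y then g (near y) * dirichlet_kernel N y else 0)" for n by (simp add: f_def)
    ultimately show ?thesis by simp
  qed
  have AEs: "AE y in lborel. summable (\<lambda>n. norm (f n y))"
  proof (rule AE_I2)
    fix y
    show "summable (\<lambda>n. norm (f n y))"
      by (rule summable_finite[of "{near y}"]) (auto simp: f_def)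
  qed
  have ind_int: "integrable lborel (indicator {y. near y = n} :: real \<Rightarrow> real)"
      "integral\<^sup>L lborel (indicator {y. near y = n} :: real \<Rightarrow> real) \<le> 2" for n
    using dirichlet_kernel_integral_near[of n 0] by (auto simp: dirichlet_kernel_def has_bochner_integral_iff split: if_splits)
  have sn: "summable (\<lambda>n. \<integral>y. norm (f n y) \<partial>lborel)"
  proof (rule summable_comparison_test')
    show "summable (\<lambda>n. \<bar>g (real n)\<bar> * ((1 + 2 * real N) * 2))" by (intro summable_mult2 sumabs)
    show "norm (\<integral>y. norm (f n y) \<partial>lborel) \<le> \<bar>g (real n)\<bar> * ((1 + 2 * real N) * 2)" for n
    proof -
      have "(\<integral>y. norm (f n y) \<partial>lborel) \<le> (\<integral>y. \<bar>g (real n)\<bar> * ((1 + 2 * real N) * indicator {y. near y = n} y) \<partial>lborel)"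
      proof (rule integral_mono)
        show "integrable lborel (\<lambda>y. norm (f n y))" using if' by (rule integrable_norm)
        show "integrable lborel (\<lambda>y. \<bar>g (real n)\<bar> * ((1 + 2 * real N) * indicator {y. near y = n} y))"
          by (intro integrable_mult_right ind_int)
        show "norm (f n y) \<le> \<bar>g (real n)\<bar> * ((1 + 2 * real N) * indicator {y. near y = n} y)" for y
          using abs_dirichlet_kernel_le[of N y]
          by (auto simp: f_def abs_mult indicator_def intro!: mult_left_mono)
      qed
      also have "\<dots> = \<bar>g (real n)\<bar> * ((1 + 2 * real N) * integral\<^sup>L lborel (indicator {y. near y = n}))" by simp
      also have "\<dots> \<le> \<bar>g (real n)\<bar> * ((1 + 2 * real N) * 2)"
        using ind_int by (intro mult_left_mono) auto
      finally show ?thesis by simp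
    qed
  qed
  have su: "(\<Sum>n. f n y) = g (near y) * dirichlet_kernel N y" for y using fsum sums_unique by metis
  show "integrable lborel (\<lambda>y. g (near y) * dirichlet_kernel N y)"
    using integrable_suminf[OF if' AEs sn] by (simp add: su)
  have sg: "summable (\<lambda>n. g (real n))" using sumabs by (rule summable_rabs_cancel)
  then show sg': "summable (\<lambda>n. g (real (Suc n)))" by (subst summable_Suc_iff)
  have "(\<integral>y. g (near y) * dirichlet_kernel N y \<partial>lborel) = (\<Sum>n. \<integral>y. f n y \<partial>lborel)"
    using integral_suminf[OF if' AEs sn] by (simp add: su)
  also have "(\<lambda>n. \<integral>y. f n y \<partial>lborel) = (\<lambda>n. g (real n) * (if n = 0 then 1 else 2))"
    unfolding f_def using dirichlet_kernel_integral_near[of _ N] by (auto simp: has_bochner_integral_iff)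
  also have "(\<Sum>n. g (real n) * (if n = 0 then 1 else 2)) = g 0 + (\<Sum>n. 2 * g (real (Suc n)))"
  proof -
    have "(\<lambda>n. g (real (Suc n)) * (if Suc n = 0 then 1 else 2)) sums (\<Sum>n. 2 * g (real (Suc n)))"
      using summable_mult[OF sg', of 2] by (simp add: mult.commute summable_sums)
    from sums_Suc[OF this] show ?thesis by (simp add: sums_iff add.commute)
  qed
  also have "(\<Sum>n. 2 * g (real (Suc n))) = 2 * (\<Sum>n. g (real (Suc n)))" by (rule suminf_mult[OF sg'])
  finally show "(\<integral>y. g (near y) * dirichlet_kernel N y \<partial>lborel) = g 0 + 2 * (\<Sum>n. g (real (Suc n)))" .
qed

text \<open>Against the Dirichlet kernel, \<open>g\<close> integrates to a partial sum of the
  Fourier side and the samples of \<open>g\<close> integrate to the left side. The two differ by the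
  sampling error, which tends to 0.\<close>

lemma poisson_summation_even:
  fixes g g' :: "real \<Rightarrow> real"
  assumes even: "\<And>y. g (- y) = g y" and der: "\<And>y. (g has_real_derivative g' y) (at y)"
    and bd: "\<And>y. \<bar>g y\<bar> \<le> C / (1 + y\<^sup>2)" and bd': "\<And>y. \<bar>g' y\<bar> \<le> C / (1 + y\<^sup>2)"
    and four: "\<And>m. has_bochner_integral lborel (\<lambda>y. g y * cos (2 * pi * real m * y)) (G m)"
    and sumG: "summable G"
  shows "g 0 + 2 * (\<Sum>n. g (real (Suc n))) = G 0 + 2 * (\<Sum>n. G (Suc n))"
proof -
  have D: "has_bochner_integral lborel (\<lambda>y. g y * dirichlet_kernel N y) (G 0 + 2 * (\<Sum>m=1..N. G m))" for N
  proof -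
    have "has_bochner_integral lborel (\<lambda>y. g y * cos (2 * pi * real 0 * y) + 2 * (\<Sum>m=1..N. g y * cos (2 * pi * real m * y)))
        (G 0 + 2 * (\<Sum>m=1..N. G m))"
      by (intro has_bochner_integral_add has_bochner_integral_mult_right has_bochner_integral_sum four)
    then show ?thesis by (simp add: dirichlet_kernel_def algebra_simps sum_distrib_left)
  qed
  have "(\<lambda>N. \<integral>y. (g y - g (near y)) * dirichlet_kernel N y \<partial>lborel) \<longlonglongrightarrow> 0"
    by (rule dirichlet_kernel_sampling_error[OF even der bd bd'])
  also have "(\<lambda>N. \<integral>y. (g y - g (near y)) * dirichlet_kernel N y \<partial>lborel) =
      (\<lambda>N. (G 0 + 2 * (\<Sum>m=1..N. G m)) - (g 0 + 2 * (\<Sum>n. g (real (Suc n)))))"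
  proof
    fix N
    show "(\<integral>y. (g y - g (near y)) * dirichlet_kernel N y \<partial>lborel) =
      (G 0 + 2 * (\<Sum>m=1..N. G m)) - (g 0 + 2 * (\<Sum>n. g (real (Suc n))))"
      unfolding left_diff_distrib
      using D[of N] dirichlet_kernel_integral_samples(1,2)[OF bd, of N]
      by (subst Bochner_Integration.integral_diff) (auto simp: has_bochner_integral_iff)
  qed
  finally have L1: "(\<lambda>N. (G 0 + 2 * (\<Sum>m=1..N. G m)) - (g 0 + 2 * (\<Sum>n. g (real (Suc n))))) \<longlonglongrightarrow> 0" .
  have "(\<lambda>n. G (Suc n)) sums (\<Sum>n. G (Suc n))" using sumG by (intro summable_sums) (simp add: summable_Suc_iff)
  then have "(\<lambda>N. \<Sum>m<N. G (Suc m)) \<longlonglongrightarrow> (\<Sum>n. G (Suc n))" by (simp add: sums_def)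
  moreover have "(\<Sum>m<N. G (Suc m)) = (\<Sum>m=1..N. G m)" for N
    by (simp add: sum.atLeast1_atMost_eq)
  ultimately have "(\<lambda>N. \<Sum>m=1..N. G m) \<longlonglongrightarrow> (\<Sum>n. G (Suc n))" by simp
  then have "(\<lambda>N. (G 0 + 2 * (\<Sum>m=1..N. G m)) - (g 0 + 2 * (\<Sum>n. g (real (Suc n))))) \<longlonglongrightarrow>
      (G 0 + 2 * (\<Sum>n. G (Suc n))) - (g 0 + 2 * (\<Sum>n. g (real (Suc n))))"
    by (intro tendsto_intros)
  from LIMSEQ_unique[OF L1 this] show ?thesis by simp
qed

section \<open>The Gaussian series and its functional equation\<close>

definition theta_psi :: "real \<Rightarrow> real" where
  "theta_psi x = (\<Sum>n. exp (- pi * (real (Suc n))\<^sup>2 * x))"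

text \<open>This is the characteristic function of the standard normal distribution at
  \<open>t = 2 * pi * m / c\<close>, after the rescaling by \<open>c = sqrt (2 * pi * a)\<close>
  that turns exp(-x^2/2) into exp(-pi a y^2).\<close>

lemma gaussian_fourier:
  assumes a: "a > 0"
  shows "has_bochner_integral lborel (\<lambda>y. exp (- pi * a * y\<^sup>2) * cos (2 * pi * m * y)) (exp (- pi * m\<^sup>2 / a) / sqrt a)"
proof -
  define c where "c = sqrt (2 * pi * a)"
  have c: "c > 0" "c\<^sup>2 = 2 * pi * a" using a by (auto simp: c_def)
  define t where "t = 2 * pi * m / c"
  have i: "integrable lborel (\<lambda>x. std_normal_density x * cos (t * x))"
    by (rule Bochner_Integration.integrable_bound[where f = std_normal_density])
       (auto simp: abs_mult intro!: mult_left_le abs_cos_le_one integrable_normal_density)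
  have "char std_normal_distribution t = of_real (exp (- (t\<^sup>2) / 2))" by (simp add: char_std_normal_distribution)
  moreover have "char std_normal_distribution t = (CLINT x|lborel. std_normal_density x *\<^sub>R iexp (t * x))"
    unfolding char_def by (subst integral_density) (auto simp: std_normal_density_def intro!: AE_I2)
  ultimately have "Re (CLINT x|lborel. std_normal_density x *\<^sub>R iexp (t * x)) = exp (- (t\<^sup>2) / 2)" by (metis Re_complex_of_real)
  moreover have "integrable lborel (\<lambda>x. std_normal_density x *\<^sub>R iexp (t * x))"
    by (rule Bochner_Integration.integrable_bound[where f = std_normal_density])
       (auto intro!: integrable_normal_density)
  ultimately have "(\<integral>x. Re (std_normal_density x *\<^sub>R iexp (t * x)) \<partial>lborel) = exp (- (t\<^sup>2) / 2)" by (simp add: integral_Re del: scaleR_complex.sel)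
  then have h: "has_bochner_integral lborel (\<lambda>x. std_normal_density x * cos (t * x)) (exp (- (t\<^sup>2) / 2))"
    using i by (simp add: has_bochner_integral_iff Re_exp)
  have "has_bochner_integral lborel (\<lambda>y. std_normal_density (0 + c * y) * cos (t * (0 + c * y))) (exp (- (t\<^sup>2) / 2) /\<^sub>R \<bar>c\<bar>)"
    using lborel_has_bochner_integral_real_affine_iff[of c "\<lambda>x. std_normal_density x * cos (t * x)" _ 0] h c by simp
  from has_bochner_integral_mult_right[OF this, of "sqrt (2 * pi)"]
  have "has_bochner_integral lborel (\<lambda>y. sqrt (2 * pi) * (std_normal_density (0 + c * y) * cos (t * (0 + c * y))))
     (sqrt (2 * pi) * (exp (- (t\<^sup>2) / 2) /\<^sub>R \<bar>c\<bar>))" by simp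
  also have "(\<lambda>y. sqrt (2 * pi) * (std_normal_density (0 + c * y) * cos (t * (0 + c * y)))) =
      (\<lambda>y. exp (- pi * a * y\<^sup>2) * cos (2 * pi * m * y))"
  proof
    fix y
    have 1: "t * (0 + c * y) = 2 * pi * m * y" using c by (simp add: t_def)
    have 2: "sqrt (2 * pi) * std_normal_density (0 + c * y) = exp (- pi * a * y\<^sup>2)"
      using c by (simp add: std_normal_density_def power_mult_distrib)
    show "sqrt (2 * pi) * (std_normal_density (0 + c * y) * cos (t * (0 + c * y))) =
        exp (- pi * a * y\<^sup>2) * cos (2 * pi * m * y)"
      unfolding 1 mult.assoc[symmetric] 2 ..
  qed
  also have "sqrt (2 * pi) * (exp (- (t\<^sup>2) / 2) /\<^sub>R \<bar>c\<bar>) = exp (- pi * m\<^sup>2 / a) / sqrt a"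
  proof -
    have "t\<^sup>2 / 2 = pi * m\<^sup>2 / a" using a by (simp add: t_def power_divide power_mult_distrib c(2)) (simp add: power2_eq_square)
    moreover have "sqrt (2 * pi) / \<bar>c\<bar> = 1 / sqrt a" using a by (simp add: c_def real_sqrt_mult)
    moreover have "sqrt (2 * pi) * (E /\<^sub>R \<bar>c\<bar>) = E * (sqrt (2 * pi) / \<bar>c\<bar>)" for E by (simp add: divide_inverse)
    ultimately show ?thesis by simp
  qed
  finally show ?thesis .
qed

lemma exp_ge_one_plus_half_square: "x \<ge> 0 \<Longrightarrow> (1 + x / 2)\<^sup>2 \<le> exp (x::real)"
  using power_mono[OF exp_ge_add_one_self[of "x/2"], of 2] by (simp add: exp_double[symmetric])

text \<open>The square in the denominator leaves room for the factor y that differentiating a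
  Gaussian brings down, so that the function and its derivative both meet the decay hypothesis of
  Poisson summation.\<close>

lemma gaussian_decay:
  fixes b :: real
  assumes b: "b > 0"
  obtains C where "C > 0" "\<And>y. exp (- b * y\<^sup>2) \<le> C / (1 + y\<^sup>2)\<^sup>2"
proof -
  define m where "m = min 1 (b / 2)"
  have m: "m > 0" "m \<le> 1" "m \<le> b / 2" using b by (auto simp: m_def)
  have "exp (- b * y\<^sup>2) \<le> (1 / m\<^sup>2) / (1 + y\<^sup>2)\<^sup>2" for y
  proof -
    have "m * (1 + y\<^sup>2) \<le> 1 + b * y\<^sup>2 / 2"
      using m mult_right_mono[OF m(3), of "y\<^sup>2"] by (simp add: algebra_simps)
    then have "(m * (1 + y\<^sup>2))\<^sup>2 \<le> (1 + b * y\<^sup>2 / 2)\<^sup>2" using m by (intro power_mono mult_nonneg_nonneg add_nonneg_nonneg) auto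
    also have "\<dots> \<le> exp (b * y\<^sup>2)" using b by (intro exp_ge_one_plus_half_square) auto
    finally have "inverse (exp (b * y\<^sup>2)) \<le> inverse ((m * (1 + y\<^sup>2))\<^sup>2)"
      using m by (intro le_imp_inverse_le zero_less_power mult_pos_pos add_pos_nonneg) auto
    moreover have "inverse ((m * q)\<^sup>2) = (1 / m\<^sup>2) / q\<^sup>2" for q by (simp add: power_mult_distrib divide_inverse)
    ultimately show ?thesis by (simp add: exp_minus del: power_mult_distrib)
  qed
  then show ?thesis using m by (intro that[of "1 / m\<^sup>2"]) auto
qed

lemma summable_theta_psi: "x > 0 \<Longrightarrow> summable (\<lambda>n. exp (- pi * (real (Suc n))\<^sup>2 * x))"
proof -
  assume x: "x > 0"
  obtain C where C: "C > 0" "\<And>y. exp (- (pi * x) * y\<^sup>2) \<le> C / (1 + y\<^sup>2)\<^sup>2"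
    using gaussian_decay[of "pi * x"] x by auto
  have "\<bar>exp (- (pi * x) * y\<^sup>2)\<bar> \<le> C / (1 + y\<^sup>2)" for y
  proof -
    have p: "1 \<le> 1 + y\<^sup>2" by simp
    then have pos: "1 + y\<^sup>2 > 0" by linarith
    have "C / (1 + y\<^sup>2)\<^sup>2 \<le> C / (1 + y\<^sup>2)"
      using C p self_le_power[OF p, of 2] by (intro divide_left_mono mult_pos_pos zero_less_power pos) auto
    then show ?thesis using C(2)[of y] by simp
  qed
  from dirichlet_kernel_integral_samples(3)[OF this] show ?thesis by (simp add: mult_ac)
qed

lemma theta_functional_equation:
  assumes a: "a > 0"
  shows "1 + 2 * theta_psi a = (1 + 2 * theta_psi (1 / a)) / sqrt a"
proof -
  obtain C where C: "C > 0" "\<And>y. exp (- (pi * a) * y\<^sup>2) \<le> C / (1 + y\<^sup>2)\<^sup>2"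
    using gaussian_decay[of "pi * a"] a by auto
  \<comment> \<open>A single constant for both decay hypotheses: it dominates \<open>C\<close> for
    the Gaussian and \<open>C * (2 * pi * a)\<close> for its derivative.\<close>
  define K where "K = C * (1 + 2 * pi * a)"
  define G where "G = (\<lambda>m::nat. exp (- pi * (real m)\<^sup>2 / a) / sqrt a)"
  have CK: "C \<le> K" "C * (2 * pi * a) \<le> K" using C a by (auto simp: K_def algebra_simps)
  have p: "1 \<le> 1 + y\<^sup>2" for y :: real by simp
  have pos: "0 < 1 + y\<^sup>2" for y :: real by (intro add_pos_nonneg) auto
  have sumG: "summable G"
  proof -
    have "summable (\<lambda>n. exp (- pi * (real (Suc n))\<^sup>2 * (1 / a)) / sqrt a)"
      using a by (intro summable_divide summable_theta_psi) auto
    then have "summable (\<lambda>n. G (Suc n))" by (simp add: G_def)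
    then show ?thesis by (subst (asm) summable_Suc_iff)
  qed
  have "exp (- (pi * a) * 0\<^sup>2) + 2 * (\<Sum>n. exp (- (pi * a) * (real (Suc n))\<^sup>2)) = G 0 + 2 * (\<Sum>n. G (Suc n))"
  proof (rule poisson_summation_even)
    show "((\<lambda>y. exp (- (pi * a) * y\<^sup>2)) has_real_derivative exp (- (pi * a) * y\<^sup>2) * (- (pi * a) * (2 * y))) (at y)" for y
      by (auto intro!: derivative_eq_intros)
    show "\<bar>exp (- (pi * a) * y\<^sup>2)\<bar> \<le> K / (1 + y\<^sup>2)" for y
    proof -
      have "C / (1 + y\<^sup>2)\<^sup>2 \<le> K / (1 + y\<^sup>2)"
        using C CK p[of y] pos[of y] self_le_power[OF p, of 2 y] by (intro frac_le) auto
      then show ?thesis using C(2)[of y] by simp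
    qed
    show "\<bar>exp (- (pi * a) * y\<^sup>2) * (- (pi * a) * (2 * y))\<bar> \<le> K / (1 + y\<^sup>2)" for y
    proof -
      have y: "\<bar>y\<bar> \<le> 1 + y\<^sup>2" using zero_le_power2[of "\<bar>y\<bar> - 1"] by (simp add: power2_eq_square algebra_simps)
      have "\<bar>exp (- (pi * a) * y\<^sup>2) * (- (pi * a) * (2 * y))\<bar> = exp (- (pi * a) * y\<^sup>2) * (2 * pi * a * \<bar>y\<bar>)"
        using a by (simp add: abs_mult)
      also have "\<dots> \<le> C / (1 + y\<^sup>2)\<^sup>2 * (2 * pi * a * (1 + y\<^sup>2))"
        using C a y by (intro mult_mono) (auto intro!: divide_nonneg_nonneg)
      also have "\<dots> = C * (2 * pi * a) / (1 + y\<^sup>2)" using pos[of y] by (simp add: power2_eq_square)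
      also have "\<dots> \<le> K / (1 + y\<^sup>2)" using CK pos[of y] by (intro divide_right_mono) auto
      finally show ?thesis .
    qed
    show "has_bochner_integral lborel (\<lambda>y. exp (- (pi * a) * y\<^sup>2) * cos (2 * pi * real m * y)) (G m)" for m
      using gaussian_fourier[OF a, of "real m"] by (simp add: G_def)
    show "summable G" by (rule sumG)
  qed simp
  moreover have "(\<Sum>n. exp (- (pi * a) * (real (Suc n))\<^sup>2)) = theta_psi a"
    unfolding theta_psi_def by (simp add: mult_ac)
  moreover have "(\<Sum>n. G (Suc n)) = theta_psi (1 / a) / sqrt a"
    unfolding theta_psi_def G_def
    using suminf_divide[OF summable_theta_psi[of "1 / a"], of "sqrt a"] a by simp
  ultimately show ?thesis by (simp add: G_def add_divide_distrib)
qed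

section \<open>Riemann's xi function as a Laplace transform\<close>

text \<open>Expanding \<open>exp (z * of_real t)\<close> and integrating termwise produces a power
  series in z that converges on every disc; hypothesis \<open>int\<close> with
  \<open>R = norm z\<close> dominates all absolute partial sums at once.\<close>

lemma laplace_transform_entire:
  fixes w :: "real \<Rightarrow> real"
  assumes [measurable]: "w \<in> borel_measurable borel" and w0: "\<And>t. w t \<ge> 0"
    and int: "\<And>R. integrable lborel (\<lambda>t. w t * exp (R * \<bar>t\<bar>))"
  shows "(\<lambda>z::complex. \<integral>t. of_real (w t) * exp (z * of_real t) \<partial>lborel) holomorphic_on UNIV"
proof -
  define f where "f = (\<lambda>(z::complex) n t. of_real (w t) * ((z * of_real t) ^ n /\<^sub>R fact n))"
  define b where "b = (\<lambda>n. \<integral>t. complex_of_real (w t) * (of_real t ^ n /\<^sub>R fact n) \<partial>lborel)"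
  have nf: "norm (f z n t) = w t * ((norm z * \<bar>t\<bar>) ^ n /\<^sub>R fact n)" for z n t
    using w0[of t] by (simp add: f_def norm_mult norm_power)
  have expsum: "(\<lambda>n. x ^ n /\<^sub>R fact n) sums exp x" for x :: real by (rule exp_converges)
  have part: "(\<Sum>n<N. w t * ((norm z * \<bar>t\<bar>) ^ n /\<^sub>R fact n)) \<le> w t * exp (norm z * \<bar>t\<bar>)" for z :: complex and t N
    unfolding sum_distrib_left[symmetric]
  proof (rule mult_left_mono[OF _ w0])
    show "(\<Sum>n<N. (norm z * \<bar>t\<bar>) ^ n /\<^sub>R fact n) \<le> exp (norm z * \<bar>t\<bar>)"
      using sum_le_suminf[OF sums_summable[OF expsum[of "norm z * \<bar>t\<bar>"]], of "{..<N}"] sums_unique[OF expsum[of "norm z * \<bar>t\<bar>"]]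
      by simp
  qed
  have single: "w t * ((norm z * \<bar>t\<bar>) ^ n /\<^sub>R fact n) \<le> w t * exp (norm z * \<bar>t\<bar>)" for z :: complex and t n
  proof -
    have "w t * ((norm z * \<bar>t\<bar>) ^ n /\<^sub>R fact n) \<le> (\<Sum>m<Suc n. w t * ((norm z * \<bar>t\<bar>) ^ m /\<^sub>R fact m))"
      using w0[of t] by (intro member_le_sum) auto
    then show ?thesis using part[of t z "Suc n"] by linarith
  qed
  have fint: "integrable lborel (f z n)" for z n
  proof (rule Bochner_Integration.integrable_bound[OF int[of "norm z"]])
    show "AE t in lborel. norm (f z n t) \<le> norm (w t * exp (norm z * \<bar>t\<bar>))"
      unfolding nf using single w0 by (intro AE_I2) (simp add: abs_mult)
  qed (simp add: f_def)
  have nint: "integrable lborel (\<lambda>t. w t * ((norm z * \<bar>t\<bar>) ^ n /\<^sub>R fact n))" for z :: complex and n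
    using integrable_norm[OF fint[of z n]] by (simp add: nf)
  have sn: "summable (\<lambda>n. \<integral>t. norm (f z n t) \<partial>lborel)" for z
  proof (rule summableI_nonneg_bounded)
    show "(\<Sum>n<N. \<integral>t. norm (f z n t) \<partial>lborel) \<le> (\<integral>t. w t * exp (norm z * \<bar>t\<bar>) \<partial>lborel)" for N
    proof -
      have "(\<Sum>n<N. \<integral>t. norm (f z n t) \<partial>lborel) = (\<integral>t. (\<Sum>n<N. w t * ((norm z * \<bar>t\<bar>) ^ n /\<^sub>R fact n)) \<partial>lborel)"
        using nint by (subst Bochner_Integration.integral_sum) (auto simp: nf)
      also have "\<dots> \<le> (\<integral>t. w t * exp (norm z * \<bar>t\<bar>) \<partial>lborel)"
        by (intro integral_mono Bochner_Integration.integrable_sum nint int part)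
      finally show ?thesis .
    qed
  qed auto
  have ae: "AE t in lborel. summable (\<lambda>n. norm (f z n t))" for z
    unfolding nf by (intro AE_I2 summable_mult sums_summable[OF expsum])
  have su: "(\<Sum>n. f z n t) = of_real (w t) * exp (z * of_real t)" for z t
    unfolding f_def using exp_converges[of "z * of_real t"] by (subst suminf_mult) (auto simp: sums_iff)
  have fz: "(\<integral>t. f z n t \<partial>lborel) = b n * (z - 0) ^ n" for z n
  proof -
    have "f z n = (\<lambda>t. (of_real (w t) * (of_real t ^ n /\<^sub>R fact n)) * z ^ n)"
      by (auto simp: f_def power_mult_distrib scaleR_conv_of_real mult_ac)
    then show ?thesis by (simp add: b_def)
  qed
  have "(\<lambda>n. b n * (z - 0) ^ n) sums (\<integral>t. of_real (w t) * exp (z * of_real t) \<partial>lborel)" for z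
    using sums_integral[OF fint ae sn, of z] by (simp add: su fz)
  then have "(\<lambda>z::complex. \<integral>t. of_real (w t) * exp (z * of_real t) \<partial>lborel) holomorphic_on ball 0 r" for r
    by (intro power_series_holomorphic[where a = b])
  then have "(\<lambda>z::complex. \<integral>t. of_real (w t) * exp (z * of_real t) \<partial>lborel) holomorphic_on (\<Union>r\<in>{0<..}. ball 0 r)"
    by (intro holomorphic_on_UN_open) auto
  moreover have "(\<Union>r\<in>{0<..}. ball 0 r) = (UNIV :: complex set)"
  proof -
    have "x \<in> (\<Union>r\<in>{0<..}. ball 0 r)" for x :: complex
      by (rule UN_I[of "norm x + 1"]) (auto intro: add_nonneg_pos)
    then show ?thesis by blast
  qed
  ultimately show ?thesis by simp
qed

lemma theta_psi_nonneg: "x > 0 \<Longrightarrow> theta_psi x \<ge> 0"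
  unfolding theta_psi_def by (intro suminf_nonneg summable_theta_psi) auto

lemma theta_psi_measurable [measurable]: "theta_psi \<in> borel_measurable borel"
  unfolding theta_psi_def by measurable

text \<open>As n \<le> n^2, the series lies below a geometric one with ratio exp(-pi x).\<close>

lemma theta_psi_le_geometric:
  assumes x: "x > 0"
  shows "theta_psi x \<le> 1 / (exp (pi * x) - 1)"
proof -
  define q where "q = exp (- pi * x)"
  have q: "0 < q" "q < 1" using x by (auto simp: q_def)
  have "(\<lambda>n. q * q ^ n) sums (q * (1 / (1 - q)))"
    by (intro sums_mult geometric_sums) (use q in auto)
  then have s: "summable (\<lambda>n. q ^ Suc n)" "(\<Sum>n. q ^ Suc n) = q / (1 - q)" by (auto simp: sums_iff)
  have "theta_psi x \<le> (\<Sum>n. q ^ Suc n)"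
    unfolding theta_psi_def
  proof (rule suminf_le[OF _ summable_theta_psi[OF x] s(1)])
    fix n
    have "q ^ Suc n = exp (- pi * real (Suc n) * x)" unfolding q_def exp_of_nat_mult[symmetric] by (simp add: algebra_simps)
    moreover have "real (Suc n) \<le> (real (Suc n))\<^sup>2" by (rule self_le_power) auto
    then have "pi * x * real (Suc n) \<le> pi * x * (real (Suc n))\<^sup>2" using x by (intro mult_left_mono) auto
    ultimately show "exp (- pi * (real (Suc n))\<^sup>2 * x) \<le> q ^ Suc n" by (simp add: mult_ac)
  qed
  also have "\<dots> = 1 / (exp (pi * x) - 1)"
    unfolding s(2) using x by (simp add: q_def exp_minus field_simps)
  finally show ?thesis .
qed

text \<open>From exp y - 1 \<ge> y^2/2. Decay of second order with an explicit constant is what the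
  numerical exclusion of zeros near the origin in \<open>xi_even_nonzero_low\<close> works
  with.\<close>

lemma theta_psi_le_inverse_square: "x > 0 \<Longrightarrow> theta_psi x \<le> 2 / (pi * x)\<^sup>2"
proof -
  assume x: "x > 0"
  have "(pi * x)\<^sup>2 / 2 \<le> exp (pi * x) - 1" using exp_lower_Taylor_quadratic[of "pi * x"] mult_pos_pos[OF pi_gt_zero x] by linarith
  then have "1 / (exp (pi * x) - 1) \<le> 1 / ((pi * x)\<^sup>2 / 2)" using x by (intro divide_left_mono) auto
  then show ?thesis using theta_psi_le_geometric[OF x] by simp
qed

lemma theta_psi_le_exp: "x \<ge> 1 \<Longrightarrow> theta_psi x \<le> 2 * exp (- x)"
proof -
  assume x: "x \<ge> 1"
  have "exp x \<ge> 2" using exp_ge_add_one_self[of x] x by linarith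
  moreover have "exp x \<le> exp (pi * x)" using x pi_ge_two mult_right_mono[of 1 pi x] by simp
  ultimately have "exp x / 2 \<le> exp (pi * x) - 1" by linarith
  then have "1 / (exp (pi * x) - 1) \<le> 1 / (exp x / 2)" by (intro frac_le) auto
  also have "1 / (exp x / 2) = 2 * exp (- x)" by (simp add: exp_minus inverse_eq_divide)
  finally show ?thesis using theta_psi_le_geometric[of x] x by linarith
qed

lemma has_bochner_integral_of_has_integral_nonneg:
  fixes f :: "real \<Rightarrow> real"
  assumes "(f has_integral I) S" "\<And>x. x \<in> S \<Longrightarrow> f x \<ge> 0"
    and "S \<in> sets borel" "f \<in> borel_measurable borel"
  shows "has_bochner_integral lborel (\<lambda>x. indicator S x * f x) I"
proof (rule has_bochner_integral_nn_integral)
  show "(\<integral>\<^sup>+x. ennreal (indicator S x * f x) \<partial>lborel) = ennreal I"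
    using nn_integral_has_integral_lebesgue[OF assms(2,1)] by (simp add: nn_integral_completion)
  show "0 \<le> I" by (rule has_integral_nonneg[OF assms(1,2)])
  show "AE x in lborel. 0 \<le> indicator S x * f x"
    using assms(2) by (intro AE_I2) (simp add: indicator_def)
  show "(\<lambda>x. indicator S x * f x) \<in> borel_measurable lborel"
    using assms(3,4) by (simp add: borel_measurable_times borel_measurable_indicator)
qed

lemma has_bochner_integral_exp_atLeast:
  "a > 0 \<Longrightarrow> has_bochner_integral lborel (\<lambda>t::real. indicator {0..} t * exp (- a * t)) (1 / a)"
proof (rule has_bochner_integral_of_has_integral_nonneg)
  show "a > 0 \<Longrightarrow> ((\<lambda>t. exp (- a * t)) has_integral 1 / a) {0..}"
    using has_integral_exp_minus_to_infinity[of a 0] by simp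
  show "(\<lambda>t::real. exp (- a * t)) \<in> borel_measurable borel"
    by (intro borel_measurable_continuous_onI continuous_intros)
qed auto

text \<open>Riemann's integral over x \<ge> 1 in the variable x = exp t: with s = 1/2 + z the kernel
  x^(s/2) dx/x becomes exp(t/4) exp(zt/2) dt. The first factor belongs to the weight; the second and
  its reflection under s \<rightarrow> 1 - s make up \<open>xi_integral\<close>.\<close>

definition xi_weight :: "real \<Rightarrow> real" where
  "xi_weight t = indicator {0..} t * (theta_psi (exp t) * exp (t / 4))"

definition xi_integral :: "complex \<Rightarrow> complex" where
  "xi_integral z = (\<integral>t. of_real (xi_weight t) * (exp (z / 2 * of_real t) + exp (- z / 2 * of_real t)) \<partial>lborel)"

text \<open>Riemann's \<open>\<xi> (1/2 + z)\<close>.\<close>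
definition xi_even :: "complex \<Rightarrow> complex" where
  "xi_even z = (1 - (1/4 - z\<^sup>2) * xi_integral z) / 2"

lemma xi_weight_measurable [measurable]: "xi_weight \<in> borel_measurable borel"
  unfolding xi_weight_def by measurable

lemma xi_weight_nonneg: "xi_weight t \<ge> 0"
  unfolding xi_weight_def by (intro mult_nonneg_nonneg theta_psi_nonneg) auto

text \<open>\<open>theta_psi (exp t)\<close> decays like exp(-exp t). Half of this exponent pays for
  exp(At) with A = R + 1/4, because ln y \<le> y - 1 at y = exp t / (2A) gives At \<le> A ln(2A) +
  exp(t)/2; the other half leaves exp(-t/2). The constant exp(A ln(2A)) determines the growth of
  \<open>xi_even\<close>.\<close>

lemma xi_weight_bound:
  assumes R: "R \<ge> 1"
  shows "xi_weight t * exp (R * \<bar>t\<bar>) \<le> 2 * exp ((R + 1/4) * ln (2 * (R + 1/4))) * (indicator {0..} t * exp (- (1/2) * t))"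
proof (cases "t \<ge> 0")
  case True
  define A where "A = R + 1/4"
  have A: "A > 0" using R by (simp add: A_def)
  have "ln (exp t / (2 * A)) \<le> exp t / (2 * A) - 1" using A by (intro ln_le_minus_one) auto
  then have "t \<le> ln (2 * A) + exp t / (2 * A)" using A by (simp add: ln_div)
  then have "A * t \<le> A * (ln (2 * A) + exp t / (2 * A))" using A by (intro mult_left_mono) auto
  also have "\<dots> = A * ln (2 * A) + exp t / 2" using A by (simp add: field_simps)
  finally have At: "A * t \<le> A * ln (2 * A) + exp t / 2" .
  have "xi_weight t * exp (R * \<bar>t\<bar>) = theta_psi (exp t) * exp (A * t)"
    using True by (simp add: xi_weight_def A_def flip: exp_add) (simp add: algebra_simps)
  also have "\<dots> \<le> 2 * exp (- exp t) * exp (A * ln (2 * A) + exp t / 2)"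
    using theta_psi_le_exp[of "exp t"] True At by (intro mult_mono) auto
  also have "\<dots> = 2 * exp (A * ln (2 * A)) * exp (- exp t / 2)" by (simp add: exp_add[symmetric])
  also have "\<dots> \<le> 2 * exp (A * ln (2 * A)) * exp (- (1/2) * t)"
  proof -
    have "t \<le> exp t" using exp_ge_add_one_self[of t] by linarith
    then show ?thesis by (intro mult_left_mono) auto
  qed
  finally show ?thesis using True by (simp add: A_def)
qed (simp add: xi_weight_def)

lemma xi_weight_integrable:
  "integrable lborel (\<lambda>t. xi_weight t * exp (R * \<bar>t\<bar>))"
proof -
  define R' where "R' = max 1 R"
  define C where "C = 2 * exp ((R' + 1/4) * ln (2 * (R' + 1/4)))"
  have R: "R' \<ge> 1" "R \<le> R'" by (auto simp: R'_def)
  have "integrable lborel (\<lambda>t::real. indicator {0..} t * exp (- (1/2) * t))"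
    using has_bochner_integral_exp_atLeast[of "1/2"] by (auto simp: has_bochner_integral_iff)
  then have i: "integrable lborel (\<lambda>t::real. C * (indicator {0..} t * exp (- (1/2) * t)))" by (rule integrable_mult_right)
  show ?thesis
  proof (rule Bochner_Integration.integrable_bound[OF i])
    show "AE t in lborel. norm (xi_weight t * exp (R * \<bar>t\<bar>)) \<le> norm (C * (indicator {0..} t * exp (- (1/2) * t)))"
    proof (rule AE_I2)
      fix t :: real
      have "xi_weight t * exp (R * \<bar>t\<bar>) \<le> xi_weight t * exp (R' * \<bar>t\<bar>)"
        using R by (intro mult_left_mono xi_weight_nonneg) (auto intro: mult_right_mono)
      also have "\<dots> \<le> C * (indicator {0..} t * exp (- (1/2) * t))" unfolding C_def by (rule xi_weight_bound[OF R(1)])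
      finally show "norm (xi_weight t * exp (R * \<bar>t\<bar>)) \<le> norm (C * (indicator {0..} t * exp (- (1/2) * t)))"
        using xi_weight_nonneg[of t] by (simp add: abs_mult C_def)
    qed
  qed measurable
qed

lemma xi_weight_integrable_complex:
  "integrable lborel (\<lambda>t. complex_of_real (xi_weight t) * exp (z * of_real t))"
proof (rule Bochner_Integration.integrable_bound[OF xi_weight_integrable[of "norm z"]])
  show "AE t in lborel. norm (complex_of_real (xi_weight t) * exp (z * of_real t)) \<le> norm (xi_weight t * exp (norm z * \<bar>t\<bar>))"
  proof (rule AE_I2)
    fix t
    have "Re (z * of_real t) \<le> norm z * \<bar>t\<bar>" using complex_Re_le_cmod[of "z * of_real t"] by (simp add: norm_mult)
    then show "norm (complex_of_real (xi_weight t) * exp (z * of_real t)) \<le> norm (xi_weight t * exp (norm z * \<bar>t\<bar>))"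
      using xi_weight_nonneg[of t] by (simp add: norm_mult abs_mult mult_left_mono)
  qed
  have "(\<lambda>t::real. exp (z * of_real t)) \<in> borel_measurable borel"
    by (intro borel_measurable_continuous_onI continuous_intros)
  moreover have "(\<lambda>t. complex_of_real (xi_weight t)) \<in> borel_measurable borel"
    by (rule measurable_compose[OF xi_weight_measurable]) (intro borel_measurable_continuous_onI continuous_intros)
  ultimately show "(\<lambda>t. complex_of_real (xi_weight t) * exp (z * of_real t)) \<in> borel_measurable lborel"
    using borel_measurable_times by simp
qed

lemma xi_integral_split:
  "xi_integral z = (\<integral>t. of_real (xi_weight t) * exp (z / 2 * of_real t) \<partial>lborel) +
      (\<integral>t. of_real (xi_weight t) * exp (- z / 2 * of_real t) \<partial>lborel)"
  unfolding xi_integral_def distrib_left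
  by (rule Bochner_Integration.integral_add[OF xi_weight_integrable_complex xi_weight_integrable_complex])

lemma xi_even_holomorphic: "xi_even holomorphic_on UNIV"
proof -
  define L where "L = (\<lambda>z::complex. \<integral>t. of_real (xi_weight t) * exp (z * of_real t) \<partial>lborel)"
  have L: "L holomorphic_on UNIV" unfolding L_def
    by (rule laplace_transform_entire[OF xi_weight_measurable xi_weight_nonneg xi_weight_integrable])
  have "(\<lambda>z. L (z / 2)) holomorphic_on UNIV" "(\<lambda>z. L (- z / 2)) holomorphic_on UNIV"
    by (rule holomorphic_on_compose_gen[OF _ L, unfolded o_def]; auto intro!: holomorphic_intros)+
  then have "(\<lambda>z. (1 - (1/4 - z\<^sup>2) * (L (z / 2) + L (- z / 2))) / 2) holomorphic_on UNIV"
    by (intro holomorphic_intros) auto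
  then show ?thesis
    unfolding L_def xi_integral_split[symmetric] xi_even_def[symmetric] by simp
qed

lemma xi_even_uminus: "xi_even (- z) = xi_even z"
  by (simp add: xi_even_def xi_integral_def add.commute)

lemma norm_xi_integral_le:
  assumes "\<bar>Re z\<bar> \<le> 2 * R"
  shows "norm (xi_integral z) \<le> 2 * (\<integral>t. xi_weight t * exp (R * \<bar>t\<bar>) \<partial>lborel)"
proof -
  have "norm (xi_integral z) \<le> (\<integral>t. norm (of_real (xi_weight t) * (exp (z / 2 * of_real t) + exp (- z / 2 * of_real t))) \<partial>lborel)"
    unfolding xi_integral_def by (rule integral_norm_bound)
  also have "\<dots> \<le> (\<integral>t. 2 * (xi_weight t * exp (R * \<bar>t\<bar>)) \<partial>lborel)"
  proof (rule integral_mono)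
    show "integrable lborel (\<lambda>t. norm (complex_of_real (xi_weight t) * (exp (z / 2 * of_real t) + exp (- z / 2 * of_real t))))"
      unfolding distrib_left
      by (intro integrable_norm Bochner_Integration.integrable_add xi_weight_integrable_complex)
    show "integrable lborel (\<lambda>t. 2 * (xi_weight t * exp (R * \<bar>t\<bar>)))" by (intro integrable_mult_right xi_weight_integrable)
    fix t
    have "\<bar>Re z / 2 * t\<bar> \<le> R * \<bar>t\<bar>" unfolding abs_mult using assms by (intro mult_right_mono) auto
    then have "norm (exp (z / 2 * of_real t)) \<le> exp (R * \<bar>t\<bar>)" "norm (exp (- z / 2 * of_real t)) \<le> exp (R * \<bar>t\<bar>)"
      by (auto simp: abs_le_iff)
    then have "norm (exp (z / 2 * of_real t) + exp (- z / 2 * of_real t)) \<le> 2 * exp (R * \<bar>t\<bar>)"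
      using norm_triangle_ineq[of "exp (z / 2 * of_real t)" "exp (- z / 2 * of_real t)"] by linarith
    then have "xi_weight t * norm (exp (z / 2 * of_real t) + exp (- z / 2 * of_real t)) \<le> xi_weight t * (2 * exp (R * \<bar>t\<bar>))"
      by (intro mult_left_mono xi_weight_nonneg)
    then show "norm (complex_of_real (xi_weight t) * (exp (z / 2 * of_real t) + exp (- z / 2 * of_real t))) \<le> 2 * (xi_weight t * exp (R * \<bar>t\<bar>))"
      using xi_weight_nonneg[of t] by (simp add: norm_mult)
  qed
  finally show ?thesis by simp
qed

text \<open>By \<open>xi_weight_bound\<close> the logarithm of the bound \<open>B n\<close> is of
  size n ln n, which any multiple of n^2 exceeds in the end.\<close>

lemma xi_even_growth:
  assumes e: "e > 0"
  shows "\<forall>\<^sub>F n in sequentially. \<forall>z. norm z \<le> real n \<longrightarrow> norm (xi_even z) \<le> exp (e * (real n)\<^sup>2)"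
proof -
  define B where "B = (\<lambda>x::real. (1 + (1/4 + x\<^sup>2) * (8 * exp ((x + 1/4) * ln (2 * (x + 1/4))))) / 2)"
  have "\<forall>\<^sub>F n::nat in sequentially. B (real n) \<le> exp (e * (real n)\<^sup>2)"
    unfolding B_def using e by real_asymp
  then show ?thesis using eventually_ge_at_top[of 1]
  proof eventually_elim
    case (elim n)
    show ?case
    proof (intro allI impI)
      fix z :: complex assume z: "norm z \<le> real n"
      define C where "C = 2 * exp ((real n + 1/4) * ln (2 * (real n + 1/4)))"
      have "\<bar>Re z\<bar> \<le> 2 * real n" using abs_Re_le_cmod[of z] z by linarith
      then have "norm (xi_integral z) \<le> 2 * (\<integral>t. xi_weight t * exp (real n * \<bar>t\<bar>) \<partial>lborel)" by (rule norm_xi_integral_le)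
      also have "(\<integral>t. xi_weight t * exp (real n * \<bar>t\<bar>) \<partial>lborel) \<le> (\<integral>t. C * (indicator {0..} t * exp (- (1/2) * t)) \<partial>lborel)"
        unfolding C_def using has_bochner_integral_exp_atLeast[of "1/2"] elim(2)
        by (intro integral_mono xi_weight_integrable integrable_mult_right xi_weight_bound) (auto simp: has_bochner_integral_iff)
      also have "\<dots> = C * 2" using has_bochner_integral_exp_atLeast[of "1/2"] by (simp add: has_bochner_integral_iff)
      finally have P: "norm (xi_integral z) \<le> 4 * C" by simp
      have "norm (1/4 - z\<^sup>2) \<le> 1/4 + (real n)\<^sup>2"
      proof -
        have "norm (1/4 - z\<^sup>2) \<le> norm (1/4 :: complex) + norm (z\<^sup>2)" by (rule norm_triangle_ineq4)
        moreover have "norm (z\<^sup>2) \<le> (real n)\<^sup>2" unfolding norm_power by (rule power_mono[OF z norm_ge_zero])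
        moreover have "norm (1/4 :: complex) = 1/4" by simp
        ultimately show ?thesis by linarith
      qed
      then have "norm ((1/4 - z\<^sup>2) * xi_integral z) \<le> (1/4 + (real n)\<^sup>2) * (4 * C)"
        unfolding norm_mult using P by (intro mult_mono) auto
      then have "norm (1 - (1/4 - z\<^sup>2) * xi_integral z) \<le> 1 + (1/4 + (real n)\<^sup>2) * (4 * C)"
        using norm_triangle_ineq4[of 1 "(1/4 - z\<^sup>2) * xi_integral z"] by simp
      then have "norm (xi_even z) \<le> B (real n)" by (simp add: xi_even_def B_def C_def norm_divide)
      then show "norm (xi_even z) \<le> exp (e * (real n)\<^sup>2)" using elim(1) by linarith
    qed
  qed
qed

text \<open>On this square |1/4 - z^2| \<le> 1, while the integral is at most 8 / (3 pi^2) \<le>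
  2/3, so their product is not 1. The resulting bound \<open>\<bar>Im r\<bar> > 1/2\<close> for the
  zeros is what the comparison of \<open>zero_alpha\<close> with \<open>zero_beta\<close> draws
  on.\<close>

lemma xi_even_nonzero_low:
  assumes "\<bar>Re z\<bar> \<le> 1/2" "\<bar>Im z\<bar> \<le> 1/2"
  shows "xi_even z \<noteq> 0"
proof -
  have "norm (xi_integral z) \<le> 2 * (\<integral>t. xi_weight t * exp ((1/4) * \<bar>t\<bar>) \<partial>lborel)"
    using assms by (intro norm_xi_integral_le) auto
  also have "(\<integral>t. xi_weight t * exp ((1/4) * \<bar>t\<bar>) \<partial>lborel) \<le> (\<integral>t. (2 / pi\<^sup>2) * (indicator {0..} t * exp (- (3/2) * t)) \<partial>lborel)"
  proof (rule integral_mono)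
    show "integrable lborel (\<lambda>t::real. (2 / pi\<^sup>2) * (indicator {0..} t * exp (- (3/2) * t)))"
      using has_bochner_integral_exp_atLeast[of "3/2"] by (intro integrable_mult_right) (auto simp: has_bochner_integral_iff)
    show "xi_weight t * exp (1/4 * \<bar>t\<bar>) \<le> (2 / pi\<^sup>2) * (indicator {0..} t * exp (- (3/2) * t))" for t
    proof (cases "t \<ge> 0")
      case True
      then have "xi_weight t * exp (1/4 * \<bar>t\<bar>) = theta_psi (exp t) * exp (t / 2)"
        by (simp add: xi_weight_def flip: exp_add)
      also have "\<dots> \<le> 2 / (pi * exp t)\<^sup>2 * exp (t / 2)" by (intro mult_right_mono theta_psi_le_inverse_square) auto
      also have "\<dots> = (2 / pi\<^sup>2) * (exp (t / 2) / exp (2 * t))" by (simp add: power_mult_distrib exp_double)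
      also have "exp (t / 2) / exp (2 * t) = exp (- (3/2) * t)" by (simp flip: exp_diff)
      finally show ?thesis using True by simp
    qed (simp add: xi_weight_def)
  qed (rule xi_weight_integrable)
  also have "(\<integral>t. (2 / pi\<^sup>2) * (indicator {0..} t * exp (- (3/2) * t)) \<partial>lborel) = 4 / (3 * pi\<^sup>2)"
    using has_bochner_integral_mult_right[OF has_bochner_integral_exp_atLeast[of "3/2"], of "2 / pi\<^sup>2"]
    by (simp add: has_bochner_integral_iff)
  also have "4 / (3 * pi\<^sup>2) \<le> 4 / (3 * 2\<^sup>2)"
    using pi_ge_two by (intro divide_left_mono mult_left_mono power_mono) auto
  finally have P: "norm (xi_integral z) \<le> 2/3" by simp
  have "norm (1/4 - z\<^sup>2) \<le> 1"
  proof -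
    define x where "x = (Re z)\<^sup>2"
    define y where "y = (Im z)\<^sup>2"
    have x: "0 \<le> x" "x \<le> 1/4" using power_mono[OF assms(1), of 2] by (auto simp: x_def power_divide)
    have y: "0 \<le> y" "y \<le> 1/4" using power_mono[OF assms(2), of 2] by (auto simp: y_def power_divide)
    have "(norm (1/4 - z\<^sup>2))\<^sup>2 = (1/4 - x + y)\<^sup>2 + 4 * (x * y)"
      unfolding cmod_power2 by (simp add: x_def y_def power2_eq_square algebra_simps)
    also have "\<dots> \<le> (1/2)\<^sup>2 + 4 * (1/4 * (1/4))"
      using x y by (intro add_mono power_mono mult_left_mono mult_mono) auto
    finally have "(norm (1/4 - z\<^sup>2))\<^sup>2 \<le> 1\<^sup>2" by (simp add: power2_eq_square)
    then show ?thesis by (rule power2_le_imp_le) simp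
  qed
  then have "norm ((1/4 - z\<^sup>2) * xi_integral z) \<le> 1 * (2/3)"
    unfolding norm_mult using P by (intro mult_mono) auto
  then have "(1/4 - z\<^sup>2) * xi_integral z \<noteq> 1" by auto
  then show ?thesis by (simp add: xi_even_def)
qed

section \<open>Mellin transform of the Gaussian series and the values of xi on the real axis\<close>

lemma Gamma_integral_exp:
  assumes a: "a > 0" and c: "c > 0"
  shows "has_bochner_integral lborel (\<lambda>t::real. exp (a * t - c * exp t)) (Gamma a / c powr a)"
proof -
  define f where "f = (\<lambda>x::real. x powr (a - 1) / exp x)"
  have S: "(UNIV :: real set) \<in> sets lebesgue" by simp
  have d: "((\<lambda>t. c * exp t) has_field_derivative c * exp t) (at t within UNIV)" for t
    by (auto intro!: derivative_eq_intros)
  have inj: "inj_on (\<lambda>t. c * exp t) UNIV" using c by (auto simp: inj_on_def)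
  have im: "range (\<lambda>t. c * exp t) = {0<..}"
  proof (intro equalityI subsetI)
    fix y :: real assume y: "y \<in> {0<..}"
    then have "y = c * exp (ln (y / c))" using c by simp
    then show "y \<in> range (\<lambda>t. c * exp t)" by blast
  qed (use c in auto)
  have hi: "(f has_integral Gamma a) {0<..}"
  proof -
    have "((\<lambda>t. if t \<in> {0<..} then f t else 0) has_integral Gamma a) {0..}"
      by (rule has_integral_spike[of "{0}", OF _ _ Gamma_integral_real[OF a]]) (auto simp: f_def)
    then show ?thesis by (subst (asm) has_integral_restrict) auto
  qed
  have "f absolutely_integrable_on {0<..}"
    by (rule nonnegative_absolutely_integrable_1) (use hi in \<open>auto simp: f_def integrable_on_def\<close>)
  then have "f absolutely_integrable_on range (\<lambda>t. c * exp t) \<and> integral (range (\<lambda>t. c * exp t)) f = Gamma a"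
    unfolding im using hi by (simp add: integral_unique)
  then have "(\<lambda>t. \<bar>c * exp t\<bar> * f (c * exp t)) absolutely_integrable_on UNIV \<and>
      integral UNIV (\<lambda>t. \<bar>c * exp t\<bar> * f (c * exp t)) = Gamma a"
    using has_absolute_integral_change_of_variables_1'[OF S d inj] by blast
  then have "((\<lambda>t. \<bar>c * exp t\<bar> * f (c * exp t)) has_integral Gamma a) UNIV"
    using set_lebesgue_integral_eq_integral(1) integrable_integral by fastforce
  then have "((\<lambda>t. \<bar>c * exp t\<bar> * f (c * exp t) / c powr a) has_integral Gamma a / c powr a) UNIV"
    by (rule has_integral_divide)
  also have "(\<lambda>t. \<bar>c * exp t\<bar> * f (c * exp t) / c powr a) = (\<lambda>t. exp (a * t - c * exp t))"
  proof
    fix t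
    have "c * exp t * (c * exp t) powr (a - 1) = (c * exp t) powr a" using c by (simp add: powr_diff)
    then show "\<bar>c * exp t\<bar> * f (c * exp t) / c powr a = exp (a * t - c * exp t)"
      using c by (simp add: f_def powr_mult exp_powr_real exp_diff mult.commute)
  qed
  finally have "((\<lambda>t. exp (a * t - c * exp t)) has_integral Gamma a / c powr a) UNIV" .
  from has_bochner_integral_of_has_integral_nonneg[OF this] show ?thesis
    by (simp add: borel_measurable_continuous_onI continuous_intros)
qed

text \<open>Each term of the series is a Gamma integral with parameter c = pi n^2, which contributes
  n^(-2a); \<open>a > 1/2\<close> is the condition for these powers to be summable.\<close>

lemma theta_psi_mellin:
  assumes a: "a > 1/2"
  shows "has_bochner_integral lborel (\<lambda>t. theta_psi (exp t) * exp (a * t))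
     (Gamma a / pi powr a * (\<Sum>n. real (Suc n) powr (- (2 * a))))"
proof -
  define f where "f = (\<lambda>n t. exp (a * t - (pi * (real (Suc n))\<^sup>2) * exp t))"
  have f: "has_bochner_integral lborel (f n) (Gamma a / pi powr a * real (Suc n) powr (- (2 * a)))" for n
  proof -
    have "(pi * (real (Suc n))\<^sup>2) powr a = pi powr a * real (Suc n) powr (2 * a)"
      by (simp add: powr_mult powr_powr flip: powr_numeral)
    then have eq: "Gamma a / (pi * (real (Suc n))\<^sup>2) powr a = Gamma a / pi powr a * real (Suc n) powr (- (2 * a))"
      unfolding powr_minus by (simp add: divide_inverse)
    have "has_bochner_integral lborel (f n) (Gamma a / (pi * (real (Suc n))\<^sup>2) powr a)"
      unfolding f_def by (rule Gamma_integral_exp) (use a in auto)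
    then show ?thesis unfolding eq .
  qed
  have fi: "integrable lborel (f n)" "integral\<^sup>L lborel (f n) = Gamma a / pi powr a * real (Suc n) powr (- (2 * a))" for n
    using f by (auto simp: has_bochner_integral_iff)
  have nf: "norm (f n t) = f n t" for n t by (simp add: f_def)
  have fs: "(\<lambda>n. f n t) sums (theta_psi (exp t) * exp (a * t))" for t
  proof -
    have "(\<lambda>n. exp (- pi * (real (Suc n))\<^sup>2 * exp t) * exp (a * t)) sums (theta_psi (exp t) * exp (a * t))"
      unfolding theta_psi_def by (intro sums_mult2 summable_sums summable_theta_psi) auto
    moreover have "exp (- pi * (real (Suc n))\<^sup>2 * exp t) * exp (a * t) = f n t" for n
      unfolding f_def by (simp flip: exp_add)
    ultimately show ?thesis by simp
  qed
  have sz: "summable (\<lambda>n. real (Suc n) powr (- (2 * a)))"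
    using a by (subst summable_Suc_iff) (simp add: summable_real_powr_iff)
  have ae: "AE t in lborel. summable (\<lambda>n. norm (f n t))" unfolding nf using fs by (intro AE_I2) (auto simp: sums_iff)
  have sn: "summable (\<lambda>n. \<integral>t. norm (f n t) \<partial>lborel)" unfolding nf fi(2) by (intro summable_mult sz)
  have su: "(\<Sum>n. f n t) = theta_psi (exp t) * exp (a * t)" for t using fs by (simp add: sums_iff)
  have "integrable lborel (\<lambda>t. \<Sum>n. f n t)" by (rule integrable_suminf[OF fi(1) ae sn])
  moreover have "(\<integral>t. (\<Sum>n. f n t) \<partial>lborel) = (\<Sum>n. integral\<^sup>L lborel (f n))" by (rule integral_suminf[OF fi(1) ae sn])
  moreover have "(\<Sum>n. integral\<^sup>L lborel (f n)) = Gamma a / pi powr a * (\<Sum>n. real (Suc n) powr (- (2 * a)))"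
    unfolding fi(2) by (rule suminf_mult[OF sz])
  ultimately show ?thesis unfolding su by (simp add: has_bochner_integral_iff)
qed

text \<open>The functional equation at exp(-t), solved for the series itself: it folds the negative
  half-line onto the positive one.\<close>

lemma theta_psi_exp_uminus: "theta_psi (exp (- t)) = exp (t / 2) * theta_psi (exp t) + (exp (t / 2) - 1) / 2"
proof -
  have "sqrt (exp (- t)) = exp (- t / 2)"
    by (rule real_sqrt_unique) (auto simp: exp_double[symmetric])
  moreover have r: "1 / exp x = exp (- x)" for x :: real by (simp add: exp_minus inverse_eq_divide)
  ultimately have 1: "1 / sqrt (exp (- t)) = exp (t / 2)" by simp
  have 2: "1 / exp (- t) = exp t" unfolding r by simp
  have "1 + 2 * theta_psi (exp (- t)) = (1 + 2 * theta_psi (exp t)) * (1 / sqrt (exp (- t)))"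
    using theta_functional_equation[of "exp (- t)"] unfolding 2 by simp
  then show ?thesis unfolding 1 by (simp add: field_simps)
qed

text \<open>Riemann's splitting. The Mellin integral over the whole line is cut at t = 0 and its
  negative half is reflected; the elementary part \<open>(exp (t / 2) - 1) / 2\<close> of the
  reflection integrates to 1/(s-1) - 1/s.\<close>

lemma xi_integral_real:
  assumes s: "s > 1"
  shows "xi_integral (of_real (s - 1/2)) =
    of_real (Gamma (s/2) / pi powr (s/2) * (\<Sum>n. real (Suc n) powr (- s)) + 1 / s - 1 / (s - 1))"
proof -
  define a where "a = s / 2"
  have a: "a > 1/2" "a > 0" using s by (auto simp: a_def)
  define M where "M = Gamma a / pi powr a * (\<Sum>n. real (Suc n) powr (- (2 * a)))"
  define f where "f = (\<lambda>t. theta_psi (exp t) * exp (a * t))"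
  have f: "has_bochner_integral lborel f M" unfolding f_def M_def by (rule theta_psi_mellin[OF a(1)])
  have m: "{0::real..} \<in> sets lborel" "{..<0::real} \<in> sets lborel" by auto
  have f1: "integrable lborel (\<lambda>t. indicator {0..} t * f t)"
    using f integrable_mult_indicator[OF m(1), of f] by (auto simp: has_bochner_integral_iff)
  have f2: "integrable lborel (\<lambda>t. indicator {..<0} t * f t)"
    using f integrable_mult_indicator[OF m(2), of f] by (auto simp: has_bochner_integral_iff)
  have "M = (\<integral>t. indicator {0..} t * f t + indicator {..<0} t * f t \<partial>lborel)"
    using f by (auto simp: has_bochner_integral_iff indicator_def intro!: Bochner_Integration.integral_cong)
  also have "\<dots> = (\<integral>t. indicator {0..} t * f t \<partial>lborel) + (\<integral>t. indicator {..<0} t * f t \<partial>lborel)"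
    by (rule Bochner_Integration.integral_add[OF f1 f2])
  also have "(\<integral>t. indicator {..<0} t * f t \<partial>lborel) = (\<integral>t. indicator {..<0} (- t) * f (- t) \<partial>lborel)"
    using lborel_integral_real_affine[of "-1" "\<lambda>t. indicator {..<0} t * f t" 0] by simp
  also have "\<dots> = (\<integral>t. indicator {0..} t * (theta_psi (exp t) * exp ((1/2 - a) * t)) +
      (1/2) * (indicator {0..} t * exp (- (a - 1/2) * t) - indicator {0..} t * exp (- a * t)) \<partial>lborel)"
  proof (rule integral_cong_AE)
    \<comment> \<open>After the reflection the half-lines \<open>{..<0}\<close> and
      \<open>{0..}\<close> disagree only at t = 0.\<close>
    show "AE t in lborel. indicator {..<0} (- t) * f (- t) =
       indicator {0..} t * (theta_psi (exp t) * exp ((1/2 - a) * t)) +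
      (1/2) * (indicator {0..} t * exp (- (a - 1/2) * t) - indicator {0..} t * exp (- a * t))"
      using AE_lborel_singleton[of "0::real"]
    proof eventually_elim
      case (elim t)
      have "f (- t) = theta_psi (exp t) * (exp (t / 2) * exp (- a * t)) + (1/2) * (exp (t / 2) * exp (- a * t) - exp (- a * t))"
        unfolding f_def theta_psi_exp_uminus by (simp add: field_simps)
      also have "exp (t / 2) * exp (- a * t) = exp ((1/2 - a) * t)" by (simp flip: exp_add) (simp add: algebra_simps)
      finally have "f (- t) = theta_psi (exp t) * exp ((1/2 - a) * t) + (1/2) * (exp (- (a - 1/2) * t) - exp (- a * t))" by simp
      then show ?case using elim by (auto simp: indicator_def)
    qed
    show "(\<lambda>t. indicator {..<0} (- t) * f (- t)) \<in> borel_measurable lborel" unfolding f_def by measurable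
  qed measurable
  also have "\<dots> = (\<integral>t. indicator {0..} t * (theta_psi (exp t) * exp ((1/2 - a) * t)) \<partial>lborel) +
      (1/2) * (1 / (a - 1/2) - 1 / a)"
  proof -
    have i1: "integrable lborel (\<lambda>t. indicator {0..} t * (theta_psi (exp t) * exp ((1/2 - a) * t)))"
    proof (rule Bochner_Integration.integrable_bound[OF f1])
      show "AE t in lborel. norm (indicator {0..} t * (theta_psi (exp t) * exp ((1/2 - a) * t))) \<le> norm (indicator {0..} t * f t)"
      proof (rule AE_I2)
        fix t :: real
        show "norm (indicator {0..} t * (theta_psi (exp t) * exp ((1/2 - a) * t))) \<le> norm (indicator {0..} t * f t)"
        proof (cases "t \<ge> 0")
          case True
          then have "(1/2 - a) * t \<le> a * t" using a by (intro mult_right_mono) auto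
          then show ?thesis by (simp add: f_def abs_mult mult_left_mono)
        qed simp
      qed
    qed measurable
    have i2: "has_bochner_integral lborel (\<lambda>t. (1/2) * (indicator {0..} t * exp (- (a - 1/2) * t) - indicator {0..} t * exp (- a * t)))
        ((1/2) * (1 / (a - 1/2) - 1 / a))"
      using a by (intro has_bochner_integral_mult_right has_bochner_integral_diff has_bochner_integral_exp_atLeast) auto
    show ?thesis using Bochner_Integration.integral_add[OF i1, of "\<lambda>t. (1/2) * (indicator {0..} t * exp (- (a - 1/2) * t) - indicator {0..} t * exp (- a * t))"] i2
      by (simp only: has_bochner_integral_iff)
  qed
  finally have M: "M = (\<integral>t. indicator {0..} t * f t \<partial>lborel) +
    ((\<integral>t. indicator {0..} t * (theta_psi (exp t) * exp ((1/2 - a) * t)) \<partial>lborel) + (1/2) * (1 / (a - 1/2) - 1 / a))" .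
  have e1: "complex_of_real (xi_weight t) * exp (of_real (s - 1/2) / 2 * of_real t) = of_real (indicator {0..} t * f t)" for t
  proof -
    have 1: "exp (complex_of_real (s - 1/2) / 2 * of_real t) = of_real (exp ((s - 1/2) / 2 * t))"
      by (simp flip: exp_of_real)
    have 2: "xi_weight t * exp ((s - 1/2) / 2 * t) = indicator {0..} t * f t"
      unfolding xi_weight_def f_def mult.assoc exp_add[symmetric] by (simp add: a_def algebra_simps diff_divide_distrib)
    show ?thesis unfolding 1 of_real_mult[symmetric] 2 ..
  qed
  have e2: "complex_of_real (xi_weight t) * exp (- of_real (s - 1/2) / 2 * of_real t) =
      of_real (indicator {0..} t * (theta_psi (exp t) * exp ((1/2 - a) * t)))" for t
  proof -
    have 1: "exp (- complex_of_real (s - 1/2) / 2 * of_real t) = of_real (exp (- (s - 1/2) / 2 * t))"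
      by (simp flip: exp_of_real)
    have 2: "xi_weight t * exp (- (s - 1/2) / 2 * t) = indicator {0..} t * (theta_psi (exp t) * exp ((1/2 - a) * t))"
      unfolding xi_weight_def mult.assoc exp_add[symmetric] by (simp add: a_def algebra_simps diff_divide_distrib)
    show ?thesis unfolding 1 of_real_mult[symmetric] 2 ..
  qed
  have "xi_integral (of_real (s - 1/2)) = of_real ((\<integral>t. indicator {0..} t * f t \<partial>lborel) +
      (\<integral>t. indicator {0..} t * (theta_psi (exp t) * exp ((1/2 - a) * t)) \<partial>lborel))"
    unfolding xi_integral_split e1 e2 integral_complex_of_real of_real_add ..
  also have "(\<integral>t. indicator {0..} t * f t \<partial>lborel) +
      (\<integral>t. indicator {0..} t * (theta_psi (exp t) * exp ((1/2 - a) * t)) \<partial>lborel) = M - (1/2) * (1 / (a - 1/2) - 1 / a)"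
    using M by simp
  also have "(1/2) * (1 / (a - 1/2) - 1 / a) = 1 / (s - 1) - 1 / s" using s by (simp add: a_def field_simps)
  finally show ?thesis by (simp add: M_def a_def)
qed

text \<open>Since 1/4 - (s - 1/2)^2 = - s (s - 1), the leading 1 in \<open>xi_even\<close> cancels
  the two pole terms of \<open>xi_integral_real\<close>.\<close>

lemma xi_even_real:
  assumes s: "s > 1"
  shows "xi_even (of_real (s - 1/2)) =
    of_real (s * (s - 1) / 2 * (Gamma (s/2) / pi powr (s/2)) * (\<Sum>n. real (Suc n) powr (- s)))"
proof -
  define X where "X = Gamma (s/2) / pi powr (s/2) * (\<Sum>n. real (Suc n) powr (- s))"
  have "xi_even (of_real (s - 1/2)) = of_real ((1 - (1/4 - (s - 1/2)\<^sup>2) * (X + 1 / s - 1 / (s - 1))) / 2)"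
    unfolding xi_even_def xi_integral_real[OF s] X_def by simp
  also have "(1 - (1/4 - (s - 1/2)\<^sup>2) * (X + 1 / s - 1 / (s - 1))) / 2 = s * (s - 1) / 2 * X"
  proof -
    have q: "1/4 - (s - 1/2)\<^sup>2 = - (s * (s - 1))" by (simp add: power2_eq_square algebra_simps)
    have "s * (s - 1) * (1 / s - 1 / (s - 1)) = -1" using s by (simp add: field_simps)
    then have "s * (s - 1) * (X + 1 / s - 1 / (s - 1)) = s * (s - 1) * X - 1" by (simp add: algebra_simps)
    then show ?thesis unfolding q by simp
  qed
  finally show ?thesis by (simp add: X_def mult.assoc)
qed

section \<open>The Dirichlet eta function\<close>

definition zeta_series :: "complex \<Rightarrow> complex" where
  "zeta_series s = (\<Sum>n. 1 / of_nat (Suc n) powr s)"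

lemma norm_inverse_nat_powr: "norm (1 / of_nat (Suc n) powr s :: complex) = real (Suc n) powr (- Re s)"
proof -
  have "norm (complex_of_real (real (Suc n)) powr s) = real (Suc n) powr Re s"
    by (subst norm_powr_real_powr) (auto simp del: of_nat_Suc)
  then show ?thesis by (simp add: norm_divide powr_minus inverse_eq_divide del: of_nat_Suc)
qed

lemma summable_Suc_powr: "a > 1 \<Longrightarrow> summable (\<lambda>n. real (Suc n) powr (- a))"
  by (subst summable_Suc_iff) (simp add: summable_real_powr_iff)

lemma summable_norm_zeta_series: "Re s > 1 \<Longrightarrow> summable (\<lambda>n. norm (1 / of_nat (Suc n) powr s :: complex))"
  unfolding norm_inverse_nat_powr by (rule summable_Suc_powr)

lemma zeta_series_sums: "Re s > 1 \<Longrightarrow> (\<lambda>n. 1 / of_nat (Suc n) powr s) sums zeta_series s"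
  unfolding zeta_series_def by (intro summable_sums summable_norm_cancel[OF summable_norm_zeta_series])

lemma zeta_series_of_real:
  assumes "x > 1"
  shows "zeta_series (of_real x) = of_real (\<Sum>n. real (Suc n) powr (- x))"
proof -
  have "1 / of_nat (Suc n) powr (of_real x) = complex_of_real (real (Suc n) powr (- x))" for n
  proof -
    have "complex_of_real (real (Suc n) powr (- x)) = of_real (real (Suc n)) powr of_real (- x)"
      by (intro powr_of_real[symmetric]) simp
    also have "\<dots> = of_nat (Suc n) powr (- of_real x)" by (simp only: of_real_of_nat_eq of_real_minus)
    finally show ?thesis by (simp add: powr_minus inverse_eq_divide)
  qed
  then show ?thesis unfolding zeta_series_def by (simp only: suminf_of_real[OF summable_Suc_powr[OF assms]])
qed

text \<open>Pairing neighbouring terms gains one power of x, which makes the eta series absolutely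
  convergent for all Re s > 0.\<close>

lemma powr_difference_bound:
  assumes "Re s \<ge> 0" and x: "x > 0"
  shows "norm (1 / of_real x powr s - 1 / of_real (x + 1) powr s :: complex) \<le> norm s * x powr (- Re s - 1)"
proof -
  define f where "f = (\<lambda>z::complex. z powr (- s))"
  have seg: "z \<in> closed_segment (of_real x) (of_real (x + 1)) \<Longrightarrow> \<exists>t. z = of_real t \<and> x \<le> t" for z :: complex
  proof -
    assume "z \<in> closed_segment (of_real x) (of_real (x + 1))"
    then obtain u where u: "0 \<le> u" "z = (1 - u) *\<^sub>R of_real x + u *\<^sub>R of_real (x + 1)"
      unfolding closed_segment_def by blast
    then have "z = of_real (x + u)" by (simp add: scaleR_conv_of_real algebra_simps)
    then show ?thesis using u(1) by (intro exI[of _ "x + u"]) auto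
  qed
  have "norm (f (of_real (x + 1)) - f (of_real x)) \<le> (norm s * x powr (- Re s - 1)) * norm (complex_of_real (x + 1) - of_real x)"
  proof (rule field_differentiable_bound[where S = "closed_segment (complex_of_real x) (of_real (x + 1))" and f' = "\<lambda>z. - s * z powr (- s - 1)"])
    fix z assume "z \<in> closed_segment (complex_of_real x) (of_real (x + 1))"
    then obtain t where t: "z = of_real t" "x \<le> t" using seg by blast
    have "z \<notin> \<real>\<^sub>\<le>\<^sub>0" using t x by (simp add: complex_nonpos_Reals_iff)
    then have "((\<lambda>z. z powr (- s)) has_field_derivative - s * z powr (- s - 1)) (at z)"
      by (rule has_field_derivative_powr)
    then show "(f has_field_derivative - s * z powr (- s - 1)) (at z within closed_segment (of_real x) (of_real (x + 1)))"
      unfolding f_def by (rule has_field_derivative_at_within)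
    have "norm (z powr (- s - 1)) = t powr (- Re s - 1)"
      unfolding t(1) using t x by (subst norm_powr_real_powr) auto
    also have "\<dots> \<le> x powr (- Re s - 1)" using assms t by (intro powr_mono2') auto
    finally show "norm (- s * z powr (- s - 1)) \<le> norm s * x powr (- Re s - 1)"
      by (simp add: norm_mult mult_left_mono)
  qed auto
  then have "norm (f (of_real (x + 1)) - f (of_real x)) \<le> norm s * x powr (- Re s - 1)" by simp
  then have "norm (f (of_real x) - f (of_real (x + 1))) \<le> norm s * x powr (- Re s - 1)"
    by (simp only: norm_minus_commute)
  moreover have "f z = 1 / z powr s" for z by (simp add: f_def powr_minus inverse_eq_divide)
  ultimately show ?thesis by simp
qed

lemma sums_of_sums_pairs:
  fixes a :: "nat \<Rightarrow> 'a :: real_normed_vector"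
  assumes "(\<lambda>k. a (2 * k) + a (2 * k + 1)) sums L" "a \<longlonglongrightarrow> 0"
  shows "a sums L"
proof -
  define S where "S = (\<lambda>N. \<Sum>n<N. a n)"
  have S2: "S (2 * N) = (\<Sum>k<N. a (2 * k) + a (2 * k + 1))" for N
    by (induction N) (auto simp: S_def)
  have 1: "(\<lambda>N. S (2 * N)) \<longlonglongrightarrow> L" using assms(1) unfolding S2 sums_def .
  have "filterlim (\<lambda>N::nat. N div 2) sequentially sequentially"
  proof (rule filterlim_at_top[THEN iffD2], intro allI)
    fix Z :: nat
    show "\<forall>\<^sub>F N in sequentially. Z \<le> N div 2"
      using eventually_ge_at_top[of "2 * Z"] by eventually_elim simp
  qed
  from filterlim_compose[OF 1 this] have 2: "(\<lambda>N. S (2 * (N div 2))) \<longlonglongrightarrow> L" .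
  have 3: "(\<lambda>N. if odd N then a (N - 1) else 0) \<longlonglongrightarrow> 0"
  proof (rule Lim_null_comparison)
    show "\<forall>\<^sub>F N in sequentially. norm (if odd N then a (N - 1) else 0) \<le> norm (a (N - 1))" by simp
    have "(\<lambda>N. norm (a (Suc N - 1))) \<longlonglongrightarrow> 0" using tendsto_norm_zero[OF assms(2)] by simp
    then show "(\<lambda>N. norm (a (N - 1))) \<longlonglongrightarrow> 0" by (rule LIMSEQ_imp_Suc)
  qed
  have "S N = S (2 * (N div 2)) + (if odd N then a (N - 1) else 0)" for N
  proof (cases "odd N")
    case True
    then obtain k where "N = 2 * k + 1" by (auto elim: oddE)
    then show ?thesis by (simp add: S_def)
  qed simp
  then have "S = (\<lambda>N. S (2 * (N div 2)) + (if odd N then a (N - 1) else 0))" by blast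
  moreover have "(\<lambda>N. S (2 * (N div 2)) + (if odd N then a (N - 1) else 0)) \<longlonglongrightarrow> L + 0"
    by (intro tendsto_add 2 3)
  ultimately have "S \<longlonglongrightarrow> L" by simp
  then show ?thesis by (simp add: sums_def S_def)
qed

definition eta_pair :: "nat \<Rightarrow> complex \<Rightarrow> complex" where
  "eta_pair k s = 1 / of_nat (Suc (2 * k)) powr s - 1 / of_nat (Suc (2 * k + 1)) powr s"

lemma norm_eta_pair_le:
  assumes "Re s \<ge> d" "d > 0"
  shows "norm (eta_pair k s) \<le> norm s * real (Suc k) powr (- (d + 1))"
proof -
  have "norm (eta_pair k s) \<le> norm s * real (Suc (2 * k)) powr (- Re s - 1)"
    using powr_difference_bound[of s "real (Suc (2 * k))"] assms by (simp add: eta_pair_def add.commute)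
  also have "\<dots> \<le> norm s * real (Suc k) powr (- Re s - 1)"
    using assms by (intro mult_left_mono powr_mono2') auto
  also have "\<dots> \<le> norm s * real (Suc k) powr (- (d + 1))"
    using assms by (intro mult_left_mono powr_mono) auto
  finally show ?thesis .
qed

lemma dirichlet_eta_eq_pairs:
  assumes s: "Re s > 0"
  shows "dirichlet_eta s = (\<Sum>k. eta_pair k s)"
proof -
  have "summable (\<lambda>k. eta_pair k s)"
    by (rule summable_comparison_test'[OF summable_mult[OF summable_Suc_powr[of "Re s + 1"], of "norm s"], of 0])
       (use s norm_eta_pair_le[of "Re s" s] in auto)
  define L where "L = (\<Sum>k. eta_pair k s)"
  have "(\<lambda>k. eta_pair k s) sums L" unfolding L_def by (rule summable_sums[OF \<open>summable _\<close>])
  also have "(\<lambda>k. eta_pair k s) = (\<lambda>k. (-1) ^ (2 * k) / of_nat (Suc (2 * k)) powr s + (-1) ^ (2 * k + 1) / of_nat (Suc (2 * k + 1)) powr s)"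
    by (rule ext) (simp add: eta_pair_def)
  finally have "(\<lambda>n. (-1) ^ n / of_nat (Suc n) powr s) sums L"
  proof (rule sums_of_sums_pairs)
    have "(\<lambda>n. real (Suc n) powr (- Re s)) \<longlonglongrightarrow> 0"
      using s by (intro tendsto_neg_powr filterlim_compose[OF filterlim_real_sequentially filterlim_Suc]) auto
    then have "(\<lambda>n. norm (1 / of_nat (Suc n) powr s :: complex)) \<longlonglongrightarrow> 0" unfolding norm_inverse_nat_powr .
    then have "(\<lambda>n. norm ((-1) ^ n / of_nat (Suc n) powr s :: complex)) \<longlonglongrightarrow> 0"
      by (simp add: norm_divide norm_power)
    then show "(\<lambda>n. (-1) ^ n / of_nat (Suc n) powr s :: complex) \<longlonglongrightarrow> 0" by (rule tendsto_norm_zero_cancel)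
  qed
  then show ?thesis unfolding dirichlet_eta_def L_def by (simp add: sums_iff)
qed

text \<open>On the ball of radius Re x / 2 about x the real part stays above d = Re x / 2, so the
  paired terms have the common summable majorant n^(-d-1).\<close>

lemma dirichlet_eta_holomorphic: "dirichlet_eta holomorphic_on {s. Re s > 0}"
proof -
  have "(\<lambda>s. \<Sum>k. eta_pair k s) holomorphic_on {s. Re s > 0}"
  proof (rule holomorphic_uniform_sequence[OF open_halfspace_Re_gt])
    show "(\<lambda>s. \<Sum>k<n. eta_pair k s) holomorphic_on {s. Re s > 0}" for n
      unfolding eta_pair_def by (intro holomorphic_intros) (auto simp del: of_nat_Suc)
    fix x :: complex assume x: "x \<in> {s. Re s > 0}"
    define d where "d = Re x / 2"
    have d: "d > 0" using x by (simp add: d_def)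
    have Re: "Re s \<ge> d" if "s \<in> cball x d" for s
      using that abs_Re_le_cmod[of "x - s"] by (simp add: dist_norm d_def)
    have "uniform_limit (cball x d) (\<lambda>n s. \<Sum>k<n. eta_pair k s) (\<lambda>s. \<Sum>k. eta_pair k s) sequentially"
    proof (rule Weierstrass_m_test)
      show "summable (\<lambda>k. (norm x + d) * real (Suc k) powr (- (d + 1)))"
        using d by (intro summable_mult summable_Suc_powr) auto
      show "norm (eta_pair k s) \<le> (norm x + d) * real (Suc k) powr (- (d + 1))" if s: "s \<in> cball x d" for k s
      proof -
        have "norm s \<le> norm x + d" using s norm_triangle_ineq2[of s x] by (simp add: dist_norm norm_minus_commute)
        then have "norm s * real (Suc k) powr (- (d + 1)) \<le> (norm x + d) * real (Suc k) powr (- (d + 1))"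
          by (intro mult_right_mono) auto
        then show ?thesis using norm_eta_pair_le[OF Re[OF s] d, of k] by linarith
      qed
    qed
    moreover have "cball x d \<subseteq> {s. Re s > 0}" using Re d by fastforce
    ultimately show "\<exists>d>0. cball x d \<subseteq> {s. Re s > 0} \<and> uniform_limit (cball x d) (\<lambda>n s. \<Sum>k<n. eta_pair k s) (\<lambda>s. \<Sum>k. eta_pair k s) sequentially"
      using d by blast
  qed
  then show ?thesis by (rule holomorphic_transform) (simp add: dirichlet_eta_eq_pairs)
qed

text \<open>The alternating signs come from subtracting twice the terms at even integers, which sum
  to \<open>2 powr (- s) * zeta_series s\<close>. Indices start at 0, so even integers are the odd
  \<open>n\<close> in \<open>f\<close>.\<close>

lemma dirichlet_eta_eq_zeta_series:
  assumes s: "Re s > 1"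
  shows "dirichlet_eta s = (1 - 2 powr (1 - s)) * zeta_series s"
proof -
  note z = zeta_series_sums[OF s]
  have "(\<lambda>k. 2 * 2 powr (- s) * (1 / of_nat (Suc k) powr s)) sums (2 * 2 powr (- s) * zeta_series s)"
    by (rule sums_mult[OF z])
  moreover have "2 * 2 powr (- s) * (1 / of_nat (Suc k) powr s) = 2 / of_nat (Suc (2 * k + 1)) powr s" for k
  proof -
    have "complex_of_nat (Suc (2 * k + 1)) = of_real 2 * of_real (real (Suc k))" by simp
    also have "\<dots> powr s = of_real 2 powr s * of_real (real (Suc k)) powr s"
      by (rule powr_times_real) auto
    finally have "complex_of_nat (Suc (2 * k + 1)) powr s = 2 powr s * of_nat (Suc k) powr s" by (simp del: of_nat_Suc)
    then show ?thesis by (simp add: powr_minus divide_inverse del: of_nat_Suc)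
  qed
  ultimately have 1: "(\<lambda>k. 2 / of_nat (Suc (2 * k + 1)) powr s) sums (2 * 2 powr (- s) * zeta_series s)" by simp
  define f where "f = (\<lambda>n. if odd n then 2 / of_nat (Suc n) powr s else 0)"
  have "(\<lambda>k. f (2 * k + 1)) sums (2 * 2 powr (- s) * zeta_series s)" using 1 by (simp add: f_def)
  then have 2: "f sums (2 * 2 powr (- s) * zeta_series s)"
    by (subst (asm) sums_mono_reindex) (auto simp: strict_mono_def f_def elim!: oddE)
  have "(\<lambda>n. 1 / of_nat (Suc n) powr s - f n) sums (zeta_series s - 2 * 2 powr (- s) * zeta_series s)"
    by (rule sums_diff[OF z 2])
  moreover have "1 / of_nat (Suc n) powr s - f n = (-1) ^ n / of_nat (Suc n) powr s" for n
    by (cases "odd n") (auto simp: f_def field_simps)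
  ultimately have "(\<lambda>n. (-1) ^ n / of_nat (Suc n) powr s) sums (zeta_series s - 2 * 2 powr (- s) * zeta_series s)" by simp
  then have "dirichlet_eta s = zeta_series s - 2 * 2 powr (- s) * zeta_series s"
    unfolding dirichlet_eta_def by (rule sums_unique[symmetric])
  also have "2 * 2 powr (- s) = 2 powr (1 - s)" by (simp add: powr_diff powr_minus divide_inverse)
  finally show ?thesis by (simp add: algebra_simps)
qed

lemma dirichlet_eta_cnj:
  assumes "Re s > 0"
  shows "dirichlet_eta (cnj s) = cnj (dirichlet_eta s)"
proof -
  have "eta_pair k (cnj s) = cnj (eta_pair k s)" for k
  proof -
    have "complex_of_nat (Suc m) powr cnj s = cnj (of_nat (Suc m) powr s)" for m
      by (subst cnj_powr) (auto simp del: of_nat_Suc simp: complex_nonpos_Reals_iff complex_cnj_of_nat)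
    then show ?thesis by (simp add: eta_pair_def del: of_nat_Suc)
  qed
  moreover have "summable (\<lambda>k. eta_pair k s)"
    by (rule summable_comparison_test'[OF summable_mult[OF summable_Suc_powr[of "Re s + 1"], of "norm s"], of 0])
       (use assms norm_eta_pair_le[of "Re s" s] in auto)
  ultimately have "(\<lambda>k. eta_pair k (cnj s)) sums cnj (\<Sum>k. eta_pair k s)"
    by (simp add: sums_cnj summable_sums)
  then show ?thesis using assms by (simp add: dirichlet_eta_eq_pairs sums_iff)
qed

section \<open>Zeta and xi in the critical strip\<close>

text \<open>The completing factor of zeta with s - 1 split off. The rest is holomorphic and free of
  zeros on Re s > 0, so in the strip the zeros of zeta and of \<open>xi_even\<close> correspond,
  with multiplicity.\<close>

definition xi_factor :: "complex \<Rightarrow> complex" where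
  "xi_factor s = s / 2 * Gamma (s / 2) * of_real pi powr (- s / 2)"

lemma half_not_nonpos_Int: "Re s > 0 \<Longrightarrow> s / 2 \<notin> \<int>\<^sub>\<le>\<^sub>0"
proof
  assume s: "Re s > 0" and "s / 2 \<in> \<int>\<^sub>\<le>\<^sub>0"
  then obtain n where "s / 2 = - of_nat n" by (elim nonpos_Ints_cases')
  then have "Re (s / 2) = - real n" by simp
  then show False using s by simp
qed

lemma xi_factor_holomorphic: "xi_factor holomorphic_on {s. Re s > 0}"
  unfolding xi_factor_def
  by (intro holomorphic_intros) (use half_not_nonpos_Int in auto)

lemma xi_factor_nonzero: "Re s > 0 \<Longrightarrow> xi_factor s \<noteq> 0"
  using half_not_nonpos_Int[of s] by (auto simp: xi_factor_def Gamma_eq_zero_iff)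

lemma xi_factor_of_real:
  "x > 0 \<Longrightarrow> xi_factor (of_real x) = of_real (x / 2 * (Gamma (x / 2) / pi powr (x / 2)))"
proof -
  assume "x > 0"
  have "pi powr (- x / 2) = inverse (pi powr (x / 2))" using powr_minus[of pi "x / 2"] by simp
  then have 1: "complex_of_real pi powr (- of_real x / 2) = of_real (inverse (pi powr (x / 2)))"
    using powr_of_real[of pi "- x / 2"] by simp
  have 2: "Gamma (complex_of_real x / 2) = of_real (Gamma (x / 2))"
    using Gamma_complex_of_real[of "x / 2"] by simp
  have "xi_factor (of_real x) = of_real x / 2 * of_real (Gamma (x / 2)) * of_real (inverse (pi powr (x / 2)))"
    unfolding xi_factor_def 1 2 ..
  also have "\<dots> = of_real (x / 2 * Gamma (x / 2) * inverse (pi powr (x / 2)))"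
    by (simp only: of_real_mult of_real_divide of_real_numeral)
  also have "x / 2 * Gamma (x / 2) * inverse (pi powr (x / 2)) = x / 2 * (Gamma (x / 2) / pi powr (x / 2))"
    by (simp only: divide_inverse mult.assoc)
  finally show ?thesis .
qed

text \<open>Both sides are holomorphic on Re s > 0 and agree on the real ray s > 1, where the Mellin
  computation applies; the identity theorem extends this. The product form stays meaningful at the
  zeros of \<open>1 - 2 powr (1 - s)\<close> on Re s = 1, where division would break down.\<close>

lemma xi_even_eta:
  assumes s: "Re s > 0"
  shows "xi_even (s - 1/2) * (1 - 2 powr (1 - s)) = (s - 1) * xi_factor s * dirichlet_eta s"
proof -
  define f where "f = (\<lambda>s. xi_even (s - 1/2) * (1 - 2 powr (1 - s)) - (s - 1) * xi_factor s * dirichlet_eta s)"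
  define U where "U = complex_of_real ` {1<..}"
  have "(xi_even \<circ> (\<lambda>s. s - 1/2)) holomorphic_on {s. Re s > 0}"
    by (rule holomorphic_on_compose_gen[OF _ xi_even_holomorphic]) (auto intro!: holomorphic_intros)
  then have h: "(\<lambda>s. xi_even (s - 1/2)) holomorphic_on {s. Re s > 0}" by (simp add: o_def)
  have fh: "f holomorphic_on {s. Re s > 0}"
    unfolding f_def by (intro holomorphic_intros h xi_factor_holomorphic dirichlet_eta_holomorphic) auto
  have f0: "f z = 0" if zU: "z \<in> U" for z
  proof -
    obtain x where x: "z = of_real x" "x > 1" using zU by (auto simp: U_def)
    have "of_real x - 1/2 = complex_of_real (x - 1/2)" by simp
    then have "xi_even (z - 1/2) = of_real (x * (x - 1) / 2 * (Gamma (x/2) / pi powr (x/2)) * (\<Sum>n. real (Suc n) powr (- x)))"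
      unfolding x(1) by (simp only: xi_even_real[OF x(2)])
    also have "\<dots> = (z - 1) * xi_factor z * zeta_series z"
      unfolding x(1) using x(2) by (simp add: xi_factor_of_real zeta_series_of_real)
    finally show ?thesis unfolding f_def using x by (simp add: dirichlet_eta_eq_zeta_series)
  qed
  have lim: "2 islimpt U"
  proof -
    have "(2::real) islimpt {1<..}" by (rule interior_limit_point) (simp add: interior_open)
    then have "\<exists>X. (\<forall>n. X n \<in> {1<..} - {2::real}) \<and> X \<longlonglongrightarrow> 2" by (simp add: islimpt_sequential)
    then obtain X where X: "\<And>n. X n \<in> {1<..} - {2::real}" "X \<longlonglongrightarrow> 2" by blast
    have "(\<lambda>n. complex_of_real (X n)) \<longlonglongrightarrow> of_real 2" by (intro tendsto_of_real X(2))
    moreover have "complex_of_real (X n) \<in> U - {2}" for n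
      using X(1)[of n] by (auto simp: U_def complex_eq_iff)
    ultimately show ?thesis unfolding islimpt_sequential by (intro exI[of _ "\<lambda>n. complex_of_real (X n)"]) auto
  qed
  have "f s = 0"
    by (rule analytic_continuation[OF fh open_halfspace_Re_gt _ _ _ lim f0])
       (use s in \<open>auto simp: U_def intro: convex_connected convex_halfspace_Re_gt\<close>)
  then show ?thesis by (simp add: f_def)
qed

lemma one_minus_two_powr_nonzero: "Re s \<noteq> 1 \<Longrightarrow> 1 - 2 powr (1 - s) \<noteq> (0::complex)"
proof
  assume "Re s \<noteq> 1" "1 - 2 powr (1 - s) = 0"
  then have "norm (2 powr (1 - s)) = 1" by simp
  moreover have "norm (complex_of_real 2 powr (1 - s)) = 2 powr (Re (1 - s))" by (subst norm_powr_real_powr) auto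
  ultimately have "2 powr (1 - Re s) = (1::real)" by simp
  then show False using \<open>Re s \<noteq> 1\<close> by (simp add: powr_eq_one_iff_gen)
qed

lemma zeta_eq_xi:
  assumes "Re s > 0" "Re s < 1"
  shows "zeta s = xi_even (s - 1/2) / ((s - 1) * xi_factor s)"
proof -
  have nz: "1 - 2 powr (1 - s) \<noteq> 0" using assms by (intro one_minus_two_powr_nonzero) auto
  have "(s - 1) * xi_factor s \<noteq> 0" using assms xi_factor_nonzero[of s] by auto
  then show ?thesis using xi_even_eta[OF assms(1)] nz unfolding zeta_def
    by (simp add: frac_eq_eq mult_ac)
qed

lemma zeta_series_eq_xi:
  assumes "Re s > 1"
  shows "zeta_series s = xi_even (s - 1/2) / ((s - 1) * xi_factor s)"
proof -
  have nz: "1 - 2 powr (1 - s) \<noteq> 0" using assms by (intro one_minus_two_powr_nonzero) auto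
  have k: "(s - 1) * xi_factor s \<noteq> 0" using assms xi_factor_nonzero[of s] by auto
  have "xi_even (s - 1/2) * (1 - 2 powr (1 - s)) = ((s - 1) * xi_factor s * zeta_series s) * (1 - 2 powr (1 - s))"
    using xi_even_eta[of s] dirichlet_eta_eq_zeta_series[OF assms] assms by (simp add: mult_ac)
  then have "xi_even (s - 1/2) = (s - 1) * xi_factor s * zeta_series s" using nz by (simp only: mult_cancel_right) simp
  then show ?thesis using k by simp
qed

lemma xi_even_half: "xi_even (1/2) = 1/2"
  by (simp add: xi_even_def power_divide)

lemma xi_even_0: "xi_even 0 \<noteq> 0"
  by (rule xi_even_nonzero_low) auto

lemma zorder_eq_Least_deriv:
  assumes hol: "f holomorphic_on A" and A: "open A" "connected A" "z \<in> A" and nz: "\<exists>w\<in>A. f w \<noteq> 0"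
  shows "zorder f z = int (LEAST n. (deriv ^^ n) f z \<noteq> 0)"
proof -
  have ex: "\<exists>n. (deriv ^^ n) f z \<noteq> 0"
  proof (rule ccontr)
    assume "\<not> ?thesis"
    then have "f w = 0" if "w \<in> A" for w
      using holomorphic_fun_eq_0_on_connected[OF hol A(1,2) _ A(3) that] by blast
    then show False using nz by auto
  qed
  have ana: "f analytic_on {z}" unfolding analytic_at using hol A by blast
  show ?thesis
    by (rule zorder_zero_eqI'[OF ana]) (use not_less_Least LeastI_ex[OF ex] in auto)
qed

text \<open>On the strip zeta is \<open>xi_even (s - 1/2)\<close> times the zero-free function
  \<open>k\<close>, so the orders agree; for a holomorphic function that is not identically zero the
  order is the index of the first nonvanishing derivative.\<close>

lemma zeta_zero_mult_eq:
  assumes "0 < Re s" "Re s < 1"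
  shows "zeta_zero_mult s = nat (zorder xi_even (s - 1/2))"
proof -
  define A where "A = {s. 0 < Re s} \<inter> {s. Re s < 1}"
  have A: "open A" "connected A" "s \<in> A"
    unfolding A_def using assms
    by (auto intro!: open_Int open_halfspace_Re_gt open_halfspace_Re_lt convex_connected convex_Int convex_halfspace_Re_gt convex_halfspace_Re_lt)
  have h: "(\<lambda>s. xi_even (s - 1/2)) holomorphic_on UNIV"
    by (rule holomorphic_on_compose_gen[OF _ xi_even_holomorphic, unfolded o_def]) (auto intro!: holomorphic_intros)
  define k where "k = (\<lambda>s. 1 / ((s - 1) * xi_factor s))"
  have kh: "k holomorphic_on A" unfolding k_def
    by (intro holomorphic_intros holomorphic_on_subset[OF xi_factor_holomorphic]) (use xi_factor_nonzero in \<open>auto simp: A_def\<close>)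
  have knz: "k w \<noteq> 0" if "w \<in> A" for w using that xi_factor_nonzero[of w] by (auto simp: k_def A_def)
  have zk: "zeta w = xi_even (w - 1/2) * k w" if "w \<in> A" for w using that by (simp add: zeta_eq_xi A_def k_def)
  have zh: "zeta holomorphic_on A"
    by (rule holomorphic_transform[of "\<lambda>w. xi_even (w - 1/2) * k w"])
       (auto simp: zk intro!: holomorphic_intros kh holomorphic_on_subset[OF h])
  have "1/2 \<in> A" by (simp add: A_def)
  then have nz: "\<exists>w\<in>A. zeta w \<noteq> 0" using zk[of "1/2"] knz xi_even_0 by (intro bexI[of _ "1/2"]) auto
  have "int (zeta_zero_mult s) = zorder zeta s"
    unfolding zeta_zero_mult_def using zorder_eq_Least_deriv[OF zh A nz] by simp
  also have "\<dots> = zorder (\<lambda>w. xi_even (w - 1/2) * k w) s"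
  proof (rule zorder_cong)
    have "eventually (\<lambda>w. w \<in> A) (nhds s)" using A by (intro eventually_nhds_in_open)
    then have "eventually (\<lambda>w. zeta w = xi_even (w - 1/2) * k w) (nhds s)" by eventually_elim (rule zk)
    then show "eventually (\<lambda>w. zeta w = xi_even (w - 1/2) * k w) (at s)" by (auto simp: eventually_at_filter elim: eventually_mono)
  qed simp
  also have "\<dots> = zorder (\<lambda>w. xi_even (w - 1/2)) s + zorder k s"
  proof (rule zorder_times_analytic)
    show "(\<lambda>w. xi_even (w - 1/2)) analytic_on {s}" unfolding analytic_at using h by blast
    show "k analytic_on {s}" unfolding analytic_at using kh A by blast
    have "eventually (\<lambda>w. zeta w \<noteq> 0 \<and> w \<in> A) (at s)"
      using nz by (auto intro!: non_zero_neighbour_alt[OF zh A(1,2,3)])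
    then show "eventually (\<lambda>w. xi_even (w - 1/2) * k w \<noteq> 0) (at s)" by eventually_elim (use zk in auto)
  qed
  also have "zorder k s = 0"
    by (rule zorder_eq_0I) (use kh A knz in \<open>auto simp: analytic_at\<close>)
  also have "zorder (\<lambda>w. xi_even (w - 1/2)) s = zorder xi_even (s - 1/2)"
  proof -
    have "zorder (\<lambda>w. xi_even (w - 1/2)) s = zorder (\<lambda>u. xi_even (u + s - 1/2)) 0" by (rule zorder_shift)
    also have "\<dots> = zorder xi_even (s - 1/2)" by (subst (2) zorder_shift) (simp add: algebra_simps)
    finally show ?thesis .
  qed
  finally show ?thesis by simp
qed

section \<open>Location of the zeros\<close>

text \<open>The product over all primes up to \<open>N\<close> sieves the series down to \<open>1\<close> plus terms beyond \<open>N\<close>.\<close>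
lemma sieve_zeta:
  assumes s: "Re s > 1" and P: "finite P" "\<And>p. p \<in> P \<Longrightarrow> prime p"
  shows "((\<lambda>n. 1 / of_nat n powr s) has_sum ((\<Prod>p\<in>P. 1 - 1 / of_nat p powr s) * zeta_series s))
    {n::nat. n > 0 \<and> (\<forall>p\<in>P. \<not> p dvd n)}"
  using P
proof (induction P rule: finite_induct)
  case empty
  have "((\<lambda>n. 1 / of_nat (Suc n) powr s) has_sum zeta_series s) UNIV"
    using norm_summable_imp_has_sum[OF summable_norm_zeta_series[OF s] zeta_series_sums[OF s]] .
  then have "((\<lambda>n. 1 / of_nat n powr s) has_sum zeta_series s) (Suc ` UNIV)"
    by (subst has_sum_reindex) (auto simp: o_def)
  moreover have "Suc ` UNIV = {n. n > 0}" by (auto simp: image_iff gr0_conv_Suc)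
  ultimately show ?case by simp
next
  case (insert p P)
  define A where "A = {n::nat. n > 0 \<and> (\<forall>q\<in>P. \<not> q dvd n)}"
  define E where "E = (\<Prod>q\<in>P. 1 - 1 / of_nat q powr s) * zeta_series s"
  have IH: "((\<lambda>n. 1 / of_nat n powr s) has_sum E) A" using insert unfolding A_def E_def by auto
  have p: "prime p" "p > 0" using insert prime_gt_0_nat by auto
  have "((\<lambda>n. 1 / of_nat p powr s * (1 / of_nat n powr s)) has_sum (1 / of_nat p powr s * E)) A"
    by (rule has_sum_cmult_right[OF IH])
  moreover have "1 / of_nat p powr s * (1 / of_nat n powr s) = 1 / (of_nat (p * n) :: complex) powr s" for n
  proof -
    have "complex_of_nat (p * n) powr s = (of_real (real p) * of_real (real n)) powr s" by simp
    also have "\<dots> = of_real (real p) powr s * of_real (real n) powr s" by (rule powr_times_real) auto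
    finally show ?thesis by simp
  qed
  ultimately have "((\<lambda>n. 1 / of_nat (p * n) powr s) has_sum (1 / of_nat p powr s * E)) A" by simp
  then have "((\<lambda>n. 1 / of_nat n powr s) has_sum (1 / of_nat p powr s * E)) ((*) p ` A)"
    using p by (subst has_sum_reindex) (auto simp: o_def inj_on_def)
  moreover have sub: "(*) p ` A = {n\<in>A. p dvd n}"
  proof (intro equalityI subsetI)
    fix m assume "m \<in> (*) p ` A"
    then obtain n where n: "m = p * n" "n \<in> A" by auto
    have "\<not> q dvd p * n" if q: "q \<in> P" for q
    proof
      assume "q dvd p * n"
      moreover have "prime q" "q \<noteq> p" using q insert by auto
      ultimately have "q dvd n" using p(1) by (metis prime_dvd_mult_iff primes_dvd_imp_eq)
      then show False using n q by (auto simp: A_def)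
    qed
    then show "m \<in> {n\<in>A. p dvd n}" using n p by (auto simp: A_def)
  next
    fix m assume m: "m \<in> {n\<in>A. p dvd n}"
    then obtain n where n: "m = p * n" by auto
    have "n \<in> A" using m n by (auto simp: A_def)
    then show "m \<in> (*) p ` A" using n by auto
  qed
  ultimately have "((\<lambda>n. 1 / of_nat n powr s) has_sum (E - 1 / of_nat p powr s * E)) (A - {n\<in>A. p dvd n})"
    by (intro has_sum_Diff IH) auto
  moreover have "A - {n\<in>A. p dvd n} = {n. n > 0 \<and> (\<forall>q\<in>insert p P. \<not> q dvd n)}" by (auto simp: A_def)
  moreover have "E - 1 / of_nat p powr s * E = (\<Prod>q\<in>insert p P. 1 - 1 / of_nat q powr s) * zeta_series s"
    using insert by (simp add: E_def algebra_simps)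
  ultimately show ?case by simp
qed

text \<open>These are the reciprocals of the usual Euler factors, so that sieving the series amounts
  to multiplication and the product tends to 1/zeta.\<close>

definition euler_partial :: "nat \<Rightarrow> complex \<Rightarrow> complex" where
  "euler_partial N s = (\<Prod>p | prime p \<and> p \<le> N. 1 - 1 / of_nat p powr s)"

text \<open>An integer other than 1 that survives the sieve has a prime factor above N and so
  exceeds N; the error is at most a tail of the convergent series of n^(-Re s).\<close>

lemma euler_partial_tendsto:
  assumes s: "Re s > 1"
  shows "(\<lambda>N. euler_partial N s * zeta_series s) \<longlonglongrightarrow> 1"
proof -
  define A where "A = (\<lambda>N::nat. {n::nat. n > 0 \<and> (\<forall>p\<in>{p. prime p \<and> p \<le> N}. \<not> p dvd n)})"
  have hs: "((\<lambda>n. 1 / of_nat n powr s) has_sum (euler_partial N s * zeta_series s)) (A N)" for N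
    unfolding A_def euler_partial_def by (rule sieve_zeta[OF s]) auto
  have hs1: "((\<lambda>n. 1 / of_nat n powr s) has_sum (euler_partial N s * zeta_series s - 1)) (A N - {1})" for N
  proof (rule has_sum_Diff[OF hs])
    show "((\<lambda>n. 1 / of_nat n powr s) has_sum (1::complex)) {1::nat}"
      using has_sum_finite[of "{1::nat}" "\<lambda>n. 1 / of_nat n powr s :: complex"] by simp
    show "{1} \<subseteq> A N" by (auto simp: A_def)
  qed
  have sub: "A N - {1} \<subseteq> {N<..}" for N
  proof
    fix n assume n: "n \<in> A N - {1}"
    then obtain p where p: "prime p" "p dvd n" by (metis DiffE insertI1 prime_factor_nat singletonD)
    then have "\<not> p \<le> N" using n by (auto simp: A_def)
    moreover have "p \<le> n" using p n by (intro dvd_imp_le) (auto simp: A_def)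
    ultimately show "n \<in> {N<..}" by simp
  qed
  define f where "f = (\<lambda>n::nat. real (Suc n) powr (- Re s))"
  have sf: "summable f" unfolding f_def by (rule summable_Suc_powr[OF s])
  have le: "norm (euler_partial N s * zeta_series s - 1) \<le> (\<Sum>n. f (n + N))" for N
  proof -
    have "((\<lambda>n. f (n + N)) has_sum (\<Sum>n. f (n + N))) UNIV"
    proof (rule norm_summable_imp_has_sum)
      show "summable (\<lambda>n. norm (f (n + N)))" using summable_ignore_initial_segment[OF sf, of N] by (simp add: f_def)
      show "(\<lambda>n. f (n + N)) sums (\<Sum>n. f (n + N))" using summable_ignore_initial_segment[OF sf, of N] by (rule summable_sums)
    qed
    then have "((\<lambda>n. real n powr (- Re s)) has_sum (\<Sum>n. f (n + N))) ((\<lambda>n. Suc (n + N)) ` UNIV)"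
      by (subst has_sum_reindex) (auto simp: o_def f_def inj_on_def)
    moreover have "(\<lambda>n. Suc (n + N)) ` UNIV = {N<..}"
    proof (intro equalityI subsetI)
      fix m assume "m \<in> {N<..}"
      then have "m = Suc ((m - Suc N) + N)" by simp
      then show "m \<in> (\<lambda>n. Suc (n + N)) ` UNIV" by blast
    qed auto
    ultimately have g: "((\<lambda>n. real n powr (- Re s)) has_sum (\<Sum>n. f (n + N))) {N<..}" by simp
    have ns: "norm (1 / of_nat n powr s :: complex) = real n powr (- Re s)" if "n > 0" for n
      using norm_inverse_nat_powr[of "n - 1" s] that by simp
    have sg: "(\<lambda>n. real n powr (- Re s)) summable_on (A N - {1})"
      using summable_on_subset_banach[OF _ sub] g has_sum_imp_summable by blast
    have "norm (\<Sum>\<^sub>\<infinity>n\<in>A N - {1}. 1 / of_nat n powr s :: complex) \<le> (\<Sum>\<^sub>\<infinity>n\<in>A N - {1}. real n powr (- Re s))"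
    proof (rule norm_infsum_le)
      show "((\<lambda>n. 1 / of_nat n powr s) has_sum (\<Sum>\<^sub>\<infinity>n\<in>A N - {1}. 1 / of_nat n powr s :: complex)) (A N - {1})"
        using hs1[of N] by (simp add: infsumI)
      show "((\<lambda>n. real n powr (- Re s)) has_sum (\<Sum>\<^sub>\<infinity>n\<in>A N - {1}. real n powr (- Re s))) (A N - {1})"
        using sg by (rule has_sum_infsum)
      show "norm (1 / of_nat n powr s :: complex) \<le> real n powr (- Re s)" if "n \<in> A N - {1}" for n
        using that ns[of n] by (auto simp: A_def)
    qed
    also have "\<dots> \<le> (\<Sum>\<^sub>\<infinity>n\<in>{N<..}. real n powr (- Re s))"
      by (rule infsum_mono_neutral[OF sg]) (use sub g in \<open>auto simp: has_sum_imp_summable\<close>)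
    also have "\<dots> = (\<Sum>n. f (n + N))" by (rule infsumI[OF g])
    finally show ?thesis using infsumI[OF hs1[of N]] by simp
  qed
  have "(\<lambda>N. \<Sum>n. f (n + N)) \<longlonglongrightarrow> 0" by (rule suminf_exist_split2[OF sf])
  then have "(\<lambda>N. euler_partial N s * zeta_series s - 1) \<longlonglongrightarrow> 0"
    by (rule Lim_null_comparison[rotated]) (use le in auto)
  then show ?thesis by (rule LIM_zero_cancel)
qed

section \<open>Non-vanishing of zeta for Re s > 1 and, through the 3-4-1 inequality, for Re s =
  1\<close>

lemma zeta_series_nonzero: "Re s > 1 \<Longrightarrow> zeta_series s \<noteq> 0"
proof
  assume "Re s > 1" "zeta_series s = 0"
  then have "(\<lambda>N::nat. 0::complex) \<longlonglongrightarrow> 1" using euler_partial_tendsto[of s] by simp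
  then show False using LIMSEQ_unique[OF tendsto_const[of "0::complex" sequentially]] by force
qed

text \<open>The inequality at a single prime. The logarithm of the left side is a series with terms
  -(r^n/n) Re(3 + 4v + v^2), where v = w^n, and on the unit circle Re(3 + 4v + v^2) = 2 (1 + Re
  v)^2.\<close>

lemma three_four_one:
  fixes r :: real and w :: complex
  assumes r: "0 < r" "r < 1" and w: "norm w = 1"
  shows "(1 - r) ^ 3 * norm (1 - of_real r * w) ^ 4 * norm (1 - of_real r * w\<^sup>2) \<le> 1"
proof -
  have n: "norm (- complex_of_real r) < 1" "norm (- (of_real r * w)) < 1" "norm (- (of_real r * w\<^sup>2)) < 1"
    using r w by (auto simp: norm_mult norm_power)
  define S where "S = 3 * ln (1 + - complex_of_real r) + 4 * ln (1 + - (of_real r * w)) + ln (1 + - (of_real r * w\<^sup>2))"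
  have "(\<lambda>n. 3 * (- ((-(- complex_of_real r)) ^ n) / of_nat n) + 4 * (- ((-(- (of_real r * w))) ^ n) / of_nat n)
      + - ((-(- (of_real r * w\<^sup>2))) ^ n) / of_nat n) sums S"
    unfolding S_def by (intro sums_add sums_mult Ln_series' n)
  from sums_Re[OF this] have sR: "(\<lambda>n. Re (3 * (- ((-(- complex_of_real r)) ^ n) / of_nat n) + 4 * (- ((-(- (of_real r * w))) ^ n) / of_nat n)
      + - ((-(- (of_real r * w\<^sup>2))) ^ n) / of_nat n)) sums Re S" .
  have "Re S \<le> 0"
  proof (rule sums_le[OF _ sR sums_zero])
    \<comment> \<open>The term n = 0 needs no separate treatment: division by
      \<open>of_nat 0\<close> gives 0.\<close>
    fix n
    define v where "v = w ^ n"
    have "norm v = 1" using w by (simp add: v_def norm_power)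
    then have "(Re v)\<^sup>2 + (Im v)\<^sup>2 = 1" using cmod_power2[of v] by simp
    then have "Re (3 + 4 * v + v\<^sup>2) = 2 * (1 + Re v)\<^sup>2" by (simp add: power2_eq_square algebra_simps)
    then have pos: "Re (3 + 4 * v + v\<^sup>2) \<ge> 0" by simp
    have gen: "3 * (- X / M) + 4 * (- (X * v) / M) + - (X * v\<^sup>2) / M = - (X / M) * (3 + 4 * v + v\<^sup>2)" for X M :: complex
      by (simp add: divide_inverse algebra_simps)
    have e: "(of_real r * w) ^ n = of_real r ^ n * v" "(of_real r * w\<^sup>2) ^ n = of_real r ^ n * v\<^sup>2"
      by (simp_all add: v_def power_mult_distrib power_mult[symmetric] mult.commute)
    have "3 * (- ((-(- complex_of_real r)) ^ n) / of_nat n) + 4 * (- ((-(- (of_real r * w))) ^ n) / of_nat n)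
      + - ((-(- (of_real r * w\<^sup>2))) ^ n) / of_nat n = - (of_real r ^ n / of_nat n) * (3 + 4 * v + v\<^sup>2)"
      unfolding minus_minus e by (rule gen)
    also have "- (complex_of_real r ^ n / of_nat n) = of_real (- (r ^ n / real n))" by simp
    finally have eq: "3 * (- ((-(- complex_of_real r)) ^ n) / of_nat n) + 4 * (- ((-(- (of_real r * w))) ^ n) / of_nat n)
      + - ((-(- (of_real r * w\<^sup>2))) ^ n) / of_nat n = of_real (- (r ^ n / real n)) * (3 + 4 * v + v\<^sup>2)" .
    have "- (r ^ n / real n) * Re (3 + 4 * v + v\<^sup>2) \<le> 0"
      using pos r by (intro mult_nonpos_nonneg) auto
    then show "Re (3 * (- ((-(- complex_of_real r)) ^ n) / of_nat n) + 4 * (- ((-(- (of_real r * w))) ^ n) / of_nat n)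
      + - ((-(- (of_real r * w\<^sup>2))) ^ n) / of_nat n) \<le> 0"
      unfolding eq by (simp only: Re_complex_of_real times_complex.sel Im_complex_of_real mult_zero_left diff_zero)
  qed
  moreover have "norm (exp S) = (1 - r) ^ 3 * norm (1 - of_real r * w) ^ 4 * norm (1 - of_real r * w\<^sup>2)"
  proof -
    have ne: "1 + - complex_of_real r \<noteq> 0" "1 + - (of_real r * w) \<noteq> 0" "1 + - (of_real r * w\<^sup>2) \<noteq> 0"
    proof -
      have "1 + y \<noteq> 0" if "norm y < 1" for y :: complex
      proof
        assume "1 + y = 0"
        then have "y = - 1" by (simp add: add_eq_0_iff)
        then show False using that by simp
      qed
      then show "1 + - complex_of_real r \<noteq> 0" "1 + - (of_real r * w) \<noteq> 0" "1 + - (of_real r * w\<^sup>2) \<noteq> 0"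
        using n by blast+
    qed
    have e3: "exp (3 * y) = exp y ^ 3" and e4: "exp (4 * y) = exp y ^ 4" for y :: complex
      using exp_of_nat_mult[of 3 y] exp_of_nat_mult[of 4 y] by auto
    have "exp S = (1 + - complex_of_real r) ^ 3 * (1 + - (of_real r * w)) ^ 4 * (1 + - (of_real r * w\<^sup>2))"
      unfolding S_def exp_add e3 e4 exp_Ln[OF ne(1)] exp_Ln[OF ne(2)] exp_Ln[OF ne(3)] ..
    moreover have "norm (1 + - complex_of_real r) = 1 - r"
    proof -
      have "1 + - complex_of_real r = of_real (1 - r)" by simp
      then show ?thesis using r by (simp only: norm_of_real abs_of_pos diff_gt_0_iff_gt)
    qed
    ultimately show ?thesis by (simp add: norm_mult norm_power)
  qed
  moreover have "norm (exp S) = exp (Re S)" by simp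
  moreover have "exp (Re S) \<le> 1" using \<open>Re S \<le> 0\<close> by simp
  ultimately show ?thesis by linarith
qed

text \<open>At a prime p the local inequality is used with r = p^(-x) and w = p^(-it). The product
  over p \<le> N of the reciprocal factors is therefore at most 1, while its product with the zeta
  values tends to 1.\<close>

lemma zeta_three_four_one:
  assumes x: "x > 1"
  shows "1 \<le> norm (zeta_series (of_real x)) ^ 3 * norm (zeta_series (Complex x t)) ^ 4 * norm (zeta_series (Complex x (2 * t)))"
proof -
  define Z where "Z = norm (zeta_series (of_real x)) ^ 3 * norm (zeta_series (Complex x t)) ^ 4 * norm (zeta_series (Complex x (2 * t)))"
  define E where "E = (\<lambda>N. norm (euler_partial N (of_real x)) ^ 3 * norm (euler_partial N (Complex x t)) ^ 4 * norm (euler_partial N (Complex x (2 * t))))"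
  have "(\<lambda>N. norm (euler_partial N (of_real x) * zeta_series (of_real x)) ^ 3 * norm (euler_partial N (Complex x t) * zeta_series (Complex x t)) ^ 4 *
      norm (euler_partial N (Complex x (2 * t)) * zeta_series (Complex x (2 * t)))) \<longlonglongrightarrow> norm (1::complex) ^ 3 * norm (1::complex) ^ 4 * norm (1::complex)"
    using x by (intro tendsto_intros euler_partial_tendsto) auto
  moreover have "norm (euler_partial N (of_real x) * zeta_series (of_real x)) ^ 3 * norm (euler_partial N (Complex x t) * zeta_series (Complex x t)) ^ 4 *
      norm (euler_partial N (Complex x (2 * t)) * zeta_series (Complex x (2 * t))) = E N * Z" for N
    by (simp add: E_def Z_def norm_mult power_mult_distrib)
  ultimately have "(\<lambda>N. E N * Z) \<longlonglongrightarrow> 1" by simp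
  moreover have "E N * Z \<le> Z" for N
  proof -
    have "E N = (\<Prod>p | prime p \<and> p \<le> N. norm (1 - 1 / of_nat p powr (of_real x) :: complex) ^ 3 *
        norm (1 - 1 / of_nat p powr (Complex x t)) ^ 4 * norm (1 - 1 / of_nat p powr (Complex x (2 * t))))"
      unfolding E_def euler_partial_def by (simp add: prod_norm[symmetric] prod_power_distrib prod.distrib)
    also have "\<dots> \<le> 1"
    proof (rule prod_le_1)
      fix p assume "p \<in> {p. prime p \<and> p \<le> N}"
      then have p: "p > 1" using prime_gt_1_nat by auto
      define r where "r = real p powr (- x)"
      define w where "w = cis (- t * ln (real p))"
      have r: "0 < r" "r < 1" using p x by (auto simp: r_def powr_less_one)
      have q: "1 / complex_of_nat p powr (Complex x u) = of_real r * cis (- u * ln (real p))" for u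
      proof -
        have inv: "1 / exp y = exp (- y)" for y :: complex by (simp add: exp_minus inverse_eq_divide)
        have "complex_of_nat p powr (Complex x u) = exp (Complex x u * of_real (ln (real p)))"
          using p by (simp add: powr_def Ln_of_nat)
        then have "1 / complex_of_nat p powr (Complex x u) = exp (- (Complex x u * of_real (ln (real p))))"
          by (simp only: inv)
        also have "\<dots> = of_real (exp (Re (- (Complex x u * of_real (ln (real p)))))) * cis (Im (- (Complex x u * of_real (ln (real p)))))"
          by (rule exp_eq_polar)
        also have "\<dots> = of_real r * cis (- u * ln (real p))"
          using p by (simp add: r_def powr_def)
        finally show ?thesis .
      qed
      have q1: "1 / complex_of_nat p powr (of_real x) = of_real r" using q[of 0] by (simp add: complex_of_real_def)
      have q3: "cis (- (2 * t) * ln (real p)) = w\<^sup>2" by (simp add: w_def power2_eq_square cis_mult algebra_simps)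
      have "norm (1 - complex_of_real r) = 1 - r"
      proof -
        have "1 - complex_of_real r = of_real (1 - r)" by simp
        then show ?thesis using r by (simp only: norm_of_real abs_of_pos diff_gt_0_iff_gt)
      qed
      then have "norm (1 - 1 / of_nat p powr (of_real x) :: complex) ^ 3 *
        norm (1 - 1 / of_nat p powr (Complex x t)) ^ 4 * norm (1 - 1 / of_nat p powr (Complex x (2 * t))) =
        (1 - r) ^ 3 * norm (1 - of_real r * w) ^ 4 * norm (1 - of_real r * w\<^sup>2)"
        unfolding q1 q q3 w_def[symmetric] by simp
      also have "\<dots> \<le> 1" by (rule three_four_one[OF r]) (simp add: w_def)
      finally show "0 \<le> norm (1 - 1 / of_nat p powr (of_real x) :: complex) ^ 3 *
        norm (1 - 1 / of_nat p powr (Complex x t)) ^ 4 * norm (1 - 1 / of_nat p powr (Complex x (2 * t))) \<and>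
        norm (1 - 1 / of_nat p powr (of_real x) :: complex) ^ 3 *
        norm (1 - 1 / of_nat p powr (Complex x t)) ^ 4 * norm (1 - 1 / of_nat p powr (Complex x (2 * t))) \<le> 1" by simp
    qed
    finally show ?thesis using mult_right_mono[of "E N" 1 Z] by (simp add: Z_def)
  qed
  ultimately have "1 \<le> Z" using LIMSEQ_le_const2 by blast
  then show ?thesis by (simp add: Z_def)
qed

lemma xi_even_isCont: "isCont (\<lambda>s. xi_even (s - 1/2)) s"
proof -
  have "isCont xi_even z" for z
    using xi_even_holomorphic by (simp add: field_differentiable_imp_continuous_at holomorphic_on_imp_differentiable_at)
  then show ?thesis by (intro isCont_o2[where f = "\<lambda>s. s - 1/2" and g = xi_even]) (auto intro: continuous_intros)
qed

lemma xi_factor_isCont: "Re s > 0 \<Longrightarrow> isCont xi_factor s"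
  by (rule field_differentiable_imp_continuous_at, rule holomorphic_on_imp_differentiable_at[OF xi_factor_holomorphic open_halfspace_Re_gt]) simp

lemma xi_even_derivative: "(xi_even has_field_derivative deriv xi_even z) (at z)"
  by (rule holomorphic_derivI[OF xi_even_holomorphic]) auto

text \<open>One positive null sequence serves every approach to Re s = 1 from the right: the
  difference quotients of \<open>xi_even\<close> and the constant term of zeta at its pole.\<close>

definition step_seq :: "nat \<Rightarrow> real" where "step_seq n = 1 / real (Suc n)"

lemma step_seq_pos: "step_seq n > 0" and step_seq_le: "step_seq n \<le> 1"
  by (simp_all add: step_seq_def)

lemma step_seq_tendsto: "step_seq \<longlonglongrightarrow> 0"
  unfolding step_seq_def by real_asymp

lemma xi_even_difference_quotient:
  "(\<lambda>n. (xi_even (z + of_real (step_seq n)) - xi_even z) / of_real (step_seq n)) \<longlonglongrightarrow> deriv xi_even z"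
proof -
  have "((\<lambda>h. (xi_even (z + h) - xi_even z) / h) \<longlongrightarrow> deriv xi_even z) (at 0)"
    using xi_even_derivative[of z] by (simp add: DERIV_def)
  moreover have "filterlim (\<lambda>n. complex_of_real (step_seq n)) (at 0) sequentially"
    unfolding filterlim_at using tendsto_of_real[OF step_seq_tendsto, where ?'a = complex] step_seq_pos
    by (auto simp: less_imp_neq[symmetric] intro!: always_eventually)
  ultimately show ?thesis by (rule filterlim_compose)
qed

text \<open>The classical argument of Mertens: a zero at 1 + it would make zeta(1 + h + it) of size
  O(h), against zeta(1 + h) = O(1/h) and a bounded value at 1 + h + 2it. The 3-4-1 product would be
  O(h^(4-3)) and tend to 0, although it is at least 1. \<open>A\<close>, \<open>B\<close> and
  \<open>C\<close> are the three values with these powers of h taken out.\<close>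

lemma xi_even_nonzero_edge: "xi_even (Complex (1/2) t) \<noteq> 0"
proof (cases "t = 0")
  case True
  then have "Complex (1/2) t = 1/2" by (simp add: complex_eq_iff)
  then show ?thesis unfolding \<open>Complex (1/2) t = 1/2\<close> xi_even_half by simp
next
  case False
  show ?thesis
  proof
    assume z: "xi_even (Complex (1/2) t) = 0"
    define h where "h = step_seq"
    have h: "h n > 0" "h \<longlonglongrightarrow> 0" for n using step_seq_pos step_seq_tendsto by (auto simp: h_def)
    define A where "A = (\<lambda>n. xi_even (of_real (1 + h n) - 1/2) / xi_factor (of_real (1 + h n)))"
    define B where "B = (\<lambda>n. (xi_even (Complex (1/2) t + of_real (h n)) - xi_even (Complex (1/2) t)) / of_real (h n) /
       ((Complex (1 + h n) t - 1) * xi_factor (Complex (1 + h n) t)))"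
    define C where "C = (\<lambda>n. xi_even (Complex (1 + h n) (2 * t) - 1/2) / ((Complex (1 + h n) (2 * t) - 1) * xi_factor (Complex (1 + h n) (2 * t))))"
    have s: "(\<lambda>n. Complex (1 + h n) u) \<longlonglongrightarrow> Complex 1 u" for u
      using tendsto_Complex[OF tendsto_add[OF tendsto_const[of 1] h(2)] tendsto_const[of u]] by simp
    have G: "(\<lambda>n. xi_even (Complex (1 + h n) u - 1/2)) \<longlonglongrightarrow> xi_even (Complex 1 u - 1/2)" for u
      by (rule isCont_tendsto_compose[OF xi_even_isCont s])
    have K: "(\<lambda>n. xi_factor (Complex (1 + h n) u)) \<longlonglongrightarrow> xi_factor (Complex 1 u)" for u
      by (rule isCont_tendsto_compose[OF xi_factor_isCont s]) simp
    have Knz: "xi_factor (Complex 1 u) \<noteq> 0" for u by (rule xi_factor_nonzero) simp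
    have nz: "Complex 1 u - 1 \<noteq> 0" if "u \<noteq> 0" for u using that by (simp add: complex_eq_iff)
    have real: "complex_of_real x = Complex x 0" for x by (simp add: complex_eq_iff)
    have "A \<longlonglongrightarrow> xi_even (Complex 1 0 - 1/2) / xi_factor (Complex 1 0)"
      unfolding A_def real by (intro tendsto_divide G K Knz)
    moreover have "B \<longlonglongrightarrow> deriv xi_even (Complex (1/2) t) / ((Complex 1 t - 1) * xi_factor (Complex 1 t))"
      unfolding B_def h_def
      by (intro tendsto_divide xi_even_difference_quotient tendsto_mult tendsto_diff tendsto_const s[unfolded h_def] K[unfolded h_def])
         (use Knz nz False in auto)
    moreover have "C \<longlonglongrightarrow> xi_even (Complex 1 (2 * t) - 1/2) / ((Complex 1 (2 * t) - 1) * xi_factor (Complex 1 (2 * t)))"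
      unfolding C_def by (intro tendsto_divide tendsto_mult tendsto_diff tendsto_const s G K) (use Knz nz False in auto)
    ultimately have "(\<lambda>n. h n * (norm (A n) ^ 3 * norm (B n) ^ 4 * norm (C n))) \<longlonglongrightarrow>
        0 * (norm (xi_even (Complex 1 0 - 1/2) / xi_factor (Complex 1 0)) ^ 3 *
        norm (deriv xi_even (Complex (1/2) t) / ((Complex 1 t - 1) * xi_factor (Complex 1 t))) ^ 4 *
        norm (xi_even (Complex 1 (2 * t) - 1/2) / ((Complex 1 (2 * t) - 1) * xi_factor (Complex 1 (2 * t)))))"
      by (intro tendsto_mult tendsto_power tendsto_norm h(2))
    then have lim: "(\<lambda>n. h n * (norm (A n) ^ 3 * norm (B n) ^ 4 * norm (C n))) \<longlonglongrightarrow> 0" by simp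
    have "1 \<le> h n * (norm (A n) ^ 3 * norm (B n) ^ 4 * norm (C n))" for n
    proof -
      have x: "1 + h n > 1" using h by simp
      have za: "norm (zeta_series (of_real (1 + h n))) = norm (A n) / h n"
        using zeta_series_eq_xi[of "of_real (1 + h n)"] h(1)[of n] by (simp add: A_def norm_divide norm_mult)
      have "Complex (1 + h n) t - 1/2 = Complex (1/2) t + of_real (h n)" by (simp add: complex_eq_iff)
      then have "zeta_series (Complex (1 + h n) t) = of_real (h n) * B n"
        using zeta_series_eq_xi[of "Complex (1 + h n) t"] h(1)[of n] z by (simp add: B_def)
      then have zb: "norm (zeta_series (Complex (1 + h n) t)) = h n * norm (B n)" using h(1)[of n] by (simp add: norm_mult)
      have zc: "zeta_series (Complex (1 + h n) (2 * t)) = C n"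
        using zeta_series_eq_xi[of "Complex (1 + h n) (2 * t)"] h(1)[of n] by (simp add: C_def)
      have "1 \<le> (norm (A n) / h n) ^ 3 * (h n * norm (B n)) ^ 4 * norm (C n)"
        using zeta_three_four_one[OF x, of t] unfolding za zb zc .
      also have "\<dots> = h n * (norm (A n) ^ 3 * norm (B n) ^ 4 * norm (C n))"
      proof -
        have gen: "(a / k) ^ 3 * (k * b) ^ 4 * c = k * (a ^ 3 * b ^ 4 * c)" if "k \<noteq> 0" for a b c k :: real
          using that by (simp add: power_divide power_mult_distrib field_simps power3_eq_cube power4_eq_xxxx)
        show ?thesis by (rule gen) (use h(1)[of n] in auto)
      qed
      finally show ?thesis .
    qed
    then show False using LIMSEQ_le_const[OF lim, of 1] by auto
  qed
qed

text \<open>Re z \<ge> 1/2 is excluded by the series and by the edge; evenness transfers this to the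
  left side.\<close>

lemma xi_even_zero_strip:
  assumes "xi_even z = 0"
  shows "\<bar>Re z\<bar> < 1/2" "\<bar>Im z\<bar> > 1/2"
proof -
  have pos: "Re w < 1/2" if w: "xi_even w = 0" for w
  proof (rule ccontr)
    assume "\<not> Re w < 1/2"
    then consider "Re w = 1/2" | "Re w > 1/2" by linarith
    then show False
    proof cases
      case 1
      then have "w = Complex (1/2) (Im w)" by (simp add: complex_eq_iff)
      then show False using w xi_even_nonzero_edge by metis
    next
      case 2
      then have "zeta_series (w + 1/2) = 0" using zeta_series_eq_xi[of "w + 1/2"] w by simp
      then show False using zeta_series_nonzero[of "w + 1/2"] 2 by simp
    qed
  qed
  show re: "\<bar>Re z\<bar> < 1/2" using pos[OF assms] pos[of "- z"] assms by (simp add: xi_even_uminus abs_less_iff)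
  show "\<bar>Im z\<bar> > 1/2" using xi_even_nonzero_low[of z] re assms by fastforce
qed

lemma nontrivial_zeros_eq: "nontrivial_zeros = (\<lambda>z. z + 1/2) ` {z. xi_even z = 0}"
proof (intro equalityI subsetI)
  fix s assume s: "s \<in> nontrivial_zeros"
  then have "xi_even (s - 1/2) / ((s - 1) * xi_factor s) = 0" using zeta_eq_xi[of s] by (simp add: nontrivial_zeros_def)
  moreover have "(s - 1) * xi_factor s \<noteq> 0" using s xi_factor_nonzero[of s] by (auto simp: nontrivial_zeros_def)
  ultimately have "xi_even (s - 1/2) = 0" by simp
  then show "s \<in> (\<lambda>z. z + 1/2) ` {z. xi_even z = 0}" by (intro image_eqI[of _ _ "s - 1/2"]) auto
next
  fix s assume "s \<in> (\<lambda>z. z + 1/2) ` {z. xi_even z = 0}"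
  then obtain z where z: "s = z + 1/2" "xi_even z = 0" by blast
  from xi_even_zero_strip(1)[OF z(2)] have "0 < Re s" "Re s < 1" using z by (auto simp: abs_less_iff)
  then show "s \<in> nontrivial_zeros" using zeta_eq_xi[of s] z by (simp add: nontrivial_zeros_def)
qed

section \<open>The constant term of zeta at its pole and the derivative of xi at the edge\<close>

lemma zeta_real_minus_pole_tendsto:
  "(\<lambda>n. (\<Sum>m. real (Suc m) powr (- (1 + step_seq n))) - 1 / step_seq n) \<longlonglongrightarrow> euler_mascheroni"
proof -
  \<comment> \<open>The pole 1/h is written as a telescoping series and subtracted term by term. For
    h \<rightarrow> 0 the m-th difference tends to \<open>l m\<close>, the term of a series for
    Euler's constant, and a majorant of order m^(-2) lets Tannery's theorem take the limit
    inside.\<close>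
  define u where "u = (\<lambda>m n. real (Suc m) powr (- (1 + step_seq n)) - (real (Suc m) powr (- step_seq n) - real (Suc (Suc m)) powr (- step_seq n)) / step_seq n)"
  define l where "l = (\<lambda>m. inverse (real (m + 1)) + ln (real (m + 1)) - ln (real (m + 2)))"
  have usum: "(\<lambda>m. u m n) sums ((\<Sum>m. real (Suc m) powr (- (1 + step_seq n))) - 1 / step_seq n)" for n
  proof -
    have "(\<lambda>m. real (Suc m) powr (- step_seq n)) \<longlonglongrightarrow> 0"
      using step_seq_pos[of n]
      by (intro tendsto_neg_powr filterlim_compose[OF filterlim_real_sequentially filterlim_Suc]) simp
    then have "(\<lambda>m. real (Suc m) powr (- step_seq n) - real (Suc (Suc m)) powr (- step_seq n)) sums (real (Suc 0) powr (- step_seq n) - 0)"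
      by (rule telescope_sums')
    then have "(\<lambda>m. (real (Suc m) powr (- step_seq n) - real (Suc (Suc m)) powr (- step_seq n)) / step_seq n) sums (1 / step_seq n)"
      using sums_divide by fastforce
    then show ?thesis unfolding u_def
      by (intro sums_diff summable_sums summable_Suc_powr) (use step_seq_pos[of n] in auto)
  qed
  have ulim: "(\<lambda>n. u m n) \<longlonglongrightarrow> l m" for m
  proof -
    define a where "a = real (Suc m)"
    define b where "b = real (Suc (Suc m))"
    have ab: "a > 0" "b > 0" by (auto simp: a_def b_def)
    have "((\<lambda>x. a powr (- x) - b powr (- x)) has_real_derivative (ln b - ln a)) (at 0)"
      using ab by (auto intro!: derivative_eq_intros)
    then have "((\<lambda>h. (a powr (- h) - b powr (- h)) / h) \<longlongrightarrow> ln b - ln a) (at 0)"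
      using ab by (simp add: DERIV_def)
    moreover have "filterlim step_seq (at 0) sequentially"
      unfolding filterlim_at using step_seq_tendsto step_seq_pos by (auto simp: less_imp_neq[symmetric] intro!: always_eventually)
    ultimately have 1: "(\<lambda>n. (a powr (- step_seq n) - b powr (- step_seq n)) / step_seq n) \<longlonglongrightarrow> ln b - ln a"
      by (rule filterlim_compose)
    have "(\<lambda>n. a powr (- (1 + step_seq n))) \<longlonglongrightarrow> a powr (- (1 + 0))"
      using ab by (intro tendsto_intros step_seq_tendsto) auto
    from tendsto_diff[OF this 1] have "(\<lambda>n. u m n) \<longlonglongrightarrow> a powr (- (1 + 0)) - (ln b - ln a)" by (simp only: u_def a_def b_def)
    moreover have "a powr (- (1 + 0)) - (ln b - ln a) = l m" using ab by (simp add: l_def a_def b_def powr_minus add_ac)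
    ultimately show ?thesis by simp
  qed
  \<comment> \<open>Two mean values: the quotient equals \<open>x powr (- h - 1)\<close> for some x
    in (a, a + 1), and its distance to \<open>a powr (- h - 1)\<close> costs one further derivative.
    The 2 bounds h + 1.\<close>
  have ubd: "norm (u m n) \<le> 2 * real (Suc m) powr (- 2)" for m n
  proof -
    define a where "a = real (Suc m)"
    define h where "h = step_seq n"
    have a: "a \<ge> 1" and h: "h > 0" "h \<le> 1" using step_seq_pos[of n] step_seq_le[of n] by (auto simp: a_def h_def)
    have "\<exists>x. a < x \<and> x < a + 1 \<and> (a + 1) powr (- h) - a powr (- h) = (a + 1 - a) * (- h * x powr (- h - 1))"
      by (rule MVT2) (use a in \<open>auto intro!: derivative_eq_intros simp: powr_diff\<close>)
    then obtain x where x: "a < x" "x < a + 1" "(a + 1) powr (- h) - a powr (- h) = - h * x powr (- h - 1)" by auto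
    then have "(a powr (- h) - (a + 1) powr (- h)) / h = x powr (- h - 1)" using h by (simp add: field_simps)
    moreover have "u m n = a powr (- (1 + h)) - (a powr (- h) - (a + 1) powr (- h)) / h"
      by (simp add: u_def a_def h_def add.commute)
    moreover have "- (1 + h) = - h - 1" by simp
    ultimately have u: "u m n = a powr (- h - 1) - x powr (- h - 1)" by metis
    have "\<exists>y. a < y \<and> y < x \<and> x powr (- h - 1) - a powr (- h - 1) = (x - a) * ((- h - 1) * y powr (- h - 2))"
    proof (rule MVT2[OF x(1)])
      fix t assume "a \<le> t" "t \<le> x"
      then have "((\<lambda>t. t powr (- h - 1)) has_real_derivative (- h - 1) * t powr (- h - 1 - 1)) (at t)"
        using a by (intro has_real_derivative_powr) auto
      moreover have "- h - 1 - 1 = - h - 2" by simp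
      ultimately show "((\<lambda>t. t powr (- h - 1)) has_real_derivative (- h - 1) * t powr (- h - 2)) (at t)"
        by (simp only:)
    qed
    then obtain y where y: "a < y" "y < x" "x powr (- h - 1) - a powr (- h - 1) = (x - a) * ((- h - 1) * y powr (- h - 2))" by auto
    have "u m n = (x - a) * ((h + 1) * y powr (- h - 2))" using y(3) u by (simp add: algebra_simps)
    moreover have "0 \<le> (x - a) * ((h + 1) * y powr (- h - 2))" using x h by (intro mult_nonneg_nonneg) auto
    moreover have "(x - a) * ((h + 1) * y powr (- h - 2)) \<le> 1 * (2 * a powr (- 2))"
    proof (intro mult_mono)
      have "y powr (- h - 2) \<le> a powr (- h - 2)" using y a h by (intro powr_mono2') auto
      also have "\<dots> \<le> a powr (- 2)" using a h by (intro powr_mono) auto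
      finally show "y powr (- h - 2) \<le> a powr (- 2)" .
    qed (use x h in auto)
    ultimately show ?thesis by (simp add: a_def)
  qed
  have sM: "summable (\<lambda>m. 2 * real (Suc m) powr (- 2))" by (intro summable_mult summable_Suc_powr) auto
  have ev: "\<forall>\<^sub>F (m, n) in at_top \<times>\<^sub>F sequentially. norm (u m n) \<le> 2 * real (Suc m) powr (- 2)"
    using ubd by (intro always_eventually) auto
  have "(\<lambda>n. \<Sum>m. u m n) \<longlonglongrightarrow> (\<Sum>m. l m)"
    using tannerys_theorem[OF ulim ev sM sequentially_bot] by blast
  moreover have "(\<Sum>m. u m n) = (\<Sum>m. real (Suc m) powr (- (1 + step_seq n))) - 1 / step_seq n" for n
    using usum by (simp add: sums_iff)
  moreover have "(\<Sum>m. l m) = euler_mascheroni"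
    using euler_mascheroni_sum_real unfolding l_def by (simp add: sums_iff)
  ultimately show ?thesis by simp
qed

text \<open>Near s = 1, xi(s) = k(s) (s - 1) zeta(s) and (s - 1) zeta(s) = 1 + gamma (s - 1) + ...,
  so the derivative is k'(1) + gamma k(1) with k(1) = 1/2. In k'(1) = \<open>D\<close>, the value
  Digamma(1/2) = - gamma - 2 ln 2 produces ln(4 pi) together with ln pi.\<close>

lemma deriv_xi_even_half:
  "deriv xi_even (1/2) = of_real ((1 + euler_mascheroni / 2 - ln (4 * pi) / 2) / 2)"
proof -
  define k where "k = (\<lambda>x::real. x / 2 * (Gamma (x / 2) / pi powr (x / 2)))"
  define Z where "Z = (\<lambda>n. (\<Sum>m. real (Suc m) powr (- (1 + step_seq n))))"
  define D where "D = 1/2 * (1 + Digamma (1/2) / 2 - ln pi / 2 :: real)"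
  have k1: "k 1 = 1/2" by (simp add: k_def Gamma_one_half_real powr_half_sqrt)
  have dk: "(k has_real_derivative D) (at 1)"
  proof -
    have nz: "(1/2::real) \<notin> \<int>\<^sub>\<le>\<^sub>0" using nonpos_Ints_nonpos[of "1/2 :: real"] by auto
    have dh: "((\<lambda>x::real. x / 2) has_real_derivative 1/2) (at 1)" by (auto intro!: derivative_eq_intros)
    have dG: "((\<lambda>x. Gamma (x / 2)) has_real_derivative Gamma (1/2) * Digamma (1/2) * (1/2)) (at 1)"
      by (rule DERIV_chain2[where f = Gamma and g = "\<lambda>x. x / 2", OF has_field_derivative_Gamma[OF nz] dh])
    have dP: "((\<lambda>x. pi powr (x / 2)) has_real_derivative pi powr (1/2) * (ln pi * (1/2))) (at 1)"
      by (auto intro!: derivative_eq_intros)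
    have pnz: "pi powr (1/2) \<noteq> 0" by simp
    have dk0: "(k has_real_derivative (1 / 2 * (Gamma (1 / 2) / pi powr (1 / 2)) +
       ((Gamma (1/2) * Digamma (1/2) * (1/2) * pi powr (1/2) - Gamma (1/2) * (pi powr (1/2) * (ln pi * (1/2)))) / (pi powr (1/2) * pi powr (1/2))) * (1/2))) (at 1)"
      unfolding k_def by (rule DERIV_mult[OF dh DERIV_divide[OF dG dP pnz]])
    have gen: "1 / 2 * (q / q) + ((q * d * (1/2) * q - q * (q * (l * (1/2)))) / (q * q)) * (1/2) = 1/2 * (1 + d / 2 - l / 2)"
      if "q \<noteq> 0" for q d l :: real using that by (simp add: field_simps)
    have e: "Gamma (1/2 :: real) = sqrt pi" "pi powr (1/2) = sqrt pi"
      by (simp_all add: Gamma_one_half_real powr_half_sqrt)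
    have "sqrt pi \<noteq> 0" by simp
    show ?thesis using dk0 unfolding e gen[OF \<open>sqrt pi \<noteq> 0\<close>] D_def .
  qed
  have kq: "(\<lambda>n. (k (1 + step_seq n) - k 1) / step_seq n) \<longlonglongrightarrow> D"
  proof -
    have 1: "((\<lambda>h. (k (1 + h) - k 1) / h) \<longlongrightarrow> D) (at 0)" using dk by (simp add: DERIV_def)
    have 2: "filterlim step_seq (at 0) sequentially"
      unfolding filterlim_at using step_seq_tendsto step_seq_pos by (auto simp: less_imp_neq[symmetric] intro!: always_eventually)
    show ?thesis by (rule filterlim_compose[OF 1 2])
  qed
  have kl: "(\<lambda>n. k (1 + step_seq n)) \<longlonglongrightarrow> 1/2"
  proof -
    have "(\<lambda>n. 1 + step_seq n) \<longlonglongrightarrow> 1 + 0" by (intro tendsto_intros step_seq_tendsto)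
    then show ?thesis using isCont_tendsto_compose[OF DERIV_isCont[OF dk], of "\<lambda>n. 1 + step_seq n"] k1 by simp
  qed
  have "(\<lambda>n. (k (1 + step_seq n) - k 1) / step_seq n + k (1 + step_seq n) * (Z n - 1 / step_seq n)) \<longlonglongrightarrow> D + 1/2 * euler_mascheroni"
    unfolding Z_def by (intro tendsto_add tendsto_mult kq kl zeta_real_minus_pole_tendsto)
  then have "(\<lambda>n. complex_of_real ((k (1 + step_seq n) - k 1) / step_seq n + k (1 + step_seq n) * (Z n - 1 / step_seq n))) \<longlonglongrightarrow> of_real (D + 1/2 * euler_mascheroni)"
    by (rule tendsto_of_real)
  moreover have "complex_of_real ((k (1 + step_seq n) - k 1) / step_seq n + k (1 + step_seq n) * (Z n - 1 / step_seq n)) =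
     (xi_even (1/2 + of_real (step_seq n)) - xi_even (1/2)) / of_real (step_seq n)" for n
  proof -
    define h where "h = step_seq n"
    have h: "h > 0" unfolding h_def by (rule step_seq_pos)
    have "1/2 + complex_of_real h = of_real (1 + h - 1/2)" by simp
    then have "xi_even (1/2 + of_real h) = of_real ((1 + h) * (1 + h - 1) / 2 * (Gamma ((1 + h)/2) / pi powr ((1 + h)/2)) * (\<Sum>m. real (Suc m) powr (- (1 + h))))"
      using xi_even_real[of "1 + h"] h by simp
    also have "(1 + h) * (1 + h - 1) / 2 * (Gamma ((1 + h)/2) / pi powr ((1 + h)/2)) * (\<Sum>m. real (Suc m) powr (- (1 + h))) = k (1 + h) * h * Z n"
      by (simp add: k_def Z_def h_def)
    finally have "xi_even (1/2 + of_real h) = of_real (k (1 + h) * h * Z n)" .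
    moreover have "xi_even (1/2) = of_real (k 1)" unfolding xi_even_half k1 by simp
    moreover have "(k (1 + h) - k 1) / h + k (1 + h) * (Z n - 1 / h) = (k (1 + h) * h * Z n - k 1) / h" using h by (simp add: field_simps)
    ultimately show ?thesis unfolding h_def[symmetric] by simp
  qed
  ultimately have "(\<lambda>n. (xi_even (1/2 + of_real (step_seq n)) - xi_even (1/2)) / of_real (step_seq n)) \<longlonglongrightarrow> of_real (D + 1/2 * euler_mascheroni)"
    by simp
  from LIMSEQ_unique[OF xi_even_difference_quotient this]
  have "deriv xi_even (1/2) = of_real (D + 1/2 * euler_mascheroni)" .
  also have "D + 1/2 * euler_mascheroni = (1 + euler_mascheroni / 2 - ln (4 * pi) / 2) / 2"
  proof -
    have "ln (4 * pi) = 2 * ln 2 + ln pi" using ln_mult[of 4 pi] ln_powr[of 2 2] by simp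
    moreover have "Digamma (1/2) = - euler_mascheroni - 2 * ln (2::real)" using Digamma_one_half[where ?'a = real] by simp
    ultimately show ?thesis by (simp add: D_def field_simps)
  qed
  finally show ?thesis .
qed

section \<open>Logarithmic integrals along the critical line\<close>

lemma half_plane_integral_Re:
  fixes g :: "complex \<Rightarrow> complex"
  assumes "g holomorphic_on {s. Re s > 1/2}" "continuous_on {s. Re s \<ge> 1/2} g"
    and "\<And>e. e > 0 \<Longrightarrow> \<exists>R. \<forall>s. Re s \<ge> 1/2 \<longrightarrow> norm s \<ge> R \<longrightarrow> norm (g s) \<le> e * (norm s)\<^sup>2"
  shows "has_bochner_integral lborel (\<lambda>u. Re (g (Complex (1/2) u)) / (u\<^sup>2 + 1/4)\<^sup>2) (2 * pi * (2 * Re (g 1) - Re (deriv g 1)))"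
proof -
  note i = half_plane_integral[OF assms]
  have "has_bochner_integral lborel (\<lambda>u. Re (g (Complex (1/2) u) / of_real ((u\<^sup>2 + 1/4)\<^sup>2)))
      (Re (2 * pi * (2 * g 1 - deriv g 1)))"
    using i by (simp only: has_bochner_integral_iff integrable_Re integral_Re simp_thms)
  moreover have "Re (2 * complex_of_real pi * (2 * g 1 - deriv g 1)) = 2 * pi * (2 * Re (g 1) - Re (deriv g 1))" by simp
  moreover have "Re (g (Complex (1/2) u) / of_real ((u\<^sup>2 + 1/4)\<^sup>2)) = Re (g (Complex (1/2) u)) / (u\<^sup>2 + 1/4)\<^sup>2" for u
    by (rule Re_divide_of_real)
  ultimately show ?thesis by simp
qed

lemma has_bochner_integral_inverse_weight_square:
  "has_bochner_integral lborel (\<lambda>u::real. 1 / (u\<^sup>2 + 1/4)\<^sup>2) (4 * pi)"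
proof -
  have "has_bochner_integral lborel (\<lambda>u::real. Re ((\<lambda>s. 1) (Complex (1/2) u)) / (u\<^sup>2 + 1/4)\<^sup>2) (2 * pi * (2 * Re 1 - Re (deriv (\<lambda>s::complex. 1) 1)))"
  proof (rule half_plane_integral_Re)
    fix e :: real assume e: "e > 0"
    have "norm (1::complex) \<le> e * (norm s)\<^sup>2" if s: "norm s \<ge> 1 / sqrt e" for s :: complex
    proof -
      have "(1 / sqrt e)\<^sup>2 \<le> (norm s)\<^sup>2" using s e by (intro power_mono) auto
      then have "e * (1 / e) \<le> e * (norm s)\<^sup>2" using e by (intro mult_left_mono) (auto simp: power_divide)
      then show ?thesis using e by simp
    qed
    then show "\<exists>R. \<forall>s::complex. Re s \<ge> 1/2 \<longrightarrow> norm s \<ge> R \<longrightarrow> norm (1::complex) \<le> e * (norm s)\<^sup>2" by blast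
  qed auto
  then show ?thesis by simp
qed

lemma norm_Ln_le: "z \<noteq> 0 \<Longrightarrow> norm (Ln z) \<le> \<bar>ln (norm z)\<bar> + pi"
proof -
  assume z: "z \<noteq> 0"
  have "norm (Ln z) \<le> \<bar>Re (Ln z)\<bar> + \<bar>Im (Ln z)\<bar>" by (rule cmod_le)
  moreover have "\<bar>Im (Ln z)\<bar> \<le> pi" using mpi_less_Im_Ln[OF z] Im_Ln_le_pi[OF z] by (simp add: abs_le_iff)
  ultimately show ?thesis using z by (simp add: Re_Ln)
qed

text \<open>With \<open>a\<close> strictly to the left of the line, s - a has positive real part on
  the closed half-plane, where \<open>Ln (s - a)\<close> is therefore holomorphic, with logarithmic
  growth.\<close>

lemma log_line_integral_interior:
  assumes a: "Re a < 1/2"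
  shows "has_bochner_integral lborel (\<lambda>u. ln (norm (Complex (1/2) u - a)) / (u\<^sup>2 + 1/4)\<^sup>2)
    (2 * pi * (2 * ln (norm (1 - a)) - Re (1 / (1 - a))))"
proof -
  define g where "g = (\<lambda>s. Ln (s - a))"
  have ns: "s - a \<notin> \<real>\<^sub>\<le>\<^sub>0" if "Re s \<ge> 1/2" for s using that a by (simp add: complex_nonpos_Reals_iff)
  have nz: "s - a \<noteq> 0" if "Re s \<ge> 1/2" for s using that a by (auto simp: complex_eq_iff)
  have hol: "g holomorphic_on {s. Re s > 1/2}" unfolding g_def
    by (intro holomorphic_intros) (use ns in auto)
  have cont: "continuous_on {s. Re s \<ge> 1/2} g" unfolding g_def
    by (intro continuous_intros) (use ns in auto)
  have growth: "\<exists>R. \<forall>s. Re s \<ge> 1/2 \<longrightarrow> norm s \<ge> R \<longrightarrow> norm (g s) \<le> e * (norm s)\<^sup>2" if e: "e > 0" for e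
  proof -
    have "\<forall>\<^sub>F x in at_top. ln (2 * x) + pi \<le> e * x\<^sup>2" using e by real_asymp
    then obtain R where R: "\<And>x. x \<ge> R \<Longrightarrow> ln (2 * x) + pi \<le> e * x\<^sup>2" by (auto simp: eventually_at_top_linorder)
    have "norm (g s) \<le> e * (norm s)\<^sup>2" if s: "Re s \<ge> 1/2" "norm s \<ge> max R (norm a + 1)" for s
    proof -
      have 1: "1 \<le> norm (s - a)" using s norm_triangle_ineq2[of s a] by linarith
      have 2: "norm (s - a) \<le> 2 * norm s" using s norm_triangle_ineq4[of s a] by linarith
      have "ln (norm (s - a)) \<le> ln (2 * norm s)" using 1 2 by (subst ln_le_cancel_iff) auto
      then have "norm (g s) \<le> ln (2 * norm s) + pi" using norm_Ln_le[OF nz[OF s(1)]] 1 by (simp add: g_def)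
      also have "\<dots> \<le> e * (norm s)\<^sup>2" using R s by simp
      finally show ?thesis .
    qed
    then show ?thesis by blast
  qed
  have "has_bochner_integral lborel (\<lambda>u. Re (g (Complex (1/2) u)) / (u\<^sup>2 + 1/4)\<^sup>2) (2 * pi * (2 * Re (g 1) - Re (deriv g 1)))"
    by (rule half_plane_integral_Re[OF hol cont growth])
  moreover have "Re (g s) = ln (norm (s - a))" if "Re s \<ge> 1/2" for s using nz[OF that] by (simp add: g_def)
  moreover have "deriv g 1 = 1 / (1 - a)"
  proof (rule DERIV_imp_deriv)
    have "1 - a \<notin> \<real>\<^sub>\<le>\<^sub>0" by (rule ns) simp
    from has_field_derivative_Ln[OF this]
    have "((\<lambda>s. Ln (s - a)) has_field_derivative inverse (1 - a) * 1) (at 1)"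
      by (rule DERIV_chain2) (auto intro!: derivative_eq_intros)
    then show "(g has_field_derivative 1 / (1 - a)) (at 1)" unfolding g_def by (simp add: inverse_eq_divide)
  qed
  ultimately show ?thesis by simp
qed

text \<open>For \<open>a\<close> on the line, as happens for zeros on the critical line, the
  integrand has a logarithmic singularity. Pushing \<open>a\<close> to the left by
  \<open>h n\<close> enlarges the distance, so the integrands decrease monotonically to it; the
  minus sign in \<open>f\<close> turns this into an increasing sequence.\<close>

lemma log_line_integral:
  assumes a: "Re a \<le> 1/2"
  shows "has_bochner_integral lborel (\<lambda>u. ln (norm (Complex (1/2) u - a)) / (u\<^sup>2 + 1/4)\<^sup>2)
    (2 * pi * (2 * ln (norm (1 - a)) - Re (1 / (1 - a))))"
proof (cases "Re a < 1/2")
  case True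
  then show ?thesis by (rule log_line_integral_interior)
next
  case False
  then have Re: "Re a = 1/2" using a by simp
  define h where "h = (\<lambda>n. 1 / real (Suc n))"
  have h: "h n > 0" for n by (simp add: h_def)
  have hd: "h (Suc n) \<le> h n" for n unfolding h_def by (intro divide_left_mono) auto
  have hl: "h \<longlonglongrightarrow> 0" unfolding h_def by real_asymp
  define f where "f = (\<lambda>n u. - (ln (norm (Complex (1/2) u - (a - of_real (h n)))) / (u\<^sup>2 + 1/4)\<^sup>2))"
  define I where "I = (\<lambda>b::complex. 2 * pi * (2 * ln (norm (1 - b)) - Re (1 / (1 - b))))"
  have fi: "has_bochner_integral lborel (f n) (- I (a - of_real (h n)))" for n
    unfolding f_def I_def by (intro has_bochner_integral_minus log_line_integral_interior) (use Re h in auto)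
  have nrm: "norm (Complex (1/2) u - (a - of_real t)) = sqrt (t\<^sup>2 + (u - Im a)\<^sup>2)" for u t
  proof -
    have "Complex (1/2) u - (a - of_real t) = Complex t (u - Im a)" using Re by (simp add: complex_eq_iff)
    then show ?thesis by (simp only: cmod_def complex.sel)
  qed
  have mono: "incseq (\<lambda>n. f n u)" for u
  proof (rule incseq_SucI)
    fix n
    have "(h (Suc n))\<^sup>2 \<le> (h n)\<^sup>2" using h[of "Suc n"] hd[of n] by (intro power_mono) auto
    then have "sqrt ((h (Suc n))\<^sup>2 + (u - Im a)\<^sup>2) \<le> sqrt ((h n)\<^sup>2 + (u - Im a)\<^sup>2)" by simp
    moreover have "0 < sqrt ((h (Suc n))\<^sup>2 + (u - Im a)\<^sup>2)" using h[of "Suc n"] by (simp add: add_pos_nonneg)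
    ultimately have "ln (sqrt ((h (Suc n))\<^sup>2 + (u - Im a)\<^sup>2)) \<le> ln (sqrt ((h n)\<^sup>2 + (u - Im a)\<^sup>2))"
      by (intro ln_mono) auto
    then show "f n u \<le> f (Suc n) u" unfolding f_def nrm by (simp add: divide_right_mono)
  qed
  define v where "v = (\<lambda>u. - (ln (norm (Complex (1/2) u - a)) / (u\<^sup>2 + 1/4)\<^sup>2))"
  have lim: "AE u in lborel. (\<lambda>n. f n u) \<longlonglongrightarrow> v u"
    using AE_lborel_singleton[of "Im a"]
  proof eventually_elim
    case (elim u)
    then have "Complex (1/2) u - a \<noteq> 0" using Re by (auto simp: complex_eq_iff)
    moreover have "(\<lambda>n. Complex (1/2) u - (a - of_real (h n))) \<longlonglongrightarrow> Complex (1/2) u - (a - of_real 0)"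
      by (intro tendsto_intros hl)
    ultimately have "(\<lambda>n. ln (norm (Complex (1/2) u - (a - of_real (h n))))) \<longlonglongrightarrow> ln (norm (Complex (1/2) u - a))"
      by (intro tendsto_ln tendsto_norm) auto
    then show ?case unfolding f_def v_def by (intro tendsto_minus tendsto_divide tendsto_const) (use add_nonneg_pos[of "u\<^sup>2" "1/4"] in auto)
  qed
  have "1 - a \<noteq> 0" using Re by (auto simp: complex_eq_iff)
  then have Il: "(\<lambda>n. - I (a - of_real (h n))) \<longlonglongrightarrow> - I (a - of_real 0)"
    unfolding I_def by (intro tendsto_intros hl) auto
  have meas: "v \<in> borel_measurable lborel"
  proof -
    have "(\<lambda>u. Complex (1/2) u) \<in> borel_measurable borel" by (intro borel_measurable_continuous_onI continuous_intros)
    then show ?thesis unfolding v_def by measurable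
  qed
  have int: "integrable lborel (f n)" "integral\<^sup>L lborel (f n) = - I (a - of_real (h n))" for n
    using fi[of n] by (auto simp: has_bochner_integral_iff)
  have "integrable lborel v"
    by (rule integrable_monotone_convergence[OF int(1) _ lim _ meas, where x = "- I a"]) (use mono Il int in auto)
  moreover have "integral\<^sup>L lborel v = - I a"
    by (rule integral_monotone_convergence[OF int(1) _ lim _ meas]) (use mono Il int in auto)
  ultimately have "has_bochner_integral lborel v (- I a)" by (simp add: has_bochner_integral_iff)
  from has_bochner_integral_minus[OF this] show ?thesis by (simp add: v_def I_def)
qed

text \<open>The derivative y/(1 + y) is bounded by min(1, |x|), hence by |x|^(1/2). The exponent 3/2
  is a compromise: above 1, so that the sum over k in the series of \<open>ln_Gamma\<close>
  converges, and below 2, so that the growth condition of the half-plane formula holds.\<close>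

lemma norm_minus_Ln_1_plus_le:
  fixes x :: complex
  assumes "Re x \<ge> 0"
  shows "norm (x - Ln (1 + x)) \<le> norm x powr (3/2)"
proof (cases "x = 0")
  case False
  define B where "B = norm x powr (1/2)"
  have "norm ((x - Ln (1 + x)) - (0 - Ln (1 + 0))) \<le> B * norm (x - 0)"
  proof (rule field_differentiable_bound[where S = "closed_segment 0 x" and f' = "\<lambda>y. y / (1 + y)" and f = "\<lambda>y. y - Ln (1 + y)"])
    fix y assume "y \<in> closed_segment 0 x"
    then obtain u where u: "0 \<le> u" "u \<le> 1" "y = of_real u * x" by (auto simp: closed_segment_def scaleR_conv_of_real)
    have Re: "Re y \<ge> 0" using u assms by simp
    have "1 + y \<notin> \<real>\<^sub>\<le>\<^sub>0" using Re by (simp add: complex_nonpos_Reals_iff)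
    moreover have n1: "1 + y \<noteq> 0" using Re by (auto simp: complex_eq_iff)
    ultimately have "((\<lambda>y. y - Ln (1 + y)) has_field_derivative 1 - inverse (1 + y)) (at y)"
      by (auto intro!: derivative_eq_intros)
    moreover have "1 - inverse (1 + y) = y / (1 + y)" using n1 by (simp add: field_simps)
    ultimately have "((\<lambda>y. y - Ln (1 + y)) has_field_derivative y / (1 + y)) (at y)" by simp
    then show "((\<lambda>y. y - Ln (1 + y)) has_field_derivative y / (1 + y)) (at y within closed_segment 0 x)"
      by (rule has_field_derivative_at_within)
    have g1: "norm (1 + y) \<ge> 1" using complex_Re_le_cmod[of "1 + y"] Re by simp
    have "(norm y)\<^sup>2 \<le> (norm (1 + y))\<^sup>2" unfolding cmod_power2 using Re by (simp add: power2_eq_square algebra_simps)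
    then have gy: "norm y \<le> norm (1 + y)" by (rule power2_le_imp_le) simp
    have "norm (y / (1 + y)) \<le> min 1 (norm x)"
    proof (rule min.boundedI)
      have "1 + y \<noteq> 0" by (rule n1)
      then show "norm (y / (1 + y)) \<le> 1" using gy by (simp add: norm_divide divide_le_eq)
      have "norm (y / (1 + y)) \<le> norm y / 1" unfolding norm_divide using g1 by (intro divide_left_mono) auto
      also have "\<dots> \<le> norm x" using u by (simp add: norm_mult mult_left_le_one_le)
      finally show "norm (y / (1 + y)) \<le> norm x" .
    qed
    also have "min 1 (norm x) \<le> B"
    proof (cases "norm x \<le> 1")
      case True
      then have "norm x powr 1 \<le> norm x powr (1/2)" by (intro powr_mono') auto
      then show ?thesis using True by (simp add: B_def)
    next
      case f: False
      then show ?thesis by (simp add: B_def ge_one_powr_ge_zero)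
    qed
    finally show "norm (y / (1 + y)) \<le> B" .
  qed auto
  also have "B * norm (x - 0) = norm x powr (3/2)"
  proof -
    have "norm x powr (3/2) = norm x powr (1/2 + 1)" by simp
    also have "\<dots> = B * norm x" unfolding powr_add B_def by simp
    finally show ?thesis by simp
  qed
  finally show ?thesis by simp
qed simp

text \<open>A termwise estimate of the Weierstrass series. It is much weaker than Stirling's
  formula, but it is o(|z|^2), which is what the half-plane formula asks for.\<close>

lemma norm_ln_Gamma_le:
  obtains C where "C \<ge> 0" "\<And>z. Re z > 0 \<Longrightarrow> norm (ln_Gamma z) \<le> C * norm z powr (3/2) + euler_mascheroni * norm z + norm (Ln z)"
proof -
  define f where "f = (\<lambda>n. real (Suc n) powr (- (3/2)))"
  have sf: "summable f" unfolding f_def by (subst summable_Suc_iff) (simp add: summable_real_powr_iff)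
  have "norm (ln_Gamma z) \<le> suminf f * norm z powr (3/2) + euler_mascheroni * norm z + norm (Ln z)" if z: "Re z > 0" for z
  proof -
    have "z \<notin> \<int>\<^sub>\<le>\<^sub>0" using z nonpos_Ints_subset_nonpos_Reals by (auto simp: complex_nonpos_Reals_iff)
    from ln_Gamma_series'_aux[OF this]
    have s: "(\<lambda>k. z / of_nat (Suc k) - ln (1 + z / of_nat (Suc k))) sums (ln_Gamma z + euler_mascheroni * z + ln z)" .
    have le: "norm (z / of_nat (Suc k) - ln (1 + z / of_nat (Suc k))) \<le> f k * norm z powr (3/2)" for k
    proof -
      have "norm (z / of_nat (Suc k) - ln (1 + z / of_nat (Suc k))) \<le> norm (z / of_nat (Suc k)) powr (3/2)"
        by (rule norm_minus_Ln_1_plus_le) (use z in \<open>simp del: of_nat_Suc\<close>)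
      also have "\<dots> = f k * norm z powr (3/2)"
      proof -
        have "norm (z / of_nat (Suc k)) = norm z / real (Suc k)" by (simp only: norm_divide norm_of_nat)
        moreover have "(norm z / real (Suc k)) powr (3/2) = norm z powr (3/2) / real (Suc k) powr (3/2)"
          by (simp add: powr_divide del: of_nat_Suc)
        moreover have "f k = 1 / real (Suc k) powr (3/2)" unfolding f_def by (rule powr_minus_divide)
        ultimately show ?thesis by simp
      qed
      finally show ?thesis .
    qed
    have sm: "summable (\<lambda>k. f k * norm z powr (3/2))" by (intro summable_mult2 sf)
    have "norm (ln_Gamma z + euler_mascheroni * z + ln z) \<le> (\<Sum>k. f k * norm z powr (3/2))"
      using norm_suminf_le[OF le sm] s by (simp add: sums_iff)
    also have "\<dots> = suminf f * norm z powr (3/2)" by (rule suminf_mult2[OF sf, symmetric])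
    finally have 1: "norm (ln_Gamma z + euler_mascheroni * z + ln z) \<le> suminf f * norm z powr (3/2)" .
    have "norm (ln_Gamma z) \<le> norm (ln_Gamma z + euler_mascheroni * z + ln z) + norm (euler_mascheroni * z + ln z)"
      using norm_triangle_ineq4[of "ln_Gamma z + euler_mascheroni * z + ln z" "euler_mascheroni * z + ln z"] by (simp add: add.assoc)
    also have "norm (euler_mascheroni * z + ln z) \<le> norm (euler_mascheroni * z) + norm (ln z)" by (rule norm_triangle_ineq)
    also have "norm (euler_mascheroni * z) = euler_mascheroni * norm z"
    proof -
      have "norm (complex_of_real euler_mascheroni) = euler_mascheroni"
        unfolding norm_of_real by (rule abs_of_pos[OF euler_mascheroni_pos])
      then show ?thesis unfolding norm_mult of_real_euler_mascheroni by simp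
    qed
    finally show ?thesis using 1 by linarith
  qed
  moreover have "suminf f \<ge> 0" by (rule suminf_nonneg[OF sf]) (simp add: f_def)
  ultimately show ?thesis using that by blast
qed

text \<open>The zero of s - 1 lies inside the half-plane Re s > 1/2, so its logarithm cannot be used
  there. On the critical line |s - 1| = |s|, and \<open>k\<close> therefore takes
  \<open>2 * Ln s\<close>, one for s - 1 and one for the s in \<open>xi_factor\<close>. Then Re k is
  the required logarithm on the line, and k is holomorphic on the half-plane.\<close>

lemma xi_factor_line_integral:
  "has_bochner_integral lborel (\<lambda>u. ln (norm ((Complex (1/2) u - 1) * xi_factor (Complex (1/2) u))) / (u\<^sup>2 + 1/4)\<^sup>2)
    (2 * pi * (euler_mascheroni / 2 + ln pi / 2 - ln 2 - 2))"
proof -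
  define k where "k = (\<lambda>s::complex. - of_real (ln 2) + 2 * Ln s - s / 2 * of_real (ln pi) + ln_Gamma (s / 2))"
  define k' where "k' = (\<lambda>s::complex. 2 * inverse s - 1 / 2 * of_real (ln pi) + Digamma (s / 2) * (1/2))"
  have nn: "s \<notin> \<real>\<^sub>\<le>\<^sub>0" "s / 2 \<notin> \<real>\<^sub>\<le>\<^sub>0" if "Re s > 0" for s using that by (auto simp: complex_nonpos_Reals_iff)
  have dk: "(k has_field_derivative k' s) (at s)" if s: "Re s > 0" for s
  proof -
    have 1: "((\<lambda>s. 2 * Ln s) has_field_derivative 2 * inverse s) (at s)"
      by (rule DERIV_cmult[OF has_field_derivative_Ln[OF nn(1)[OF s]]])
    have h: "((\<lambda>s::complex. s / 2) has_field_derivative 1/2) (at s)" by (auto intro!: derivative_eq_intros)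
    have 2: "((\<lambda>s. ln_Gamma (s / 2)) has_field_derivative Digamma (s / 2) * (1/2)) (at s)"
      by (rule DERIV_chain2[OF has_field_derivative_ln_Gamma_complex[OF nn(2)[OF s]] h])
    have 3: "((\<lambda>s. s / 2 * of_real (ln pi)) has_field_derivative 1/2 * of_real (ln pi)) (at s)"
      by (rule DERIV_cmult_right[OF h])
    have "(k has_field_derivative 0 + 2 * inverse s - 1/2 * of_real (ln pi) + Digamma (s / 2) * (1/2)) (at s)"
      unfolding k_def by (intro DERIV_add DERIV_diff DERIV_const 1 2 3)
    then show ?thesis by (simp add: k'_def)
  qed
  have hol: "k holomorphic_on {s. Re s > 1/2}"
    unfolding holomorphic_on_open[OF open_halfspace_Re_gt]
  proof
    fix s :: complex assume "s \<in> {s. Re s > 1/2}"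
    then have "(k has_field_derivative k' s) (at s)" by (intro dk) auto
    then show "\<exists>f'. (k has_field_derivative f') (at s)" by blast
  qed
  have cont: "continuous_on {s. Re s \<ge> 1/2} k"
    by (intro continuous_at_imp_continuous_on ballI DERIV_isCont[OF dk]) auto
  obtain C where C: "C \<ge> 0" "\<And>z. Re z > 0 \<Longrightarrow> norm (ln_Gamma z) \<le> C * norm z powr (3/2) + euler_mascheroni * norm z + norm (Ln z)"
    using norm_ln_Gamma_le by blast
  have growth: "\<exists>R. \<forall>s. Re s \<ge> 1/2 \<longrightarrow> norm s \<ge> R \<longrightarrow> norm (k s) \<le> e * (norm s)\<^sup>2" if e: "e > 0" for e
  proof -
    define B where "B = (\<lambda>x::real. ln 2 + 2 * (ln x + pi) + x / 2 * \<bar>ln pi\<bar> + (C * (x / 2) powr (3/2) + euler_mascheroni * (x / 2) + (ln (x / 2) + pi)))"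
    have l1: "((\<lambda>x::real. (x / 2) powr (3/2) / x\<^sup>2) \<longlongrightarrow> 0) at_top" by real_asymp
    have l2: "((\<lambda>x::real. (ln 2 + 2 * (ln x + pi) + (ln (x / 2) + pi)) / x\<^sup>2) \<longlongrightarrow> 0) at_top" by real_asymp
    have l3: "((\<lambda>x::real. (x / 2) / x\<^sup>2) \<longlongrightarrow> 0) at_top" by real_asymp
    have "((\<lambda>x. (ln 2 + 2 * (ln x + pi) + (ln (x / 2) + pi)) / x\<^sup>2 + C * ((x / 2) powr (3/2) / x\<^sup>2) +
        (\<bar>ln pi\<bar> + euler_mascheroni) * ((x / 2) / x\<^sup>2)) \<longlongrightarrow> 0 + C * 0 + (\<bar>ln pi\<bar> + euler_mascheroni) * 0) at_top"
      by (intro tendsto_intros l1 l2 l3)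
    then have "((\<lambda>x. (ln 2 + 2 * (ln x + pi) + (ln (x / 2) + pi)) / x\<^sup>2 + C * ((x / 2) powr (3/2) / x\<^sup>2) +
        (\<bar>ln pi\<bar> + euler_mascheroni) * ((x / 2) / x\<^sup>2)) \<longlongrightarrow> 0) at_top" by simp
    then have "\<forall>\<^sub>F x in at_top. (ln 2 + 2 * (ln x + pi) + (ln (x / 2) + pi)) / x\<^sup>2 + C * ((x / 2) powr (3/2) / x\<^sup>2) +
        (\<bar>ln pi\<bar> + euler_mascheroni) * ((x / 2) / x\<^sup>2) < e" using e by (rule order_tendstoD)
    then obtain R where R: "\<And>x. x \<ge> R \<Longrightarrow> (ln 2 + 2 * (ln x + pi) + (ln (x / 2) + pi)) / x\<^sup>2 + C * ((x / 2) powr (3/2) / x\<^sup>2) +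
        (\<bar>ln pi\<bar> + euler_mascheroni) * ((x / 2) / x\<^sup>2) < e" by (auto simp: eventually_at_top_linorder)
    have "norm (k s) \<le> e * (norm s)\<^sup>2" if s: "Re s \<ge> 1/2" "norm s \<ge> max R 2" for s
    proof -
      define x where "x = norm s"
      have x: "x \<ge> 2" "x \<ge> R" using s by (auto simp: x_def)
      have s0: "s \<noteq> 0" "s / 2 \<noteq> 0" using x by (auto simp: x_def)
      have nh: "norm (s / 2) = x / 2" by (simp add: x_def norm_divide)
      have a: "norm (Ln s) \<le> ln x + pi" using norm_Ln_le[OF s0(1)] x by (simp add: x_def[symmetric] ln_ge_zero)
      have b: "norm (Ln (s / 2)) \<le> ln (x / 2) + pi" using norm_Ln_le[OF s0(2)] x unfolding nh by (simp add: ln_ge_zero)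
      have c: "norm (ln_Gamma (s / 2)) \<le> C * (x / 2) powr (3/2) + euler_mascheroni * (x / 2) + (ln (x / 2) + pi)"
        using C(2)[of "s / 2"] s b unfolding nh by simp
      have d: "norm (s / 2 * of_real (ln pi)) = x / 2 * \<bar>ln pi\<bar>" by (simp only: norm_mult nh norm_of_real)
      have gen: "K \<le> l + 2 * q + w + g" if "K \<le> A + G" "A \<le> M + D" "M \<le> M1 + M2" "M1 = l" "M2 = 2 * n1" "n1 \<le> q" "G \<le> g" "D = w"
        for K l q w g A G D M M1 M2 n1 :: real using that by linarith
      have t1: "norm (k s) \<le> norm (- of_real (ln 2) + 2 * Ln s - s / 2 * of_real (ln pi)) + norm (ln_Gamma (s / 2))"
        unfolding k_def by (rule norm_triangle_ineq)
      have t2: "norm (- complex_of_real (ln 2)) = ln 2" by (simp only: norm_minus_cancel norm_of_real) simp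
      have t3: "norm (2 * Ln s) = 2 * norm (Ln s)" by (simp add: norm_mult)
      have "norm (k s) \<le> B x"
        unfolding B_def by (rule gen[OF t1 norm_triangle_ineq4 norm_triangle_ineq t2 t3 a c d])
      also have "B x \<le> e * x\<^sup>2"
      proof -
        have "B x / x\<^sup>2 = (ln 2 + 2 * (ln x + pi) + (ln (x / 2) + pi)) / x\<^sup>2 + C * ((x / 2) powr (3/2) / x\<^sup>2) +
          (\<bar>ln pi\<bar> + euler_mascheroni) * ((x / 2) / x\<^sup>2)"
        proof -
          have gen: "(l + q + h * w + (c * p + g * h + m)) / y = (l + q + m) / y + c * (p / y) + (w + g) * (h / y)" for l q h w c p g m y :: real
            by (simp add: add_divide_distrib ring_distribs)
          show ?thesis unfolding B_def by (rule gen)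
        qed
        then have "B x / x\<^sup>2 < e" using R[OF x(2)] by simp
        then show ?thesis using x by (simp add: divide_less_eq)
      qed
      finally show ?thesis by (simp add: x_def)
    qed
    then show ?thesis by blast
  qed
  have "has_bochner_integral lborel (\<lambda>u. Re (k (Complex (1/2) u)) / (u\<^sup>2 + 1/4)\<^sup>2) (2 * pi * (2 * Re (k 1) - Re (deriv k 1)))"
    by (rule half_plane_integral_Re[OF hol cont growth])
  moreover have "Re (k (Complex (1/2) u)) = ln (norm ((Complex (1/2) u - 1) * xi_factor (Complex (1/2) u)))" for u
  proof -
    define s where "s = Complex (1/2) u"
    have s: "Re s = 1/2" "s \<noteq> 0" by (auto simp: s_def complex_eq_iff)
    have G: "norm (Gamma (s / 2)) = exp (Re (ln_Gamma (s / 2)))"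
      using half_not_nonpos_Int[of s] s by (simp add: Gamma_complex_altdef)
    have P: "norm (complex_of_real pi powr (- s / 2)) = exp (- Re s / 2 * ln pi)"
      by (subst norm_powr_real_powr) (auto simp: powr_def)
    have S: "norm (s - 1) = norm s" by (simp add: s_def cmod_def power2_eq_square)
    have "norm ((s - 1) * xi_factor s) = norm s * (norm s / 2 * norm (Gamma (s / 2)) * norm (complex_of_real pi powr (- s / 2)))"
      unfolding xi_factor_def by (simp add: norm_mult norm_divide S)
    also have "ln \<dots> = ln (norm s) + (ln (norm s) - ln 2 + Re (ln_Gamma (s / 2)) + (- Re s / 2 * ln pi))"
      unfolding G P using s(2) by (simp add: ln_mult ln_div)
    also have "\<dots> = Re (k s)" using s(2) by (simp add: k_def)
    finally show ?thesis by (simp add: s_def)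
  qed
  moreover have "Re (k 1) = - ln 2"
  proof -
    have n: "(1/2 :: complex) \<notin> \<int>\<^sub>\<le>\<^sub>0" using half_not_nonpos_Int[of 1] by simp
    have "norm (Gamma (1/2 :: complex)) = exp (Re (ln_Gamma (1/2)))" using n by (simp add: Gamma_complex_altdef)
    moreover have "norm (Gamma (1/2 :: complex)) = sqrt pi" by (simp add: Gamma_one_half_complex)
    ultimately have "Re (ln_Gamma (1/2)) = ln (sqrt pi)" by (metis ln_exp)
    then show ?thesis by (simp add: k_def ln_sqrt)
  qed
  moreover have "Re (deriv k 1) = 2 - ln pi / 2 - euler_mascheroni / 2 - ln 2"
  proof -
    have "deriv k 1 = k' 1" by (rule DERIV_imp_deriv, rule dk) simp
    moreover have "Re (Digamma (1/2 :: complex)) = - euler_mascheroni - 2 * ln 2"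
    proof -
      have "Digamma (1/2 :: complex) = of_real (- euler_mascheroni - 2 * ln 2)" by (simp add: Digamma_one_half)
      then show ?thesis by (simp only: Re_complex_of_real)
    qed
    ultimately show ?thesis by (simp add: k'_def)
  qed
  ultimately show ?thesis by (simp add: algebra_simps)
qed

section \<open>Sums over the zeros\<close>

abbreviation xi_zeros :: "nat \<Rightarrow> complex set" where "xi_zeros \<equiv> zeros_upto xi_even"

abbreviation xi_mult :: "complex \<Rightarrow> nat" where "xi_mult r \<equiv> nat (zorder xi_even r)"

lemma finite_xi_zeros: "finite (xi_zeros n)"
  by (rule finite_zeros_upto[OF xi_even_holomorphic xi_even_0])

lemma xi_zeros_mono: "xi_zeros n \<subseteq> xi_zeros (Suc n)"
  by (auto simp: zeros_upto_def)

lemma xi_zerosD: "r \<in> xi_zeros n \<Longrightarrow> xi_even r = 0" by (simp add: zeros_upto_def)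

lemma xi_mult_pos: "xi_even r = 0 \<Longrightarrow> xi_mult r > 0"
proof -
  assume r: "xi_even r = 0"
  have "(if xi_even r = 0 then 0 < zorder xi_even r else zorder xi_even r = 0) \<and> (\<exists>d>0. cball r d \<subseteq> UNIV \<and>
      zor_poly xi_even r holomorphic_on cball r d \<and>
      (\<forall>w\<in>cball r d. xi_even w = zor_poly xi_even r w * (w - r) ^ nat (zorder xi_even r) \<and> zor_poly xi_even r w \<noteq> 0))"
    by (rule zorder_exist_zero[OF xi_even_holomorphic]) (use xi_even_0 in blast)+
  then show ?thesis using r by simp
qed

lemma xi_mult_uminus: "xi_mult (- r) = xi_mult r"
  using zorder_even[OF xi_even_holomorphic xi_even_uminus xi_even_0] by simp

text \<open>Every infinite sum over zeros is the limit of these partial sums along discs; as discs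
  and multiplicities are symmetric, \<open>r\<close> may be paired with \<open>- r\<close> before
  passing to the limit.\<close>

definition zsum :: "(complex \<Rightarrow> 'a) \<Rightarrow> nat \<Rightarrow> 'a :: real_algebra_1" where
  "zsum f n = (\<Sum>r\<in>xi_zeros n. of_nat (xi_mult r) * f r)"

lemma zsum_reflect: "zsum (\<lambda>r. f (- r)) n = zsum f n"
  unfolding zsum_def
  by (rule sum.reindex_bij_witness[of _ uminus uminus]) (auto simp: zeros_upto_def xi_even_uminus xi_mult_uminus)

lemma zsum_add: "zsum (\<lambda>r. f r + g r) n = zsum f n + zsum g n"
  unfolding zsum_def by (simp add: distrib_left sum.distrib)

lemma zsum_diff: "zsum (\<lambda>r. f r - g r) n = zsum f n - zsum g n"
  unfolding zsum_def by (simp add: right_diff_distrib sum_subtractf)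

lemma zsum_cmult: "zsum (\<lambda>r. c * f r) n = c * zsum f n" for c :: real
  unfolding zsum_def by (simp add: sum_distrib_left mult_ac)

lemma zsum_symmetrize: "zsum (\<lambda>r. f r + f (- r)) n = 2 * zsum f n" for f :: "complex \<Rightarrow> real"
  unfolding zsum_add zsum_reflect by simp

lemma zsum_cong: "(\<And>r. xi_even r = 0 \<Longrightarrow> f r = g r) \<Longrightarrow> zsum f n = zsum g n"
  unfolding zsum_def by (intro sum.cong refl) (auto dest: xi_zerosD)

lemma zsum_mono: "(\<And>r. xi_even r = 0 \<Longrightarrow> f r \<le> g r) \<Longrightarrow> zsum f n \<le> zsum g n" for f g :: "complex \<Rightarrow> real"
  unfolding zsum_def by (intro sum_mono mult_left_mono) (auto dest: xi_zerosD)

lemma zsum_incseq: "(\<And>r. xi_even r = 0 \<Longrightarrow> f r \<ge> 0) \<Longrightarrow> incseq (zsum f)" for f :: "complex \<Rightarrow> real"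
  unfolding zsum_def
  by (intro incseq_SucI sum_mono2 finite_xi_zeros xi_zeros_mono) (auto simp: zeros_upto_def)

text \<open>Nonnegative terms make the partial sums along discs monotone, so comparison works
  although just one order of summation is available.\<close>

lemma zsum_convergent:
  fixes f g :: "complex \<Rightarrow> real"
  assumes "zsum g \<longlonglongrightarrow> L" "\<And>r. xi_even r = 0 \<Longrightarrow> 0 \<le> f r" "\<And>r. xi_even r = 0 \<Longrightarrow> f r \<le> g r"
  shows "\<exists>M. zsum f \<longlonglongrightarrow> M"
proof -
  have "incseq (zsum g)" by (rule zsum_incseq) (use assms in \<open>blast intro: order_trans\<close>)
  then have "zsum g n \<le> L" for n by (rule incseq_le[OF _ assms(1)])
  then have "zsum f n \<le> L" for n using zsum_mono[of f g n] assms(3) by (meson order_trans)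
  then obtain M where "zsum f \<longlonglongrightarrow> M" using incseq_convergent[OF zsum_incseq[of f]] assms(2) by blast
  then show ?thesis ..
qed

text \<open>A single zero with \<open>f r > 0\<close> lies in some disc and, having multiplicity at
  least 1, lifts all later partial sums. Through this clause equality becomes a statement about
  every zero.\<close>

lemma zsum_limit_nonneg:
  fixes f :: "complex \<Rightarrow> real"
  assumes lim: "zsum f \<longlonglongrightarrow> L" and f: "\<And>r. xi_even r = 0 \<Longrightarrow> 0 \<le> f r"
  shows "L \<ge> 0" "L = 0 \<longleftrightarrow> (\<forall>r. xi_even r = 0 \<longrightarrow> f r = 0)"
proof -
  have inc: "zsum f n \<le> L" for n by (rule incseq_le[OF zsum_incseq[OF f] lim])
  have nn: "0 \<le> zsum f n" for n unfolding zsum_def using f by (intro sum_nonneg mult_nonneg_nonneg) (auto dest: xi_zerosD)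
  show "L \<ge> 0" using inc[of 0] nn[of 0] by linarith
  show "L = 0 \<longleftrightarrow> (\<forall>r. xi_even r = 0 \<longrightarrow> f r = 0)"
  proof
    assume L: "L = 0"
    show "\<forall>r. xi_even r = 0 \<longrightarrow> f r = 0"
    proof (intro allI impI)
      fix r assume r: "xi_even r = 0"
      obtain n :: nat where "norm r \<le> real n" using real_arch_simple by blast
      then have rz: "r \<in> xi_zeros n" using r by (simp add: zeros_upto_def)
      have "of_nat (xi_mult r) * f r \<le> zsum f n"
        unfolding zsum_def using rz f by (intro member_le_sum finite_xi_zeros) (auto dest: xi_zerosD)
      then have "real (xi_mult r) * f r \<le> 0" using inc[of n] L by simp
      then show "f r = 0" using xi_mult_pos[OF r] f[OF r] by (simp add: mult_le_0_iff)
    qed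
  next
    assume "\<forall>r. xi_even r = 0 \<longrightarrow> f r = 0"
    then have "zsum f n = 0" for n unfolding zsum_def by (intro sum.neutral) (auto dest: xi_zerosD)
    then have "zsum f = (\<lambda>n. 0)" by blast
    then show "L = 0" using lim LIMSEQ_unique tendsto_const by metis
  qed
qed

lemma has_field_derivative_zero_product:
  fixes m :: "complex \<Rightarrow> nat"
  assumes "finite S" "\<And>r. r \<in> S \<Longrightarrow> r \<noteq> 0 \<and> r \<noteq> a"
  shows "((\<lambda>z. \<Prod>r\<in>S. (1 - z / r) ^ m r) has_field_derivative
     (\<Prod>r\<in>S. (1 - a / r) ^ m r) * (\<Sum>r\<in>S. of_nat (m r) * (1 / (a - r)))) (at a)"
  using assms
proof (induction S rule: finite_induct)
  case (insert q S)
  have q: "q \<noteq> 0" "q \<noteq> a" using insert by auto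
  have l: "((\<lambda>z. 1 - z / q) has_field_derivative - 1 / q) (at a)"
  proof -
    have "((\<lambda>z. 1 - z / q) has_field_derivative 0 - 1 / q) (at a)"
      by (rule DERIV_diff[OF DERIV_const DERIV_cdivide[OF DERIV_ident]])
    then show ?thesis by simp
  qed
  have pw: "((\<lambda>z. (1 - z / q) ^ m q) has_field_derivative (1 - a / q) ^ m q * (of_nat (m q) * (1 / (a - q)))) (at a)"
  proof (cases "m q")
    case (Suc k)
    have "((\<lambda>z. (1 - z / q) ^ Suc k) has_field_derivative of_nat (Suc k) * (- 1 / q * (1 - a / q) ^ (Suc k - Suc 0))) (at a)"
      by (rule DERIV_power[OF l])
    moreover have "of_nat (Suc k) * (- 1 / q * (1 - a / q) ^ (Suc k - Suc 0)) = (1 - a / q) ^ Suc k * (of_nat (Suc k) * (1 / (a - q)))"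
    proof -
      have "(1 - a / q) * (1 / (a - q)) = - 1 / q" using q by (simp add: divide_simps)
      then have "of_nat (Suc k) * (- 1 / q * (1 - a / q) ^ k) = of_nat (Suc k) * (((1 - a / q) * (1 / (a - q))) * (1 - a / q) ^ k)"
        by (simp only:)
      also have "\<dots> = (1 - a / q) ^ Suc k * (of_nat (Suc k) * (1 / (a - q)))" by (simp only: power_Suc mult_ac)
      finally show ?thesis by simp
    qed
    ultimately show ?thesis unfolding Suc by simp
  qed simp
  have IH: "((\<lambda>z. \<Prod>r\<in>S. (1 - z / r) ^ m r) has_field_derivative
     (\<Prod>r\<in>S. (1 - a / r) ^ m r) * (\<Sum>r\<in>S. of_nat (m r) * (1 / (a - r)))) (at a)"
    using insert by blast
  show ?case using DERIV_mult[OF pw IH] insert(1,2) by (simp add: algebra_simps)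
qed simp

text \<open>The factorisation in logarithmic form. The point 1/2 takes the place of the origin as
  reference, because \<open>xi_even (1/2) = 1/2\<close> is explicit while \<open>xi_even 0\<close>
  is not.\<close>

lemma xi_even_zero_sums:
  shows "\<And>z. xi_even z \<noteq> 0 \<Longrightarrow>
      zsum (\<lambda>r. ln (norm (r - z)) - ln (norm (r - 1/2))) \<longlonglongrightarrow> ln (norm (xi_even z)) - ln (norm (xi_even (1/2)))"
    and "zsum (\<lambda>r. 1 / (1/2 - r)) \<longlonglongrightarrow> deriv xi_even (1/2) / xi_even (1/2)"
proof -
  obtain h where h: "\<And>n. n > 0 \<Longrightarrow> h n holomorphic_on ball 0 (real n)"
    "\<And>n z. n > 0 \<Longrightarrow> norm z < real n \<Longrightarrow>
       xi_even z = xi_even 0 * (\<Prod>r\<in>xi_zeros n. (1 - z / r) ^ xi_mult r) * exp (h n z)"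
    "\<And>z. (\<lambda>n. h n z) \<longlonglongrightarrow> 0" "\<And>z. (\<lambda>n. deriv (h n) z) \<longlonglongrightarrow> 0"
    using even_entire_factorization[OF xi_even_holomorphic xi_even_uminus xi_even_0 xi_even_growth] by blast
  have r0: "r \<noteq> 0" "r \<noteq> 1/2" if "r \<in> xi_zeros n" for r n
  proof -
    have z: "xi_even r = 0" using that by (rule xi_zerosD)
    show "r \<noteq> 0" using z xi_even_0 by blast
    show "r \<noteq> 1/2"
    proof
      assume "r = 1/2"
      then have "xi_even (1/2) = 0" using z by (simp only:)
      then show False unfolding xi_even_half by simp
    qed
  qed
  have log: "ln (norm (xi_even z)) = ln (norm (xi_even 0)) + zsum (\<lambda>r. ln (norm (r - z)) - ln (norm r)) n + Re (h n z)"
    if z: "xi_even z \<noteq> 0" and n: "n > 0" "norm z < real n" for z n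
  proof -
    have rz: "r \<noteq> z" if "r \<in> xi_zeros n" for r using xi_zerosD[OF that] z by auto
    have nz: "norm (1 - z / r) \<noteq> 0" if "r \<in> xi_zeros n" for r using rz[OF that] r0[OF that] by (simp add: field_simps)
    have "norm (xi_even z) = norm (xi_even 0) * (\<Prod>r\<in>xi_zeros n. norm (1 - z / r) ^ xi_mult r) * exp (Re (h n z))"
      using h(2)[OF n] by (simp add: norm_mult norm_power flip: prod_norm)
    also have "ln \<dots> = ln (norm (xi_even 0)) + ln (\<Prod>r\<in>xi_zeros n. norm (1 - z / r) ^ xi_mult r) + Re (h n z)"
    proof -
      have "(\<Prod>r\<in>xi_zeros n. norm (1 - z / r) ^ xi_mult r) > 0" using nz by (intro prod_pos) auto
      then show ?thesis using xi_even_0 by (simp add: ln_mult)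
    qed
    also have "ln (\<Prod>r\<in>xi_zeros n. norm (1 - z / r) ^ xi_mult r) = (\<Sum>r\<in>xi_zeros n. ln (norm (1 - z / r) ^ xi_mult r))"
      using nz by (intro ln_prod finite_xi_zeros) auto
    also have "\<dots> = zsum (\<lambda>r. ln (norm (r - z)) - ln (norm r)) n"
      unfolding zsum_def
    proof (intro sum.cong refl)
      fix r assume r: "r \<in> xi_zeros n"
      have "norm (1 - z / r) = norm (r - z) / norm r"
        using r0[OF r] by (simp add: diff_divide_eq_iff flip: norm_divide)
      then have "ln (norm (1 - z / r)) = ln (norm (r - z)) - ln (norm r)" using r0[OF r] rz[OF r] by (simp add: ln_div)
      then show "ln (norm (1 - z / r) ^ xi_mult r) = of_nat (xi_mult r) * (ln (norm (r - z)) - ln (norm r))"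
        using nz[OF r] by (simp add: ln_realpow)
    qed
    finally show ?thesis .
  qed
  show "zsum (\<lambda>r. ln (norm (r - z)) - ln (norm (r - 1/2))) \<longlonglongrightarrow> ln (norm (xi_even z)) - ln (norm (xi_even (1/2)))"
    if z: "xi_even z \<noteq> 0" for z
  proof -
    have hf: "xi_even (1/2) \<noteq> 0" by (simp add: xi_even_half)
    have "\<forall>\<^sub>F n in sequentially. ln (norm (xi_even z)) - ln (norm (xi_even (1/2))) - (Re (h n z) - Re (h n (1/2))) =
        zsum (\<lambda>r. ln (norm (r - z)) - ln (norm (r - 1/2))) n"
    proof -
      obtain N :: nat where N: "real N > norm z" using reals_Archimedean2 by blast
      show ?thesis using eventually_ge_at_top[of "Suc N"]
      proof eventually_elim
        case (elim n)
        have n: "n > 0" "norm z < real n" "norm (1/2 :: complex) < real n" using elim N by auto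
        have "zsum (\<lambda>r. ln (norm (r - z)) - ln (norm r)) n - zsum (\<lambda>r. ln (norm (r - 1/2)) - ln (norm r)) n =
           zsum (\<lambda>r. ln (norm (r - z)) - ln (norm (r - 1/2))) n"
          unfolding zsum_diff[symmetric] by (rule zsum_cong) simp
        then show ?case using log[OF z n(1,2)] log[OF hf n(1,3)] by linarith
      qed
    qed
    moreover have "(\<lambda>n. ln (norm (xi_even z)) - ln (norm (xi_even (1/2))) - (Re (h n z) - Re (h n (1/2)))) \<longlonglongrightarrow>
        ln (norm (xi_even z)) - ln (norm (xi_even (1/2))) - (Re 0 - Re 0)"
      by (intro tendsto_intros h)
    ultimately show ?thesis using Lim_transform_eventually by fastforce
  qed
  show "zsum (\<lambda>r. 1 / (1/2 - r)) \<longlonglongrightarrow> deriv xi_even (1/2) / xi_even (1/2)"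
  proof -
    have "\<forall>\<^sub>F n in sequentially. deriv xi_even (1/2) / xi_even (1/2) - deriv (h n) (1/2) = zsum (\<lambda>r. 1 / (1/2 - r)) n"
      using eventually_ge_at_top[of 1]
    proof eventually_elim
      case (elim n)
      have n: "n > 0" "norm (1/2 :: complex) < real n" using elim by auto
      define P where "P = (\<lambda>z. \<Prod>r\<in>xi_zeros n. (1 - z / r) ^ xi_mult r)"
      have dP: "(P has_field_derivative P (1/2) * zsum (\<lambda>r. 1 / (1/2 - r)) n) (at (1/2))"
        unfolding P_def zsum_def by (rule has_field_derivative_zero_product[OF finite_xi_zeros]) (use r0 in auto)
      have dh: "(h n has_field_derivative deriv (h n) (1/2)) (at (1/2))"
        by (rule holomorphic_derivI[OF h(1)[OF n(1)]]) (use n in auto)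
      have dE: "((\<lambda>z. exp (h n z)) has_field_derivative exp (h n (1/2)) * deriv (h n) (1/2)) (at (1/2))"
        by (rule DERIV_chain2[OF DERIV_exp dh])
      have d1: "((\<lambda>z. xi_even 0 * P z * exp (h n z)) has_field_derivative
         (xi_even 0 * (P (1/2) * zsum (\<lambda>r. 1 / (1/2 - r)) n)) * exp (h n (1/2)) + (exp (h n (1/2)) * deriv (h n) (1/2)) * (xi_even 0 * P (1/2))) (at (1/2))"
        by (rule DERIV_mult[OF DERIV_cmult[OF dP] dE])
      have "\<forall>\<^sub>F z in nhds (1/2 :: complex). z \<in> ball 0 (real n)" using n by (intro eventually_nhds_in_open) auto
      then have ev: "\<forall>\<^sub>F z in nhds (1/2). xi_even z = xi_even 0 * P z * exp (h n z)"
        by eventually_elim (use h(2)[OF n(1)] in \<open>simp add: P_def\<close>)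
      have "(xi_even has_field_derivative
         (xi_even 0 * (P (1/2) * zsum (\<lambda>r. 1 / (1/2 - r)) n)) * exp (h n (1/2)) + (exp (h n (1/2)) * deriv (h n) (1/2)) * (xi_even 0 * P (1/2))) (at (1/2))"
        using DERIV_cong_ev[OF refl ev refl] d1 by simp
      then have "deriv xi_even (1/2) = (xi_even 0 * (P (1/2) * zsum (\<lambda>r. 1 / (1/2 - r)) n)) * exp (h n (1/2)) + (exp (h n (1/2)) * deriv (h n) (1/2)) * (xi_even 0 * P (1/2))"
        by (rule DERIV_imp_deriv)
      also have "\<dots> = (xi_even 0 * P (1/2) * exp (h n (1/2))) * (zsum (\<lambda>r. 1 / (1/2 - r)) n + deriv (h n) (1/2))" by (simp add: algebra_simps)
      also have "xi_even 0 * P (1/2) * exp (h n (1/2)) = xi_even (1/2)" using h(2)[OF n] by (simp add: P_def)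
      finally have eq: "deriv xi_even (1/2) = xi_even (1/2) * (zsum (\<lambda>r. 1 / (1/2 - r)) n + deriv (h n) (1/2))" .
      have "xi_even (1/2) \<noteq> 0" unfolding xi_even_half by simp
      then show ?case unfolding eq by simp
    qed
    moreover have "(\<lambda>n. deriv xi_even (1/2) / xi_even (1/2) - deriv (h n) (1/2)) \<longlonglongrightarrow> deriv xi_even (1/2) / xi_even (1/2) - 0"
      by (intro tendsto_diff tendsto_const h(4))
    ultimately show ?thesis using Lim_transform_eventually by fastforce
  qed
qed

text \<open>With \<rho> = 1/2 + r one has 1/4 - r^2 = \<rho> (1 - \<rho>), so this is the real part
  of 1/\<rho> + 1/(1 - \<rho>).\<close>

definition zero_beta :: "complex \<Rightarrow> real" where "zero_beta r = Re (1 / (1/4 - r\<^sup>2))"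

lemma zero_beta_split:
  assumes "xi_even r = 0"
  shows "zero_beta r = Re (1 / (1/2 - r)) + Re (1 / (1/2 + r))"
proof -
  have n: "1/2 - r \<noteq> 0" "1/2 + r \<noteq> 0" using xi_even_zero_strip(1)[OF assms] by (auto simp: complex_eq_iff)
  have "1/4 - r\<^sup>2 = (1/2 - r) * (1/2 + r)" by (simp add: power2_eq_square algebra_simps)
  then have "1 / (1/4 - r\<^sup>2) = 1 / (1/2 - r) + 1 / (1/2 + r)" using n by (simp add: add_frac_eq)
  then show ?thesis by (simp add: zero_beta_def)
qed

text \<open>The sum of 1/(1/2 - r) is the logarithmic derivative of xi at s = 1; pairing
  \<open>r\<close> with \<open>- r\<close> turns twice its real part into the sum of
  \<open>zero_beta\<close>.\<close>

lemma zsum_zero_beta: "zsum zero_beta \<longlonglongrightarrow> 2 + euler_mascheroni - ln (4 * pi)"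
proof -
  define B where "B = 1 + euler_mascheroni / 2 - ln (4 * pi) / 2"
  have "deriv xi_even (1/2) / xi_even (1/2) = of_real B"
    unfolding deriv_xi_even_half xi_even_half B_def by simp
  then have "zsum (\<lambda>r. 1 / (1/2 - r)) \<longlonglongrightarrow> of_real B" using xi_even_zero_sums(2) by simp
  then have "(\<lambda>n. 2 * Re (zsum (\<lambda>r. 1 / (1/2 - r)) n)) \<longlonglongrightarrow> 2 * Re (of_real B)" by (intro tendsto_intros)
  moreover have "2 * Re (zsum (\<lambda>r. 1 / (1/2 - r)) n) = zsum zero_beta n" for n
  proof -
    have "Re (zsum (\<lambda>r. 1 / (1/2 - r)) n) = zsum (\<lambda>r. Re (1 / (1/2 - r))) n"
      unfolding zsum_def Re_sum
      by (intro sum.cong refl) (simp only: times_complex.sel complex_Re_of_nat complex_Im_of_nat mult_zero_left diff_zero)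
    then have "2 * Re (zsum (\<lambda>r. 1 / (1/2 - r)) n) = zsum (\<lambda>r. Re (1 / (1/2 - r)) + Re (1 / (1/2 - (- r)))) n"
      by (simp only: zsum_symmetrize[of "\<lambda>r. Re (1 / (1/2 - r))"])
    also have "\<dots> = zsum zero_beta n" by (rule zsum_cong) (simp add: zero_beta_split)
    finally show ?thesis .
  qed
  moreover have "2 * Re (complex_of_real B) = 2 + euler_mascheroni - ln (4 * pi)"
    unfolding Re_complex_of_real B_def by simp
  ultimately show ?thesis by (simp only:)
qed

section \<open>Inequalities for the contribution of a single zero\<close>

lemma ln_ge_two_frac:
  fixes x :: real
  assumes "x \<ge> 1"
  shows "ln x \<ge> 2 * (x - 1) / (x + 1)"
proof -
  have "ln 1 - 2 * (1 - 1) / (1 + 1) \<le> ln x - 2 * (x - 1) / (x + 1)"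
  proof (rule DERIV_nonneg_imp_nondecreasing[OF assms])
    fix y :: real assume y: "1 \<le> y" "y \<le> x"
    have "((\<lambda>y. ln y - 2 * (y - 1) / (y + 1)) has_real_derivative (1 / y - (2 * (y + 1) - 2 * (y - 1)) / ((y + 1) * (y + 1)))) (at y)"
      using y by (auto intro!: derivative_eq_intros)
    moreover have "1 / y - (2 * (y + 1) - 2 * (y - 1)) / ((y + 1) * (y + 1)) = (y - 1)\<^sup>2 / (y * (y + 1)\<^sup>2)"
    proof -
      have "y \<noteq> 0" "y + 1 \<noteq> 0" using y by auto
      then have "1 / y - (2 * (y + 1) - 2 * (y - 1)) / ((y + 1) * (y + 1)) =
          (1 * ((y + 1) * (y + 1)) - (2 * (y + 1) - 2 * (y - 1)) * y) / (y * ((y + 1) * (y + 1)))"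
        by (intro diff_frac_eq) auto
      also have "1 * ((y + 1) * (y + 1)) - (2 * (y + 1) - 2 * (y - 1)) * y = (y - 1)\<^sup>2"
        by (simp add: power2_eq_square algebra_simps)
      finally show ?thesis by (simp add: power2_eq_square)
    qed
    moreover have "0 \<le> (y - 1)\<^sup>2 / (y * (y + 1)\<^sup>2)" using y by simp
    ultimately show "\<exists>z. ((\<lambda>y. ln y - 2 * (y - 1) / (y + 1)) has_real_derivative z) (at y) \<and> 0 \<le> z" by auto
  qed
  then show ?thesis by simp
qed

text \<open>The Pade bound of \<open>ln_ge_two_frac\<close> gives ln(a/b) \<ge> 4d/(a + b), and the
  two fractions combine to d (1 - (a + b))/(ab). In the total, the numerator is d times a + b - (a -
  b)^2 = 1/2 - 2 d^2 + 2T, which is positive because d < 1/2.\<close>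

lemma zero_gain_positive:
  fixes d T :: real
  assumes d: "0 < d" "d < 1/2" and T: "T \<ge> 0"
  defines "a \<equiv> (1/2 + d)\<^sup>2 + T" and "b \<equiv> (1/2 - d)\<^sup>2 + T"
  shows "ln (a / b) - (1/2 + d) / a + (1/2 - d) / b > 0"
proof -
  have pos: "a > 0" "b > 0" using d T by (auto simp: a_def b_def intro!: add_pos_nonneg)
  have ab: "a - b = 2 * d" "a + b - 4 * d\<^sup>2 = 1/2 - 2 * d\<^sup>2 + 2 * T" by (simp_all add: a_def b_def power2_eq_square algebra_simps)
  have "a / b \<ge> 1" using pos ab d by simp
  then have "ln (a / b) \<ge> 2 * (a / b - 1) / (a / b + 1)" by (rule ln_ge_two_frac)
  also have "2 * (a / b - 1) / (a / b + 1) = 2 * (a - b) / (a + b)"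
  proof -
    have "2 * (a / b - 1) = 2 * (a - b) / b" "a / b + 1 = (a + b) / b"
      using pos by (simp_all add: diff_divide_distrib add_divide_distrib)
    then show ?thesis using pos by simp
  qed
  finally have 1: "ln (a / b) \<ge> 4 * d / (a + b)" using ab by simp
  have "- (1/2 + d) / a + (1/2 - d) / b = (- (1/2 + d) * b + (1/2 - d) * a) / (a * b)" using pos by (simp add: field_simps)
  also have "- (1/2 + d) * b + (1/2 - d) * a = (a - b) / 2 - d * (a + b)" by (simp add: algebra_simps)
  also have "\<dots> = d * (1 - (a + b))" unfolding ab by (simp add: algebra_simps)
  finally have 2: "- (1/2 + d) / a + (1/2 - d) / b = d * (1 - (a + b)) / (a * b)" .
  have "d\<^sup>2 < (1/2)\<^sup>2" using d by (intro power_strict_mono) auto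
  then have p: "a + b - 4 * d\<^sup>2 > 0" unfolding ab using T by (simp add: power2_eq_square)
  have "4 * d / (a + b) + d * (1 - (a + b)) / (a * b) = d * (4 * (a * b) + (1 - (a + b)) * (a + b)) / ((a + b) * (a * b))"
    using pos by (simp add: add_frac_eq algebra_simps)
  also have "4 * (a * b) + (1 - (a + b)) * (a + b) = (a + b) - (a - b)\<^sup>2" by (simp add: power2_eq_square algebra_simps)
  also have "(a + b) - (a - b)\<^sup>2 = a + b - 4 * d\<^sup>2" unfolding ab(1) by (simp add: power2_eq_square)
  finally have "4 * d / (a + b) + d * (1 - (a + b)) / (a * b) > 0" using p d pos by simp
  moreover have "- ((1/2 + d) / a) + (1/2 - d) / b = d * (1 - (a + b)) / (a * b)"
    using 2 unfolding minus_divide_left .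
  ultimately show ?thesis using 1 by linarith
qed

text \<open>The contribution of the pair \<open>r\<close>, \<open>- r\<close> to \<open>(1 / 2\<pi>) \<integral> ln \<bar>\<xi> (1/2 + iu) / \<xi> 1\<bar> / (u\<^sup>2 + 1/4)\<^sup>2 du\<close>.\<close>
definition zero_gain :: "complex \<Rightarrow> real" where
  "zero_gain r = (let p = Complex (1/2 + \<bar>Re r\<bar>) (Im r); q = Complex (1/2 - \<bar>Re r\<bar>) (Im r)
     in 2 * ln (norm p) - 2 * ln (norm q) - 2 * Re (1 / p))"

lemma Re_one_divide: "Re (1 / z) = Re z / (norm z)\<^sup>2"
  by (simp add: Re_divide cmod_power2)

lemma zero_beta_abs:
  assumes "xi_even r = 0"
  shows "zero_beta r = Re (1 / Complex (1/2 + \<bar>Re r\<bar>) (Im r)) + Re (1 / Complex (1/2 - \<bar>Re r\<bar>) (Im r))"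
  unfolding zero_beta_split[OF assms] Re_one_divide cmod_power2
  by (cases "Re r \<ge> 0") auto

text \<open>This is \<open>zero_gain_positive\<close> with d = |Re r| and T = (Im r)^2; for d = 0
  the points \<open>p\<close> and \<open>q\<close> coincide and everything cancels.\<close>

lemma zero_gain_plus_beta:
  assumes "xi_even r = 0"
  shows "zero_gain r + zero_beta r \<ge> 0" "zero_gain r + zero_beta r = 0 \<longleftrightarrow> Re r = 0"
proof -
  define d where "d = \<bar>Re r\<bar>"
  define T where "T = (Im r)\<^sup>2"
  define p where "p = Complex (1/2 + d) (Im r)"
  define q where "q = Complex (1/2 - d) (Im r)"
  have d: "0 \<le> d" "d < 1/2" using xi_even_zero_strip(1)[OF assms] by (auto simp: d_def)
  have np: "(norm p)\<^sup>2 = (1/2 + d)\<^sup>2 + T" "(norm q)\<^sup>2 = (1/2 - d)\<^sup>2 + T" by (auto simp: p_def q_def T_def cmod_power2)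
  have pq: "p \<noteq> 0" "q \<noteq> 0" using d by (auto simp: p_def q_def complex_eq_iff)
  have eq: "zero_gain r + zero_beta r = ln (((1/2 + d)\<^sup>2 + T) / ((1/2 - d)\<^sup>2 + T)) - (1/2 + d) / ((1/2 + d)\<^sup>2 + T) + (1/2 - d) / ((1/2 - d)\<^sup>2 + T)"
  proof -
    have "zero_gain r + zero_beta r = 2 * ln (norm p) - 2 * ln (norm q) - Re (1 / p) + Re (1 / q)"
      unfolding zero_gain_def zero_beta_abs[OF assms] p_def q_def d_def Let_def by simp
    also have "2 * ln (norm p) - 2 * ln (norm q) = ln ((norm p)\<^sup>2 / (norm q)\<^sup>2)"
      using pq by (simp add: ln_div ln_realpow)
    finally show ?thesis unfolding Re_one_divide np by (simp add: p_def q_def)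
  qed
  have z: "zero_gain r + zero_beta r = 0" if "d = 0"
  proof -
    have "(1/2)\<^sup>2 + T > 0" by (simp add: T_def add_pos_nonneg)
    then show ?thesis unfolding eq that by simp
  qed
  have g: "zero_gain r + zero_beta r > 0" if "d \<noteq> 0"
    unfolding eq by (rule zero_gain_positive) (use that d in \<open>auto simp: T_def\<close>)
  show "zero_gain r + zero_beta r \<ge> 0" using z g by (cases "d = 0") auto
  show "zero_gain r + zero_beta r = 0 \<longleftrightarrow> Re r = 0"
    using z g by (cases "d = 0") (auto simp: d_def)
qed

text \<open>The modulus |r - iu| does not change when Re r changes sign, so a zero may be moved to
  the left of the critical line before \<open>log_line_integral\<close> is applied. Hence
  \<open>p\<close> arises from both \<open>r\<close> and \<open>- r\<close>, whereas the subtracted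
  constants are ln|p| and ln|q| in one order or the other.\<close>

lemma zero_line_integral:
  assumes r: "xi_even r = 0"
  shows "has_bochner_integral lborel
    (\<lambda>u. ((ln (norm (r - \<i> * of_real u)) - ln (norm (r - 1/2))) + (ln (norm (- r - \<i> * of_real u)) - ln (norm (- r - 1/2)))) / (u\<^sup>2 + 1/4)\<^sup>2)
    (2 * pi * zero_gain r)"
proof -
  define d where "d = \<bar>Re r\<bar>"
  define p where "p = Complex (1/2 + d) (Im r)"
  define q where "q = Complex (1/2 - d) (Im r)"
  have key: "has_bochner_integral lborel (\<lambda>u. ln (norm (z - \<i> * of_real u)) / (u\<^sup>2 + 1/4)\<^sup>2) (2 * pi * (2 * ln (norm p) - Re (1 / p)))"
    if z: "\<bar>Re z\<bar> = d" "\<bar>Im z\<bar> = \<bar>Im r\<bar>" "\<And>u. norm (z - \<i> * of_real u) = norm (\<i> * of_real u - Complex (- d) (Im z))" for z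
  proof -
    define a where "a = Complex (1/2 - d) (Im z)"
    have "has_bochner_integral lborel (\<lambda>u. ln (norm (Complex (1/2) u - a)) / (u\<^sup>2 + 1/4)\<^sup>2)
       (2 * pi * (2 * ln (norm (1 - a)) - Re (1 / (1 - a))))"
      by (rule log_line_integral) (simp add: a_def d_def)
    moreover have "norm (Complex (1/2) u - a) = norm (z - \<i> * of_real u)" for u
    proof -
      have "Complex (1/2) u - a = \<i> * of_real u - Complex (- d) (Im z)" by (simp add: a_def complex_eq_iff)
      then show ?thesis using z(3)[of u] by simp
    qed
    moreover have "norm (1 - a) = norm p"
    proof -
      have "(Im z)\<^sup>2 = (Im r)\<^sup>2" using z(2) by (metis power2_abs)
      then show ?thesis by (simp add: a_def p_def cmod_def)
    qed
    moreover have "Re (1 - a) = Re p" by (simp add: a_def p_def)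
    ultimately show ?thesis by (simp add: Re_one_divide)
  qed
  have nn: "norm (z - \<i> * of_real u) = norm (\<i> * of_real u - Complex (- d) (Im z))" if "\<bar>Re z\<bar> = d" for z u
  proof -
    have "(Re z)\<^sup>2 = d\<^sup>2" using that by (metis power2_abs)
    then show ?thesis by (simp add: cmod_def power2_commute[of "Im z"])
  qed
  have k1: "has_bochner_integral lborel (\<lambda>u. ln (norm (r - \<i> * of_real u)) / (u\<^sup>2 + 1/4)\<^sup>2) (2 * pi * (2 * ln (norm p) - Re (1 / p)))"
    by (rule key) (auto simp: d_def intro: nn[unfolded d_def])
  have k2: "has_bochner_integral lborel (\<lambda>u. ln (norm (- r - \<i> * of_real u)) / (u\<^sup>2 + 1/4)\<^sup>2) (2 * pi * (2 * ln (norm p) - Re (1 / p)))"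
  proof (rule key)
    show "norm (- r - \<i> * of_real u) = norm (\<i> * of_real u - Complex (- d) (Im (- r)))" for u
      by (rule nn) (simp add: d_def)
  qed (auto simp: d_def)
  have c: "has_bochner_integral lborel (\<lambda>u::real. (ln (norm (r - 1/2)) + ln (norm (- r - 1/2))) * (1 / (u\<^sup>2 + 1/4)\<^sup>2))
      ((ln (norm (r - 1/2)) + ln (norm (- r - 1/2))) * (4 * pi))"
    by (rule has_bochner_integral_mult_right[OF has_bochner_integral_inverse_weight_square])
  have "has_bochner_integral lborel (\<lambda>u. ln (norm (r - \<i> * of_real u)) / (u\<^sup>2 + 1/4)\<^sup>2 + ln (norm (- r - \<i> * of_real u)) / (u\<^sup>2 + 1/4)\<^sup>2
      - (ln (norm (r - 1/2)) + ln (norm (- r - 1/2))) * (1 / (u\<^sup>2 + 1/4)\<^sup>2))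
     (2 * pi * (2 * ln (norm p) - Re (1 / p)) + 2 * pi * (2 * ln (norm p) - Re (1 / p)) - (ln (norm (r - 1/2)) + ln (norm (- r - 1/2))) * (4 * pi))"
    by (intro has_bochner_integral_diff has_bochner_integral_add k1 k2 c)
  moreover have "ln (norm (r - 1/2)) + ln (norm (- r - 1/2)) = ln (norm p) + ln (norm q)"
  proof (cases "Re r \<ge> 0")
    case True
    have "norm (r - 1/2) = norm q" using True by (simp add: cmod_def q_def d_def power2_commute)
    moreover have "norm (- r - 1/2) = norm p"
    proof -
      have "(- Re r - 1/2)\<^sup>2 = (1/2 + Re r)\<^sup>2" by (simp add: power2_eq_square algebra_simps)
      then show ?thesis using True by (simp add: cmod_def p_def d_def)
    qed
    ultimately show ?thesis by simp
  next
    case False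
    have "norm (r - 1/2) = norm p"
    proof -
      have "(Re r - 1/2)\<^sup>2 = (1/2 - Re r)\<^sup>2" by (simp add: power2_eq_square algebra_simps)
      then show ?thesis using False by (simp add: cmod_def p_def d_def)
    qed
    moreover have "norm (- r - 1/2) = norm q"
    proof -
      have "(- Re r - 1/2)\<^sup>2 = (1/2 + Re r)\<^sup>2" by (simp add: power2_eq_square algebra_simps)
      then show ?thesis using False by (simp add: cmod_def q_def d_def)
    qed
    ultimately show ?thesis by simp
  qed
  moreover have "2 * pi * (2 * ln (norm p) - Re (1 / p)) + 2 * pi * (2 * ln (norm p) - Re (1 / p)) - (ln (norm p) + ln (norm q)) * (4 * pi) = 2 * pi * zero_gain r"
    unfolding zero_gain_def Let_def d_def[symmetric] p_def[symmetric] q_def[symmetric] by (simp add: algebra_simps)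
  ultimately show ?thesis by (simp add: diff_divide_distrib add_divide_distrib algebra_simps)
qed

text \<open>The value that \<open>zero_beta\<close> has at the point of the critical line at the
  same height.\<close>

definition zero_alpha :: "complex \<Rightarrow> real" where "zero_alpha r = 1 / ((Im r)\<^sup>2 + 1/4)"

text \<open>With D = (Re r)^2 and T = (Im r)^2, the numerator of \<alpha> - \<beta> is D (D + 3T -
  1/4); as T > 1/4 it is nonnegative and vanishes only for D = 0. The reverse bounds, with constants
  3 and 2, allow the sum of \<beta> to dominate the other sums over zeros.\<close>

lemma zero_beta_bounds:
  assumes r: "xi_even r = 0"
  shows "zero_beta r > 0" "zero_beta r \<le> zero_alpha r" "zero_alpha r \<le> 3 * zero_beta r"
    "zero_alpha r - zero_beta r = 0 \<longleftrightarrow> Re r = 0" "norm (1 / (1/4 - r\<^sup>2)) \<le> 2 * zero_alpha r"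
proof -
  define D where "D = (Re r)\<^sup>2"
  define T where "T = (Im r)\<^sup>2"
  have D: "0 \<le> D" "D < 1/4" using xi_even_zero_strip(1)[OF r] power_strict_mono[of "\<bar>Re r\<bar>" "1/2" 2] by (auto simp: D_def power_divide)
  have T: "1/4 < T" using xi_even_zero_strip(2)[OF r] power_strict_mono[of "1/2" "\<bar>Im r\<bar>" 2] by (auto simp: T_def power_divide)
  define A where "A = T + 1/4"
  define B where "B = 1/4 - D + T"
  have re: "Re (1/4 - r\<^sup>2) = B" by (simp add: B_def D_def T_def power2_eq_square)
  have im: "(Im (1/4 - r\<^sup>2))\<^sup>2 = 4 * D * T" by (simp add: D_def T_def power2_eq_square)
  have nrm: "(norm (1/4 - r\<^sup>2))\<^sup>2 = B\<^sup>2 + 4 * D * T" unfolding cmod_power2 re im ..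
  have beta: "zero_beta r = B / (B\<^sup>2 + 4 * D * T)" unfolding zero_beta_def Re_one_divide nrm re ..
  have alpha: "zero_alpha r = 1 / A" by (simp add: zero_alpha_def A_def T_def)
  have pos: "B > 0" "A > 0" "B\<^sup>2 + 4 * D * T > 0" "A \<ge> 1/2" "B \<ge> T"
    using D T by (auto simp: A_def B_def intro!: add_pos_nonneg)
  show "zero_beta r > 0" unfolding beta using pos by simp
  have "B\<^sup>2 + 4 * D * T - A * B = D * (D + 3 * T - 1/4)" by (simp add: A_def B_def power2_eq_square algebra_simps)
  moreover have sp: "D + 3 * T - 1/4 > 0" using D T by simp
  ultimately have key: "B\<^sup>2 + 4 * D * T - A * B \<ge> 0" "B\<^sup>2 + 4 * D * T - A * B = 0 \<longleftrightarrow> D = 0" using D by auto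
  have diff: "zero_alpha r - zero_beta r = (B\<^sup>2 + 4 * D * T - A * B) / (A * (B\<^sup>2 + 4 * D * T))"
    unfolding alpha beta using pos by (subst diff_frac_eq) auto
  have "zero_alpha r - zero_beta r \<ge> 0" unfolding diff using key pos by simp
  then show "zero_beta r \<le> zero_alpha r" by simp
  show "zero_alpha r - zero_beta r = 0 \<longleftrightarrow> Re r = 0" unfolding diff using key(2) pos by (simp add: D_def)
  have "4 * D * T \<le> B"
  proof -
    have "4 * D * T \<le> 1 * T" using D T by (intro mult_right_mono) auto
    then show ?thesis using pos by simp
  qed
  then have "B\<^sup>2 + 4 * D * T \<le> 3 * (A * B)"
  proof -
    have "B * B \<le> A * B" using pos D by (intro mult_right_mono) (auto simp: A_def B_def)
    moreover have "1/2 * B \<le> A * B" using pos by (intro mult_right_mono) auto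
    ultimately show ?thesis using \<open>4 * D * T \<le> B\<close> unfolding power2_eq_square by linarith
  qed
  then have "1 / A \<le> 3 * (B / (B\<^sup>2 + 4 * D * T))" using pos by (simp add: field_simps)
  then show "zero_alpha r \<le> 3 * zero_beta r" unfolding alpha beta .
  have "B \<le> norm (1/4 - r\<^sup>2)" using complex_Re_le_cmod[of "1/4 - r\<^sup>2"] unfolding re .
  moreover have "A / 2 \<le> B" using D T by (simp add: A_def B_def)
  ultimately have "A / 2 \<le> norm (1/4 - r\<^sup>2)" by linarith
  then have "1 / norm (1/4 - r\<^sup>2) \<le> 1 / (A / 2)" using pos by (intro divide_left_mono mult_pos_pos) linarith+
  then show "norm (1 / (1/4 - r\<^sup>2)) \<le> 2 * zero_alpha r" unfolding alpha norm_divide by simp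
qed

section \<open>The integral of the logarithm of zeta\<close>

lemma has_bochner_integral_FTC_atLeast:
  fixes f F :: "real \<Rightarrow> real"
  assumes "f \<in> borel_measurable borel" "\<And>x. a \<le> x \<Longrightarrow> (F has_real_derivative f x) (at x)"
    and "\<And>x. a \<le> x \<Longrightarrow> 0 \<le> f x" "(F \<longlongrightarrow> T) at_top"
  shows "has_bochner_integral lborel (\<lambda>x. indicator {a..} x * f x) (T - F a)"
proof (rule has_bochner_integral_nn_integral)
  have "F a \<le> F x" if "a \<le> x" for x
    by (rule DERIV_nonneg_imp_nondecreasing[OF that]) (use assms(2,3) in blast)
  then have "\<forall>\<^sub>F x in at_top. F a \<le> F x" by (rule eventually_mono[OF eventually_ge_at_top[of a]])
  then show "0 \<le> T - F a" using tendsto_lowerbound[OF assms(4)] by simp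
  have "(\<integral>\<^sup>+x. ennreal (indicator {a..} x * f x) \<partial>lborel) = (\<integral>\<^sup>+x. ennreal (f x) * indicator {a..} x \<partial>lborel)"
    by (intro nn_integral_cong) (auto split: split_indicator)
  also have "\<dots> = ennreal (T - F a)" by (rule nn_integral_FTC_atLeast) (use assms in auto)
  finally show "(\<integral>\<^sup>+x. ennreal (indicator {a..} x * f x) \<partial>lborel) = ennreal (T - F a)" .
  show "(\<lambda>x. indicator {a..} x * f x) \<in> borel_measurable lborel" using assms(1) by measurable
  show "AE x in lborel. 0 \<le> indicator {a..} x * f x" using assms(3) by (intro AE_I2) (auto split: split_indicator)
qed

lemma has_bochner_integral_inverse_weight: "has_bochner_integral lborel (\<lambda>u::real. 1 / (u\<^sup>2 + 1/4)) (2 * pi)"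
proof -
  have "((\<lambda>x. 2 * arctan (2 * x)) \<longlongrightarrow> pi) at_top" by real_asymp
  moreover have "((\<lambda>x. 2 * arctan (2 * x)) has_real_derivative 1 / (x\<^sup>2 + 1/4)) (at x)" for x :: real
  proof -
    have "1 + (2 * x)\<^sup>2 \<noteq> 0" "x\<^sup>2 + 1/4 \<noteq> 0" by (auto simp: add_nonneg_eq_0_iff)
    then show ?thesis by (auto intro!: derivative_eq_intros simp: field_simps power2_eq_square)
  qed
  ultimately have "has_bochner_integral lborel (\<lambda>x::real. indicator {0..} x * (1 / (x\<^sup>2 + 1/4))) (pi - 2 * arctan (2 * 0))"
    by (intro has_bochner_integral_FTC_atLeast[where F = "\<lambda>x. 2 * arctan (2 * x)"]) auto
  then have "has_bochner_integral lborel (\<lambda>x::real. 1 / (x\<^sup>2 + 1/4)) (2 *\<^sub>R pi)"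
    by (intro has_bochner_integral_even_function) auto
  then show ?thesis by simp
qed

lemma has_bochner_integral_even_half:
  fixes f :: "real \<Rightarrow> real"
  assumes f: "has_bochner_integral lborel f I" and even: "\<And>x. f (- x) = f x"
  shows "has_bochner_integral lborel (\<lambda>x. indicator {0..} x *\<^sub>R f x) (I / 2)"
proof -
  have "integrable lborel (\<lambda>x. indicator {0..} x *\<^sub>R f x)"
    by (rule integrable_mult_indicator) (use f in \<open>auto simp: has_bochner_integral_iff\<close>)
  then have h: "has_bochner_integral lborel (\<lambda>x. indicator {0..} x *\<^sub>R f x) (LINT x|lborel. indicator {0..} x *\<^sub>R f x)"
    by (rule has_bochner_integral_integrable)
  have "has_bochner_integral lborel f (2 *\<^sub>R (LINT x|lborel. indicator {0..} x *\<^sub>R f x))"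
    by (rule has_bochner_integral_even_function[OF h even])
  then have "I = 2 *\<^sub>R (LINT x|lborel. indicator {0..} x *\<^sub>R f x)" using f by (rule has_bochner_integral_eq[symmetric])
  then show ?thesis using h by simp
qed

section \<open>Exchange of the sum over zeros with the integral\<close>

definition zero_term :: "complex \<Rightarrow> real \<Rightarrow> real" where
  "zero_term r u = (ln (norm (r - \<i> * of_real u)) - ln (norm (r - 1/2))) + (ln (norm (- r - \<i> * of_real u)) - ln (norm (- r - 1/2)))"

text \<open>Multiplying the paired factors gives (r - iu)(-r - iu) = w - (u^2 + 1/4) and (r -
  1/2)(-r - 1/2) = w, with the local \<open>w = 1/4 - r\<^sup>2\<close>. The term is therefore ln|1
  - (u^2 + 1/4)/w|, and ln x \<le> x - 1 with the triangle inequality finishes.\<close>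

lemma zero_term_le:
  assumes r: "xi_even r = 0" and u: "xi_even (\<i> * of_real u) \<noteq> 0"
  shows "zero_term r u \<le> (u\<^sup>2 + 1/4) * norm (1 / (1/4 - r\<^sup>2))"
proof -
  define w where "w = 1/4 - r\<^sup>2"
  have strip: "\<bar>Re r\<bar> < 1/2" by (rule xi_even_zero_strip(1)[OF r])
  have nz: "r - \<i> * of_real u \<noteq> 0" "r - 1/2 \<noteq> 0" "- r - 1/2 \<noteq> 0"
  proof -
    show "r - \<i> * of_real u \<noteq> 0" using r u by auto
    show "r - 1/2 \<noteq> 0" "- r - 1/2 \<noteq> 0" using strip by (auto simp: complex_eq_iff)
  qed
  have nz2: "- r - \<i> * of_real u \<noteq> 0"
  proof
    assume "- r - \<i> * of_real u = 0"
    then have "\<i> * of_real u = - r" by (simp add: algebra_simps)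
    then have "xi_even (\<i> * of_real u) = xi_even r" by (simp only: xi_even_uminus)
    then show False using r u by simp
  qed
  have e1: "(r - 1/2) * (- r - 1/2) = w" by (simp add: w_def power2_eq_square algebra_simps)
  then have w0: "w \<noteq> 0" using nz by auto
  have e2: "(r - \<i> * of_real u) * (- r - \<i> * of_real u) = w - of_real (u\<^sup>2 + 1/4)"
    by (simp add: w_def power2_eq_square algebra_simps)
  have "zero_term r u = (ln (norm (r - \<i> * of_real u)) + ln (norm (- r - \<i> * of_real u))) - (ln (norm (r - 1/2)) + ln (norm (- r - 1/2)))"
    by (simp add: zero_term_def)
  also have "\<dots> = ln (norm (w - of_real (u\<^sup>2 + 1/4))) - ln (norm w)"
  proof -
    have "ln (norm w) = ln (norm (r - 1/2)) + ln (norm (- r - 1/2))"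
      unfolding e1[symmetric] norm_mult by (rule ln_mult_pos) (use nz in auto)
    moreover have "ln (norm (w - of_real (u\<^sup>2 + 1/4))) = ln (norm (r - \<i> * of_real u)) + ln (norm (- r - \<i> * of_real u))"
      unfolding e2[symmetric] norm_mult by (rule ln_mult_pos) (use nz nz2 in auto)
    ultimately show ?thesis by simp
  qed
  also have "\<dots> = ln (norm (1 - of_real (u\<^sup>2 + 1/4) / w))"
  proof -
    have "w - of_real (u\<^sup>2 + 1/4) \<noteq> 0" unfolding e2[symmetric] using nz nz2 by simp
    moreover have "1 - of_real (u\<^sup>2 + 1/4) / w = (w - of_real (u\<^sup>2 + 1/4)) / w" using w0 by (simp only: diff_divide_distrib divide_self not_False_eq_True)
    ultimately show ?thesis using w0 by (simp only: norm_divide) (simp add: ln_div)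
  qed
  also have "\<dots> \<le> norm (1 - of_real (u\<^sup>2 + 1/4) / w) - 1"
  proof (rule ln_le_minus_one)
    have "1 - of_real (u\<^sup>2 + 1/4) / w = ((r - \<i> * of_real u) * (- r - \<i> * of_real u)) / w"
      unfolding e2 using w0 by (simp only: diff_divide_distrib divide_self not_False_eq_True)
    then show "norm (1 - of_real (u\<^sup>2 + 1/4) / w) > 0" using nz nz2 w0 by simp
  qed
  also have "\<dots> \<le> norm (of_real (u\<^sup>2 + 1/4) / w)"
    using norm_triangle_ineq4[of 1 "of_real (u\<^sup>2 + 1/4) / w"] by simp
  also have "\<dots> = (u\<^sup>2 + 1/4) * norm (1 / w)"
    by (simp only: norm_divide norm_of_real) simp
  finally show ?thesis unfolding w_def .
qed

lemma AE_xi_even_nonzero: "AE u in lborel. xi_even (\<i> * of_real u) \<noteq> 0"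
proof -
  have "{u. xi_even (\<i> * of_real u) = 0} \<subseteq> (\<Union>n. Im ` xi_zeros n)"
  proof
    fix u assume u: "u \<in> {u. xi_even (\<i> * of_real u) = 0}"
    obtain n :: nat where "norm (\<i> * complex_of_real u) \<le> real n" using real_arch_simple by blast
    then have "\<i> * of_real u \<in> xi_zeros n" using u by (simp add: zeros_upto_def)
    then have "Im (\<i> * of_real u) \<in> Im ` xi_zeros n" by blast
    then show "u \<in> (\<Union>n. Im ` xi_zeros n)" by auto
  qed
  moreover have "countable (\<Union>n. Im ` xi_zeros n)" by (intro countable_UN countableI_type countable_finite finite_imageI finite_xi_zeros)
  ultimately have "countable {u. xi_even (\<i> * of_real u) = 0}" by (rule countable_subset)
  then have "AE u in lborel. u \<notin> {u. xi_even (\<i> * of_real u) = 0}" by (intro AE_not_in countable_imp_null_set_lborel)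
  then show ?thesis by simp
qed

lemma zero_term_line_integral:
  assumes r: "xi_even r = 0"
  shows "has_bochner_integral lborel (\<lambda>u. norm (1 / (1/4 - r\<^sup>2)) * (1 / (u\<^sup>2 + 1/4)) - zero_term r u / (u\<^sup>2 + 1/4)\<^sup>2)
     (norm (1 / (1/4 - r\<^sup>2)) * (2 * pi) - 2 * pi * zero_gain r)"
  unfolding zero_term_def
  by (intro has_bochner_integral_diff has_bochner_integral_mult_right has_bochner_integral_inverse_weight zero_line_integral[OF r])

lemma zero_term_remainder_nonneg:
  assumes r: "xi_even r = 0" and u: "xi_even (\<i> * of_real u) \<noteq> 0"
  shows "0 \<le> norm (1 / (1/4 - r\<^sup>2)) * (1 / (u\<^sup>2 + 1/4)) - zero_term r u / (u\<^sup>2 + 1/4)\<^sup>2"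
proof -
  define w where "w = u\<^sup>2 + 1/4"
  have w: "w > 0" by (simp add: w_def add_nonneg_pos)
  have "zero_term r u / w\<^sup>2 \<le> (w * norm (1 / (1/4 - r\<^sup>2))) / w\<^sup>2"
    by (rule divide_right_mono) (use zero_term_le[OF r u] in \<open>auto simp: w_def\<close>)
  also have "\<dots> = norm (1 / (1/4 - r\<^sup>2)) * (1 / w)" using w by (simp only: power2_eq_square) simp
  finally show ?thesis by (simp add: w_def)
qed

text \<open>The nonnegative remainder is integrated over the line. The result is the lower bound
  that the comparison test for the sum of the remainders demands.\<close>

lemma zero_gain_le_norm:
  assumes r: "xi_even r = 0"
  shows "0 \<le> norm (1 / (1/4 - r\<^sup>2)) - zero_gain r"
proof -
  have "0 \<le> (LINT u|lborel. norm (1 / (1/4 - r\<^sup>2)) * (1 / (u\<^sup>2 + 1/4)) - zero_term r u / (u\<^sup>2 + 1/4)\<^sup>2)"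
    by (rule integral_nonneg_AE, rule AE_mp[OF AE_xi_even_nonzero], rule AE_I2, rule impI, rule zero_term_remainder_nonneg[OF r])
  also have "\<dots> = norm (1 / (1/4 - r\<^sup>2)) * (2 * pi) - 2 * pi * zero_gain r"
    by (rule has_bochner_integral_integral_eq[OF zero_term_line_integral[OF r]])
  also have "\<dots> = 2 * pi * (norm (1 / (1/4 - r\<^sup>2)) - zero_gain r)" by (simp only: right_diff_distrib mult_ac)
  finally have "2 * pi * 0 \<le> 2 * pi * (norm (1 / (1/4 - r\<^sup>2)) - zero_gain r)" by simp
  then show ?thesis by (rule mult_left_le_imp_le) simp
qed

lemma xi_even_line_integral:
  "\<exists>J. zsum zero_gain \<longlonglongrightarrow> J \<and>
     has_bochner_integral lborel (\<lambda>u. ln (norm (xi_even (\<i> * of_real u))) / (u\<^sup>2 + 1/4)\<^sup>2) (pi * J - 4 * pi * ln 2)"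
proof -
  define v :: "complex \<Rightarrow> real" where "v = (\<lambda>r. norm (1 / (1/4 - r\<^sup>2)))"
  \<comment> \<open>7 = 6 + 1: \<open>v r\<close> is at most twice \<open>zero_alpha r\<close>,
    hence at most six times \<open>zero_beta r\<close>, and
    \<open>- zero_gain r \<le> zero_beta r\<close> adds one more.\<close>
  have beta7: "zsum (\<lambda>r. 7 * zero_beta r) \<longlonglongrightarrow> 7 * (2 + euler_mascheroni - ln (4 * pi))"
    unfolding zsum_cmult by (intro tendsto_mult tendsto_const zsum_zero_beta)
  have v6: "v r \<le> 6 * zero_beta r" "0 < zero_beta r" if "xi_even r = 0" for r
    using zero_beta_bounds[OF that] unfolding v_def by linarith+
  have v0: "0 \<le> v r" for r by (simp only: v_def norm_ge_zero)
  have "\<exists>S. zsum v \<longlonglongrightarrow> S"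
  proof (rule zsum_convergent[OF beta7])
    fix r assume "xi_even r = 0"
    from v6[OF this] show "v r \<le> 7 * zero_beta r" by linarith
  qed (rule v0)
  then obtain S where S: "zsum v \<longlonglongrightarrow> S" ..
  have "\<exists>D. zsum (\<lambda>r. v r - zero_gain r) \<longlonglongrightarrow> D"
  proof (rule zsum_convergent[OF beta7])
    fix r assume r: "xi_even r = 0"
    show "0 \<le> v r - zero_gain r" unfolding v_def by (rule zero_gain_le_norm[OF r])
    show "v r - zero_gain r \<le> 7 * zero_beta r" using v6[OF r] zero_gain_plus_beta(1)[OF r] by linarith
  qed
  then obtain D where D: "zsum (\<lambda>r. v r - zero_gain r) \<longlonglongrightarrow> D" ..
  define J where "J = S - D"
  have J: "zsum zero_gain \<longlonglongrightarrow> J"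
  proof -
    have "(\<lambda>n. zsum v n - zsum (\<lambda>r. v r - zero_gain r) n) \<longlonglongrightarrow> J" unfolding J_def by (intro tendsto_diff S D)
    moreover have "(\<lambda>n. zsum v n - zsum (\<lambda>r. v r - zero_gain r) n) = zsum zero_gain"
      using zsum_diff[of v zero_gain] by (intro ext) simp
    ultimately show ?thesis by simp
  qed
  define H where "H = (\<lambda>r u. v r * (1 / (u\<^sup>2 + 1/4)) - zero_term r u / (u\<^sup>2 + 1/4)\<^sup>2 :: real)"
  \<comment> \<open>The pointwise limit of the sums of \<open>H\<close>. The logarithm has the
    factor 2 because \<open>zero_term\<close> pairs each zero with its negative, and
    \<open>ln 2\<close> is \<open>- ln (norm (xi_even (1/2)))\<close>.\<close>
  define L where "L = (\<lambda>u::real. S * (1 / (u\<^sup>2 + 1/4)) - 2 * (ln (norm (xi_even (\<i> * of_real u))) + ln 2) / (u\<^sup>2 + 1/4)\<^sup>2)"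
  have Hint: "has_bochner_integral lborel (H r) (v r * (2 * pi) - 2 * pi * zero_gain r)" if "xi_even r = 0" for r
    unfolding H_def v_def by (rule zero_term_line_integral[OF that])
  have H0: "0 \<le> H r u" if "xi_even r = 0" "xi_even (\<i> * of_real u) \<noteq> 0" for r u
    unfolding H_def v_def by (rule zero_term_remainder_nonneg[OF that])
  have int: "has_bochner_integral lborel (\<lambda>u. zsum (\<lambda>r. H r u) n) (zsum (\<lambda>r. v r * (2 * pi) - 2 * pi * zero_gain r) n)" for n
    unfolding zsum_def by (intro has_bochner_integral_sum has_bochner_integral_mult_right Hint) (rule xi_zerosD)
  have cont: "continuous_on UNIV (\<lambda>u::real. norm (xi_even (\<i> * of_real u)))"
  proof -
    have "continuous_on UNIV xi_even" by (rule holomorphic_on_imp_continuous_on[OF xi_even_holomorphic])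
    then have "continuous_on UNIV (\<lambda>u::real. xi_even (\<i> * of_real u))"
      by (rule continuous_on_compose2[where t = UNIV]) (auto intro!: continuous_intros)
    then show ?thesis by (rule continuous_on_norm)
  qed
  then have meas: "(\<lambda>u::real. norm (xi_even (\<i> * of_real u))) \<in> borel_measurable borel" by (rule borel_measurable_continuous_onI)
  have "has_bochner_integral lborel L (2 * pi * D)"
  proof (rule has_bochner_integral_monotone_convergence)
    show "integrable lborel (\<lambda>u. zsum (\<lambda>r. H r u) n)" for n using int[of n] by (auto simp: has_bochner_integral_iff)
    show "AE u in lborel. mono (\<lambda>n. zsum (\<lambda>r. H r u) n)"
      by (rule AE_mp[OF AE_xi_even_nonzero], rule AE_I2) (auto intro!: zsum_incseq H0)
    show "AE u in lborel. (\<lambda>n. zsum (\<lambda>r. H r u) n) \<longlonglongrightarrow> L u"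
    proof (rule AE_mp[OF AE_xi_even_nonzero], rule AE_I2, rule impI)
      fix u assume u: "xi_even (\<i> * of_real u) \<noteq> 0"
      define l where "l = (\<lambda>r. ln (norm (r - \<i> * of_real u)) - ln (norm (r - 1/2)))"
      have lim: "zsum l \<longlonglongrightarrow> ln (norm (xi_even (\<i> * of_real u))) - ln (norm (xi_even (1/2)))"
        unfolding l_def by (rule xi_even_zero_sums(1)[OF u])
      have zt: "zero_term r u = l r + l (- r)" for r by (simp only: zero_term_def l_def)
      have eq: "zsum (\<lambda>r. H r u) n = 1 / (u\<^sup>2 + 1/4) * zsum v n - 1 / (u\<^sup>2 + 1/4)\<^sup>2 * (2 * zsum l n)" for n
      proof -
        have "zsum (\<lambda>r. H r u) n = zsum (\<lambda>r. 1 / (u\<^sup>2 + 1/4) * v r - 1 / (u\<^sup>2 + 1/4)\<^sup>2 * (l r + l (- r))) n"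
          by (rule zsum_cong) (simp add: H_def zt)
        also have "\<dots> = 1 / (u\<^sup>2 + 1/4) * zsum v n - 1 / (u\<^sup>2 + 1/4)\<^sup>2 * (2 * zsum l n)"
          by (simp only: zsum_diff zsum_cmult zsum_symmetrize)
        finally show ?thesis .
      qed
      have "(\<lambda>n. zsum (\<lambda>r. H r u) n) \<longlonglongrightarrow> 1 / (u\<^sup>2 + 1/4) * S - 1 / (u\<^sup>2 + 1/4)\<^sup>2 * (2 * (ln (norm (xi_even (\<i> * of_real u))) - ln (norm (xi_even (1/2)))))"
        unfolding eq by (intro tendsto_diff tendsto_mult tendsto_const S lim)
      moreover have "ln (norm (xi_even (1/2))) = - ln 2" unfolding xi_even_half by (simp add: norm_divide ln_div)
      ultimately show "(\<lambda>n. zsum (\<lambda>r. H r u) n) \<longlonglongrightarrow> L u" by (simp add: L_def)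
    qed
    have "(LINT u|lborel. zsum (\<lambda>r. H r u) n) = 2 * pi * zsum (\<lambda>r. v r - zero_gain r) n" for n
    proof -
      have "(LINT u|lborel. zsum (\<lambda>r. H r u) n) = zsum (\<lambda>r. v r * (2 * pi) - 2 * pi * zero_gain r) n"
        by (rule has_bochner_integral_integral_eq[OF int])
      also have "\<dots> = zsum (\<lambda>r. 2 * pi * (v r - zero_gain r)) n"
        by (rule zsum_cong) (simp add: algebra_simps)
      finally show ?thesis by (simp only: zsum_cmult)
    qed
    then show "(\<lambda>n. LINT u|lborel. zsum (\<lambda>r. H r u) n) \<longlonglongrightarrow> 2 * pi * D"
      by (simp only:) (intro tendsto_mult tendsto_const D)
    have "L \<in> borel_measurable borel" unfolding L_def using meas by measurable
    then show "L \<in> borel_measurable lborel" by simp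
  qed
  then have "has_bochner_integral lborel (\<lambda>u. 1 / 2 * (S * (1 / (u\<^sup>2 + 1/4)) - L u) - ln 2 * (1 / (u\<^sup>2 + 1/4)\<^sup>2)) (1 / 2 * (S * (2 * pi) - 2 * pi * D) - ln 2 * (4 * pi))"
    by (intro has_bochner_integral_diff has_bochner_integral_mult_right has_bochner_integral_inverse_weight has_bochner_integral_inverse_weight_square)
  moreover have "1 / 2 * (S * (1 / (u\<^sup>2 + 1/4)) - L u) - ln 2 * (1 / (u\<^sup>2 + 1/4)\<^sup>2) = ln (norm (xi_even (\<i> * of_real u))) / (u\<^sup>2 + 1/4)\<^sup>2" for u
    unfolding L_def by (simp add: add_divide_distrib)
  moreover have "1 / 2 * (S * (2 * pi) - 2 * pi * D) - ln 2 * (4 * pi) = pi * J - 4 * pi * ln 2"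
    by (simp add: J_def algebra_simps)
  ultimately have "has_bochner_integral lborel (\<lambda>u. ln (norm (xi_even (\<i> * of_real u))) / (u\<^sup>2 + 1/4)\<^sup>2) (pi * J - 4 * pi * ln 2)"
    by (simp only:)
  then show ?thesis using J by blast
qed

lemma norm_zeta_cnj: "Re s > 0 \<Longrightarrow> norm (zeta (cnj s)) = norm (zeta s)"
proof -
  assume s: "Re s > 0"
  have "cnj (2 powr (1 - s)) = 2 powr (1 - cnj s)" by (subst cnj_powr) auto
  then have "zeta (cnj s) = cnj (zeta s)" unfolding zeta_def dirichlet_eta_cnj[OF s] by simp
  then show ?thesis by simp
qed

text \<open>On the line ln|zeta| is ln|xi| minus the logarithm treated in
  \<open>xi_factor_line_integral\<close>. Adding the sum of \<beta> to that of the gains absorbs 2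
  ln 2 + ln pi = ln(4 pi) and leaves 1 - gamma as the only constant.\<close>

lemma zeta_line_integral:
  "\<exists>D. zsum (\<lambda>r. zero_gain r + zero_beta r) \<longlonglongrightarrow> D \<and>
     (LBINT u:{0..}. ln (norm (zeta (Complex (1/2) u))) / (u\<^sup>2 + 1/4)\<^sup>2) = pi * (D / 2 + 1 - euler_mascheroni)"
proof -
  obtain J where J: "zsum zero_gain \<longlonglongrightarrow> J"
    "has_bochner_integral lborel (\<lambda>u. ln (norm (xi_even (\<i> * of_real u))) / (u\<^sup>2 + 1/4)\<^sup>2) (pi * J - 4 * pi * ln 2)"
    using xi_even_line_integral by blast
  define D where "D = J + (2 + euler_mascheroni - ln (4 * pi))"
  have D: "zsum (\<lambda>r. zero_gain r + zero_beta r) \<longlonglongrightarrow> D"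
    unfolding D_def zsum_add by (intro tendsto_add J(1) zsum_zero_beta)
  define f where "f = (\<lambda>u. ln (norm (zeta (Complex (1/2) u))) / (u\<^sup>2 + 1/4)\<^sup>2)"
  define g where "g = (\<lambda>u. ln (norm (xi_even (\<i> * of_real u))) / (u\<^sup>2 + 1/4)\<^sup>2 -
    ln (norm ((Complex (1/2) u - 1) * xi_factor (Complex (1/2) u))) / (u\<^sup>2 + 1/4)\<^sup>2)"
  have g: "has_bochner_integral lborel g (pi * J - 4 * pi * ln 2 - 2 * pi * (euler_mascheroni / 2 + ln pi / 2 - ln 2 - 2))"
    unfolding g_def by (intro has_bochner_integral_diff J(2) xi_factor_line_integral)
  have z: "zeta (Complex (1/2) u) = xi_even (Complex (1/2) u - 1/2) / ((Complex (1/2) u - 1) * xi_factor (Complex (1/2) u))" for u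
    by (rule zeta_eq_xi) auto
  have x: "Complex (1/2) u - 1/2 = \<i> * of_real u" for u by (simp add: complex_eq_iff)
  have nz: "(Complex (1/2) u - 1) * xi_factor (Complex (1/2) u) \<noteq> 0" for u
  proof -
    have "Complex (1/2) u - 1 \<noteq> 0" by (simp add: complex_eq_iff)
    then show ?thesis using xi_factor_nonzero[of "Complex (1/2) u"] by simp
  qed
  \<comment> \<open>At a zero on the critical line \<open>ln 0\<close> is merely a default value and
    the two sides may differ; this affects a null set.\<close>
  have fg: "f u = g u" if u: "xi_even (\<i> * of_real u) \<noteq> 0" for u
  proof -
    have "ln (norm (zeta (Complex (1/2) u))) = ln (norm (xi_even (\<i> * of_real u))) - ln (norm ((Complex (1/2) u - 1) * xi_factor (Complex (1/2) u)))"
      unfolding z x norm_divide by (rule ln_divide_pos) (use u nz[of u] in auto)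
    then show ?thesis unfolding f_def g_def by (simp only: diff_divide_distrib)
  qed
  have cont: "continuous_on UNIV (\<lambda>u::real. norm (zeta (Complex (1/2) u)))"
  proof -
    have c: "continuous_on UNIV (\<lambda>u. Complex (1/2) u)" by (intro continuous_intros)
    have "continuous_on UNIV (\<lambda>u. xi_even (Complex (1/2) u - 1/2))"
      by (rule continuous_on_compose2[OF holomorphic_on_imp_continuous_on[OF xi_even_holomorphic]]) (auto intro!: continuous_intros c)
    moreover have "continuous_on UNIV (\<lambda>u. xi_factor (Complex (1/2) u))"
      by (rule continuous_on_compose2[OF holomorphic_on_imp_continuous_on[OF xi_factor_holomorphic] c]) auto
    ultimately have "continuous_on UNIV (\<lambda>u. xi_even (Complex (1/2) u - 1/2) / ((Complex (1/2) u - 1) * xi_factor (Complex (1/2) u)))"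
      using nz by (intro continuous_on_divide continuous_on_mult continuous_on_diff continuous_on_const c) auto
    then show ?thesis unfolding z by (rule continuous_on_norm)
  qed
  then have "(\<lambda>u::real. norm (zeta (Complex (1/2) u))) \<in> borel_measurable borel" by (rule borel_measurable_continuous_onI)
  then have fm: "f \<in> borel_measurable borel" unfolding f_def by measurable
  have ae: "AE u in lborel. g u = f u" by (rule AE_mp[OF AE_xi_even_nonzero], rule AE_I2) (simp add: fg)
  have "has_bochner_integral lborel f (pi * J - 4 * pi * ln 2 - 2 * pi * (euler_mascheroni / 2 + ln pi / 2 - ln 2 - 2))"
    using g by (rule has_bochner_integralI_AE[OF _ _ ae]) (use fm in simp)
  moreover have "pi * J - 4 * pi * ln 2 - 2 * pi * (euler_mascheroni / 2 + ln pi / 2 - ln 2 - 2) = pi * (D + 2 - 2 * euler_mascheroni)"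
  proof -
    have "ln (4 * pi) = 2 * ln 2 + ln pi" using ln_realpow[of 2 2] by (simp add: ln_mult)
    then show ?thesis unfolding D_def by (simp add: algebra_simps)
  qed
  ultimately have F: "has_bochner_integral lborel f (pi * (D + 2 - 2 * euler_mascheroni))" by simp
  have "f (- u) = f u" for u
  proof -
    have "Complex (1/2) (- u) = cnj (Complex (1/2) u)" by (simp add: complex_eq_iff)
    then have "norm (zeta (Complex (1/2) (- u))) = norm (zeta (Complex (1/2) u))" by (simp only:) (rule norm_zeta_cnj, simp)
    then show ?thesis unfolding f_def by simp
  qed
  then have "has_bochner_integral lborel (\<lambda>u. indicator {0..} u *\<^sub>R f u) (pi * (D + 2 - 2 * euler_mascheroni) / 2)"
    by (rule has_bochner_integral_even_half[OF F])
  then have "(LBINT u:{0..}. f u) = pi * (D + 2 - 2 * euler_mascheroni) / 2"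
    unfolding set_lebesgue_integral_def by (rule has_bochner_integral_integral_eq)
  then have "(LBINT u:{0..}. ln (norm (zeta (Complex (1/2) u))) / (u\<^sup>2 + 1/4)\<^sup>2) = pi * (D / 2 + 1 - euler_mascheroni)"
    unfolding f_def by (simp add: field_simps)
  then show ?thesis using D by blast
qed

lemma RH_iff_xi: "RH \<longleftrightarrow> (\<forall>r. xi_even r = 0 \<longrightarrow> Re r = 0)"
  unfolding RH_def nontrivial_zeros_eq by auto

section \<open>The integral of the counting function\<close>

text \<open>The case a = 1/2 of \<open>has_bochner_integral_arctan\<close>, where the coefficient a
  / (2 (a^2 - 1/4)) of the partial fractions breaks down and another antiderivative takes
  over.\<close>

lemma has_bochner_integral_arctan_half:
  "has_bochner_integral lborel (\<lambda>u::real. indicator {0..} u * (u * arctan (2 * u) / (u\<^sup>2 + 1/4)\<^sup>2)) (pi / 2)"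
proof -
  define F where "F = (\<lambda>u::real. (u / 2 - arctan (2 * u) / 2) / (u\<^sup>2 + 1/4) + arctan (2 * u))"
  have lim: "(F \<longlongrightarrow> pi / 2) at_top" unfolding F_def by real_asymp
  have der: "(F has_real_derivative u * arctan (2 * u) / (u\<^sup>2 + 1/4)\<^sup>2) (at u)" for u
  proof -
    define w where "w = u\<^sup>2 + 1/4"
    have w: "w > 0" by (simp add: w_def add_nonneg_pos)
    have at: "1 / (1 + (2 * u)\<^sup>2) * 2 = 1 / (2 * w)" using w by (simp add: w_def field_simps)
    have d1: "((\<lambda>u. arctan (2 * u)) has_real_derivative 1 / (2 * w)) (at u)"
      unfolding at[symmetric] by (auto intro!: derivative_eq_intros simp: inverse_eq_divide)
    have d2: "((\<lambda>u. u\<^sup>2 + 1/4) has_real_derivative 2 * u) (at u)"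
      by (auto intro!: derivative_eq_intros)
    have d3: "((\<lambda>u. u / 2 - arctan (2 * u) / 2) has_real_derivative 1 / 2 - 1 / (2 * w) / 2) (at u)"
      by (intro DERIV_diff DERIV_cdivide DERIV_ident d1)
    have "(F has_real_derivative ((1 / 2 - 1 / (2 * w) / 2) * w - (u / 2 - arctan (2 * u) / 2) * (2 * u)) / (w * w) + 1 / (2 * w)) (at u)"
      unfolding F_def using DERIV_add[OF DERIV_divide[OF d3 d2] d1] w by (simp add: w_def)
    moreover have "((1 / 2 - 1 / (2 * w) / 2) * w - (u / 2 - arctan (2 * u) / 2) * (2 * u)) / (w * w) + 1 / (2 * w) = u * arctan (2 * u) / w\<^sup>2"
    proof -
      have "(1 / 2 - 1 / (2 * w) / 2) * w = w / 2 - 1/4" using w by (simp add: field_simps)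
      moreover have "1 / (2 * w) = (w / 2) / (w * w)" using w by simp
      moreover have "u\<^sup>2 = w - 1/4" by (simp add: w_def)
      then have "(u / 2 - arctan (2 * u) / 2) * (2 * u) = w - 1/4 - u * arctan (2 * u)"
        by (simp add: algebra_simps power2_eq_square)
      ultimately show ?thesis by (simp only: add_divide_distrib[symmetric]) (simp add: power2_eq_square)
    qed
    ultimately show ?thesis by (simp add: w_def)
  qed
  have "has_bochner_integral lborel (\<lambda>u. indicator {0..} u * (u * arctan (2 * u) / (u\<^sup>2 + 1/4)\<^sup>2)) (pi / 2 - F 0)"
    by (rule has_bochner_integral_FTC_atLeast[OF _ der _ lim]) (auto simp: arctan_le_zero_iff)
  then show ?thesis by (simp add: F_def)
qed

text \<open>Integration by parts leaves half the integral of a / ((u^2 + a^2)(u^2 + 1/4));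
  \<open>c\<close> is the coefficient in its partial fractions, and \<open>F\<close> is the
  antiderivative found in this way.\<close>

lemma has_bochner_integral_arctan:
  fixes a :: real
  assumes a: "a > 1/2"
  shows "has_bochner_integral lborel (\<lambda>u. indicator {0..} u * (u * arctan (u / a) / (u\<^sup>2 + 1/4)\<^sup>2)) (pi / (2 * a + 1))"
proof -
  define c where "c = a / (2 * (a\<^sup>2 - 1/4))"
  have a2: "a\<^sup>2 - 1/4 = (a - 1/2) * (a + 1/2)" by (simp add: power2_eq_square algebra_simps)
  then have a2': "a\<^sup>2 - 1/4 > 0" using a by simp
  define F where "F = (\<lambda>u. - (arctan (u / a) / 2) / (u\<^sup>2 + 1/4) + c * (2 * arctan (2 * u) - arctan (u / a) / a))"
  have at: "((\<lambda>u. arctan (u / a)) \<longlongrightarrow> pi / 2) at_top" using a by real_asymp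
  have "((\<lambda>u::real. 1 / (u\<^sup>2 + 1/4)) \<longlongrightarrow> 0) at_top" by real_asymp
  then have "((\<lambda>u. - (arctan (u / a) / 2) * (1 / (u\<^sup>2 + 1/4)) + c * (2 * arctan (2 * u) - arctan (u / a) / a)) \<longlongrightarrow>
      - (pi / 2 / 2) * 0 + c * (2 * (pi / 2) - (pi / 2) / a)) at_top"
  proof (intro tendsto_add tendsto_mult tendsto_diff tendsto_const tendsto_minus tendsto_divide at)
    show "((\<lambda>u::real. arctan (2 * u)) \<longlongrightarrow> pi / 2) at_top" by real_asymp
  qed (use a in auto)
  moreover have "- (pi / 2 / 2) * 0 + c * (2 * (pi / 2) - (pi / 2) / a) = pi / (2 * a + 1)"
  proof -
    have "2 * (pi / 2) - (pi / 2) / a = pi * (a - 1/2) / a" using a by (simp add: field_simps)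
    moreover have "c = a / (2 * ((a - 1/2) * (a + 1/2)))" by (simp add: c_def a2)
    ultimately have "c * (2 * (pi / 2) - (pi / 2) / a) = pi / (2 * (a + 1/2))" using a by simp
    also have "2 * (a + 1/2) = 2 * a + 1" by simp
    finally show ?thesis by simp
  qed
  ultimately have lim: "(F \<longlongrightarrow> pi / (2 * a + 1)) at_top" unfolding F_def by simp
  have der: "(F has_real_derivative u * arctan (u / a) / (u\<^sup>2 + 1/4)\<^sup>2) (at u)" for u
  proof -
    define w where "w = u\<^sup>2 + 1/4"
    define v where "v = u\<^sup>2 + a\<^sup>2"
    have w: "w > 0" "v > 0" using a by (auto simp: w_def v_def add_nonneg_pos)
    have e1: "1 / (1 + (2 * u)\<^sup>2) * 2 = 1 / (2 * w)" using w by (simp add: w_def field_simps)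
    have d1: "((\<lambda>u. arctan (2 * u)) has_real_derivative 1 / (2 * w)) (at u)"
      unfolding e1[symmetric] by (auto intro!: derivative_eq_intros simp: inverse_eq_divide)
    have e2: "1 / (1 + (u / a)\<^sup>2) * (1 / a) = a / v"
    proof -
      have "1 + (u / a)\<^sup>2 = v / a\<^sup>2" using a by (simp add: v_def power_divide add_divide_distrib)
      then show ?thesis using a by (simp add: power2_eq_square)
    qed
    have d2: "((\<lambda>u. arctan (u / a)) has_real_derivative a / v) (at u)"
      unfolding e2[symmetric] by (rule DERIV_cong[OF DERIV_chain2[OF DERIV_arctan DERIV_cdivide[OF DERIV_ident]]]) (simp add: inverse_eq_divide)
    have d3: "((\<lambda>u. u\<^sup>2 + 1/4) has_real_derivative 2 * u) (at u)"
      by (auto intro!: derivative_eq_intros)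
    have d4: "((\<lambda>u. - (arctan (u / a) / 2) / (u\<^sup>2 + 1/4)) has_real_derivative
        (- (a / v / 2) * w - (- (arctan (u / a) / 2)) * (2 * u)) / (w * w)) (at u)"
      unfolding w_def by (rule DERIV_divide[OF DERIV_minus[OF DERIV_cdivide[OF d2]] d3]) (use w in \<open>simp add: w_def\<close>)
    have d5: "((\<lambda>u. c * (2 * arctan (2 * u) - arctan (u / a) / a)) has_real_derivative
        c * (2 * (1 / (2 * w)) - a / v / a)) (at u)"
      by (intro DERIV_cmult DERIV_diff DERIV_cdivide d1 d2)
    have "(F has_real_derivative (- (a / v / 2) * w - (- (arctan (u / a) / 2)) * (2 * u)) / (w * w) + c * (2 * (1 / (2 * w)) - a / v / a)) (at u)"
      unfolding F_def by (rule DERIV_add[OF d4 d5])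
    moreover have "(- (a / v / 2) * w - (- (arctan (u / a) / 2)) * (2 * u)) / (w * w) + c * (2 * (1 / (2 * w)) - a / v / a) = u * arctan (u / a) / w\<^sup>2"
    proof -
      have "2 * (1 / (2 * w)) - a / v / a = (v - w) / (w * v)" using w a by (simp add: diff_divide_distrib)
      also have "v - w = a\<^sup>2 - 1/4" by (simp add: v_def w_def)
      finally have eq: "2 * (1 / (2 * w)) - a / v / a = (a\<^sup>2 - 1/4) / (w * v)" .
      have gen: "a / (2 * d) * (d / (w * v)) = a / (2 * w * v)" if "d > 0" for d using that by simp
      have "c * (2 * (1 / (2 * w)) - a / v / a) = a / (2 * w * v)" unfolding eq c_def by (rule gen[OF a2'])
      moreover have "(- (a / v / 2) * w - (- (arctan (u / a) / 2)) * (2 * u)) / (w * w) = - (a / (2 * w * v)) + u * arctan (u / a) / w\<^sup>2"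
        using w by (simp add: add_divide_distrib diff_divide_distrib power2_eq_square mult_ac)
      ultimately show ?thesis by simp
    qed
    ultimately show ?thesis by (simp add: w_def)
  qed
  have "has_bochner_integral lborel (\<lambda>u. indicator {0..} u * (u * arctan (u / a) / (u\<^sup>2 + 1/4)\<^sup>2)) (pi / (2 * a + 1) - F 0)"
    by (rule has_bochner_integral_FTC_atLeast[OF _ der _ lim]) (use a in \<open>auto intro!: divide_nonneg_nonneg mult_nonneg_nonneg\<close>)
  then show ?thesis by (simp add: F_def)
qed

lemma has_bochner_integral_square_over_weight:
  "has_bochner_integral lborel (\<lambda>u::real. indicator {0..} u * (u * u / (u\<^sup>2 + 1/4)\<^sup>2)) (pi / 2)"
proof -
  have "has_bochner_integral lborel (\<lambda>u::real. 1 / (u\<^sup>2 + 1/4) - 1/4 * (1 / (u\<^sup>2 + 1/4)\<^sup>2)) (2 * pi - 1/4 * (4 * pi))"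
    by (intro has_bochner_integral_diff has_bochner_integral_mult_right has_bochner_integral_inverse_weight has_bochner_integral_inverse_weight_square)
  moreover have "1 / (u\<^sup>2 + 1/4) - 1/4 * (1 / (u\<^sup>2 + 1/4)\<^sup>2) = u * u / (u\<^sup>2 + 1/4)\<^sup>2" for u :: real
  proof -
    define w where "w = u\<^sup>2 + 1/4"
    have w: "w > 0" by (simp add: w_def add_nonneg_pos)
    have "1 / w = w / w\<^sup>2" using w by (simp add: power2_eq_square)
    then have "1 / w - 1/4 * (1 / w\<^sup>2) = (w - 1/4) / w\<^sup>2" by (simp add: diff_divide_distrib)
    then show ?thesis by (simp add: w_def power2_eq_square)
  qed
  ultimately have "has_bochner_integral lborel (\<lambda>u::real. u * u / (u\<^sup>2 + 1/4)\<^sup>2) pi" by simp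
  then have "has_bochner_integral lborel (\<lambda>u::real. indicator {0..} u *\<^sub>R (u * u / (u\<^sup>2 + 1/4)\<^sup>2)) (pi / 2)"
    by (rule has_bochner_integral_even_half) simp
  then show ?thesis by simp
qed

section \<open>The series in \<open>theta_fun\<close> and its integral\<close>

lemma arctan_quadratic_bound:
  fixes x :: real
  assumes "x \<ge> 0"
  shows "x - x\<^sup>2 / 2 \<le> arctan x"
proof -
  have "arctan 0 + 0\<^sup>2 / 2 - 0 \<le> arctan x + x\<^sup>2 / 2 - x"
  proof (rule DERIV_nonneg_imp_nondecreasing[OF assms])
    fix t :: real assume t: "0 \<le> t"
    have "((\<lambda>t. arctan t + t\<^sup>2 / 2 - t) has_real_derivative 1 / (1 + t\<^sup>2) + t - 1) (at t)"
      by (auto intro!: derivative_eq_intros simp: inverse_eq_divide)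
    moreover have "0 \<le> 1 / (1 + t\<^sup>2) + t - 1"
    proof -
      have p: "1 + t\<^sup>2 > 0" by (simp add: add_pos_nonneg)
      have "1 / (1 + t\<^sup>2) + t - 1 = (1 + (t - 1) * (1 + t\<^sup>2)) / (1 + t\<^sup>2)" using p by (simp add: add_divide_distrib)
      also have "1 + (t - 1) * (1 + t\<^sup>2) = t * ((1 - t)\<^sup>2 + t)" by (simp add: power2_eq_square algebra_simps)
      finally show ?thesis using t p by simp
    qed
    ultimately show "\<exists>y. ((\<lambda>t. arctan t + t\<^sup>2 / 2 - t) has_real_derivative y) (at t) \<and> 0 \<le> y" by blast
  qed
  then show ?thesis by simp
qed

definition theta_term :: "nat \<Rightarrow> real \<Rightarrow> real" where
  "theta_term k t = t / (2 * real (Suc k)) - arctan (t / (2 * real (Suc k) + 1/2))"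

text \<open>Two errors of order K^(-2) add up: replacing 2K + 1/2 by 2K, and the arctangent by its
  argument. Nonnegativity prepares the monotone convergence in
  \<open>theta_fun_integral\<close>.\<close>

lemma theta_term_bounds:
  assumes t: "t \<ge> 0"
  shows "0 \<le> theta_term k t" "theta_term k t \<le> (t + t\<^sup>2) * (1 / real (Suc k) ^ 2)"
proof -
  define K where "K = real (Suc k)"
  have K: "K \<ge> 1" by (simp add: K_def)
  define x where "x = t / (2 * K + 1/2)"
  have x: "0 \<le> x" "x \<le> t / (2 * K)" "x \<le> t / K" using t K by (auto simp: x_def intro!: divide_left_mono)
  have "arctan x \<le> x" using abs_arctan_le[of x] x by simp
  then show "0 \<le> theta_term k t" using x by (simp add: theta_term_def K_def x_def)
  have "t / (2 * K) - x \<le> t / K\<^sup>2"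
  proof -
    have "t / (2 * K) - x = t * (1 / (2 * K) - 1 / (2 * K + 1/2))" by (simp add: x_def right_diff_distrib)
    also have "1 / (2 * K) - 1 / (2 * K + 1/2) = (1/2) / (2 * K * (2 * K + 1/2))" using K by (subst diff_frac_eq) auto
    also have "t * ((1/2) / (2 * K * (2 * K + 1/2))) \<le> t * (1 / K\<^sup>2)"
    proof (rule mult_left_mono[OF _ t])
      have "K\<^sup>2 \<le> 2 * K * (2 * K + 1/2)" using K by (simp add: power2_eq_square algebra_simps)
      then show "(1/2) / (2 * K * (2 * K + 1/2)) \<le> 1 / K\<^sup>2" using K by (intro frac_le) auto
    qed
    finally show ?thesis by simp
  qed
  moreover have "x - arctan x \<le> t\<^sup>2 / K\<^sup>2"
  proof -
    have "x - arctan x \<le> x\<^sup>2 / 2" using arctan_quadratic_bound[OF x(1)] by simp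
    also have "\<dots> \<le> x\<^sup>2" by simp
    also have "\<dots> \<le> (t / K)\<^sup>2" using x by (intro power_mono) auto
    finally show ?thesis by (simp add: power_divide)
  qed
  ultimately have "t / (2 * K) - arctan x \<le> (t + t\<^sup>2) * (1 / K\<^sup>2)" by (simp add: add_divide_distrib distrib_right)
  then show "theta_term k t \<le> (t + t\<^sup>2) * (1 / real (Suc k) ^ 2)" by (simp add: theta_term_def K_def x_def)
qed

lemma summable_theta_term: "t \<ge> 0 \<Longrightarrow> summable (\<lambda>k. theta_term k t)"
proof (rule summable_comparison_test)
  assume t: "t \<ge> 0"
  show "\<exists>N. \<forall>n\<ge>N. norm (theta_term n t) \<le> (t + t\<^sup>2) * (1 / real (Suc n) ^ 2)"
    using theta_term_bounds[OF t] by auto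
  have "summable (\<lambda>n. inverse (real n ^ 2))" by (rule inverse_power_summable) simp
  then have "summable (\<lambda>n. inverse (real (Suc n) ^ 2))" by (subst summable_Suc_iff)
  then show "summable (\<lambda>n. (t + t\<^sup>2) * (1 / real (Suc n) ^ 2))" by (intro summable_mult) (simp add: inverse_eq_divide)
qed

text \<open>With a = 2K + 1/2 the arctangent integral is pi / (4 (K + 1/2)), and K + 1/2 = 3/2 + k;
  together with the linear part this is pi/4 times a term of the Digamma series at 3/2.\<close>

lemma theta_term_integral:
  "has_bochner_integral lborel (\<lambda>u. indicator {0..} u * (u * theta_term k u / (u\<^sup>2 + 1/4)\<^sup>2))
     (pi / 4 * (inverse (real (Suc k)) - inverse (3/2 + real k)))"
proof -
  define K where "K = real (Suc k)"
  have K: "K \<ge> 1" by (simp add: K_def)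
  have "has_bochner_integral lborel (\<lambda>u. 1 / (2 * K) * (indicator {0..} u * (u * u / (u\<^sup>2 + 1/4)\<^sup>2)) -
       indicator {0..} u * (u * arctan (u / (2 * K + 1/2)) / (u\<^sup>2 + 1/4)\<^sup>2))
     (1 / (2 * K) * (pi / 2) - pi / (2 * (2 * K + 1/2) + 1))"
    by (intro has_bochner_integral_diff has_bochner_integral_mult_right has_bochner_integral_square_over_weight has_bochner_integral_arctan)
       (use K in simp)
  moreover have "1 / (2 * K) * (indicator {0..} u * (u * u / (u\<^sup>2 + 1/4)\<^sup>2)) -
       indicator {0..} u * (u * arctan (u / (2 * K + 1/2)) / (u\<^sup>2 + 1/4)\<^sup>2) = indicator {0..} u * (u * theta_term k u / (u\<^sup>2 + 1/4)\<^sup>2)" for u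
  proof -
    have gen: "1 / c * (i * (u * u / y)) - i * (u * T / y) = i * (u * (u / c - T) / y)" for i T c y :: real
      by (simp add: diff_divide_distrib right_diff_distrib mult_ac)
    show ?thesis unfolding theta_term_def K_def by (rule gen)
  qed
  moreover have "1 / (2 * K) * (pi / 2) - pi / (2 * (2 * K + 1/2) + 1) = pi / 4 * (inverse (real (Suc k)) - inverse (3/2 + real k))"
  proof -
    have "3/2 + real k = K + 1/2" by (simp add: K_def)
    moreover have "pi / (2 * (2 * K + 1/2) + 1) = pi / 4 * (1 / (K + 1/2))"
      using K by (simp add: field_simps)
    moreover have "1 / (2 * K) * (pi / 2) - pi / 4 * (1 / (K + 1/2)) = pi / 4 * (inverse K - inverse (K + 1/2))"
      by (simp add: right_diff_distrib inverse_eq_divide)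
    ultimately show ?thesis by (simp only: K_def[symmetric])
  qed
  ultimately show ?thesis by (simp only:)
qed

text \<open>The sum is Digamma(3/2) + gamma, and Digamma(3/2) = Digamma(1/2) + 2.\<close>

lemma sums_Digamma_three_halves: "(\<lambda>k. inverse (real (Suc k)) - inverse (3/2 + real k)) sums (2 - 2 * ln 2)"
proof -
  have "Digamma (3/2 :: real) = 2 - euler_mascheroni - 2 * ln 2"
    using Digamma_plus1[of "1/2 :: real"] Digamma_one_half[where 'a = real] by simp
  moreover have "summable (\<lambda>k. inverse (of_nat (Suc k)) - inverse (3/2 + of_nat k :: real))"
    by (rule summable_Digamma) simp
  ultimately show ?thesis
    by (simp add: sums_iff Digamma_def)
qed

lemma theta_fun_integral:
  "has_bochner_integral lborel (\<lambda>u. indicator {0..} u * (u * theta_fun u / (u\<^sup>2 + 1/4)\<^sup>2))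
     (- (pi / 2) - (euler_mascheroni + ln pi) / 2 * (pi / 2) + pi / 4 * (2 - 2 * ln 2))"
proof -
  define f where "f = (\<lambda>k u. indicator {0..} u * (u * theta_term k u / (u\<^sup>2 + 1/4)\<^sup>2) :: real)"
  define s where "s = (\<lambda>u. indicator {0..} u * (u * (\<Sum>k. theta_term k u) / (u\<^sup>2 + 1/4)\<^sup>2) :: real)"
  have fint: "has_bochner_integral lborel (f k) (pi / 4 * (inverse (real (Suc k)) - inverse (3/2 + real k)))" for k
    unfolding f_def by (rule theta_term_integral)
  have f0: "0 \<le> f k u" for k u unfolding f_def using theta_term_bounds(1)[of u k] by (auto split: split_indicator)
  have lim: "(\<lambda>n. \<Sum>k<n. f k u) \<longlonglongrightarrow> s u" for u
  proof (cases "u \<ge> 0")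
    case True
    have "(\<lambda>k. theta_term k u) sums (\<Sum>k. theta_term k u)" by (rule summable_sums[OF summable_theta_term[OF True]])
    then have "(\<lambda>k. u / (u\<^sup>2 + 1/4)\<^sup>2 * theta_term k u) sums (u / (u\<^sup>2 + 1/4)\<^sup>2 * (\<Sum>k. theta_term k u))" by (rule sums_mult)
    then have "(\<lambda>k. f k u) sums s u" using True by (simp add: f_def s_def)
    then show ?thesis by (simp add: sums_def)
  qed (simp add: f_def s_def)
  have int: "has_bochner_integral lborel (\<lambda>u. \<Sum>k<n. f k u) (\<Sum>k<n. pi / 4 * (inverse (real (Suc k)) - inverse (3/2 + real k)))" for n
    by (intro has_bochner_integral_sum fint)
  have S: "has_bochner_integral lborel s (pi / 4 * (2 - 2 * ln 2))"
  proof (rule has_bochner_integral_monotone_convergence)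
    show i: "integrable lborel (\<lambda>u. \<Sum>k<n. f k u)" for n using int[of n] by (simp only: has_bochner_integral_iff)
    show "AE u in lborel. mono (\<lambda>n. \<Sum>k<n. f k u)"
      by (intro AE_I2 incseq_SucI) (simp add: f0)
    show "AE u in lborel. (\<lambda>n. \<Sum>k<n. f k u) \<longlonglongrightarrow> s u" by (intro AE_I2 lim)
    have "(LINT u|lborel. (\<Sum>k<n. f k u)) = pi / 4 * (\<Sum>k<n. inverse (real (Suc k)) - inverse (3/2 + real k))" for n
      unfolding has_bochner_integral_integral_eq[OF int] by (simp only: sum_distrib_left)
    then show "(\<lambda>n. LINT u|lborel. (\<Sum>k<n. f k u)) \<longlonglongrightarrow> pi / 4 * (2 - 2 * ln 2)"
      using sums_Digamma_three_halves by (simp only: sums_def) (intro tendsto_mult tendsto_const)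
    show "s \<in> borel_measurable lborel"
      by (rule borel_measurable_LIMSEQ_real[OF lim]) (use i in auto)
  qed
  have "has_bochner_integral lborel (\<lambda>u. - (indicator {0..} u * (u * arctan (2 * u) / (u\<^sup>2 + 1/4)\<^sup>2))
      - (euler_mascheroni + ln pi) / 2 * (indicator {0..} u * (u * u / (u\<^sup>2 + 1/4)\<^sup>2)) + s u)
     (- (pi / 2) - (euler_mascheroni + ln pi) / 2 * (pi / 2) + pi / 4 * (2 - 2 * ln 2))"
    by (intro has_bochner_integral_add has_bochner_integral_diff has_bochner_integral_minus has_bochner_integral_mult_right
        has_bochner_integral_arctan_half has_bochner_integral_square_over_weight S)
  moreover have "- (indicator {0..} u * (u * arctan (2 * u) / (u\<^sup>2 + 1/4)\<^sup>2))
      - (euler_mascheroni + ln pi) / 2 * (indicator {0..} u * (u * u / (u\<^sup>2 + 1/4)\<^sup>2)) + s u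
     = indicator {0..} u * (u * theta_fun u / (u\<^sup>2 + 1/4)\<^sup>2)" for u
  proof -
    have gen: "- (i * (u * A / y)) - c / 2 * (i * (u * u / y)) + i * (u * B / y) = i * (u * (- A - u / 2 * c + B) / y)" for i A B c y :: real
      by (simp add: ring_distribs add_divide_distrib diff_divide_distrib mult_ac)
    show ?thesis unfolding s_def theta_fun_def theta_term_def by (rule gen)
  qed
  ultimately show ?thesis by simp
qed

section \<open>The counting function as a sum over zeros\<close>

lemma zsum_zero_alpha: "\<exists>A. zsum zero_alpha \<longlonglongrightarrow> A"
proof (rule zsum_convergent)
  show "zsum (\<lambda>r. 3 * zero_beta r) \<longlonglongrightarrow> 3 * (2 + euler_mascheroni - ln (4 * pi))"
    unfolding zsum_cmult by (intro tendsto_mult tendsto_const zsum_zero_beta)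
  show "zero_alpha r \<le> 3 * zero_beta r" if "xi_even r = 0" for r by (rule zero_beta_bounds(3)[OF that])
  show "0 \<le> zero_alpha r" for r by (simp add: zero_alpha_def add_nonneg_pos less_imp_le)
qed

text \<open>Zeros of bounded height lie in a bounded disc, as |Re r| < 1/2, so the truncated sums
  become exact. The strict \<open>0 < Im r\<close> agrees with the condition
  \<open>0 \<le> Im \<rho>\<close> in \<open>zeta_N\<close> because no zero is real.\<close>

lemma zeta_N_eventually:
  "\<forall>\<^sub>F n in sequentially. zeta_N u = zsum (\<lambda>r. of_bool (0 < Im r \<and> Im r \<le> u)) n"
proof -
  obtain N :: nat where N: "real N \<ge> \<bar>u\<bar> + 1" using real_arch_simple by blast
  show ?thesis using eventually_ge_at_top[of N]
  proof eventually_elim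
    case (elim n)
    define Z where "Z = {r. xi_even r = 0 \<and> 0 < Im r \<and> Im r \<le> u}"
    have sub: "Z \<subseteq> xi_zeros n"
    proof
      fix r assume r: "r \<in> Z"
      then have "norm r \<le> 1/2 + \<bar>u\<bar>" using cmod_le[of r] xi_even_zero_strip(1)[of r] by (auto simp: Z_def)
      then show "r \<in> xi_zeros n" using r N elim by (simp add: Z_def zeros_upto_def)
    qed
    have im: "{\<rho> \<in> nontrivial_zeros. 0 \<le> Im \<rho> \<and> Im \<rho> \<le> u} = (\<lambda>r. r + 1/2) ` Z"
    proof -
      have "0 < Im r \<longleftrightarrow> 0 \<le> Im r" if "xi_even r = 0" for r using xi_even_zero_strip(2)[OF that] by auto
      then show ?thesis unfolding nontrivial_zeros_eq Z_def by (auto simp: image_iff)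
    qed
    have "zeta_N u = real (\<Sum>\<rho>\<in>(\<lambda>r. r + 1/2) ` Z. zeta_zero_mult \<rho>)" unfolding zeta_N_def im ..
    also have "(\<Sum>\<rho>\<in>(\<lambda>r. r + 1/2) ` Z. zeta_zero_mult \<rho>) = (\<Sum>r\<in>Z. zeta_zero_mult (r + 1/2))"
      by (subst sum.reindex) (auto simp: inj_on_def)
    also have "\<dots> = (\<Sum>r\<in>Z. xi_mult r)"
    proof (intro sum.cong refl)
      fix r assume "r \<in> Z"
      then have "\<bar>Re r\<bar> < 1/2" using xi_even_zero_strip(1) by (simp add: Z_def)
      then show "zeta_zero_mult (r + 1/2) = xi_mult r" by (subst zeta_zero_mult_eq) auto
    qed
    also have "real (\<Sum>r\<in>Z. xi_mult r) = (\<Sum>r\<in>Z. of_nat (xi_mult r) * of_bool (0 < Im r \<and> Im r \<le> u))"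
      by (simp add: Z_def)
    also have "\<dots> = zsum (\<lambda>r. of_bool (0 < Im r \<and> Im r \<le> u)) n"
      unfolding zsum_def by (rule sum.mono_neutral_left[OF finite_xi_zeros sub]) (auto simp: Z_def zeros_upto_def)
    finally show ?case .
  qed
qed

text \<open>A zero in the upper half-plane contributes the integral of u / (u^2 + 1/4)^2 from its
  height to infinity, which is half of \<open>zero_alpha\<close>. Zeros come in pairs
  \<open>r\<close>, \<open>- r\<close>, of which one lies in the upper half-plane; summing \<alpha>
  over all zeros counts each pair twice, hence A/4.\<close>

lemma counting_integral:
  assumes A: "zsum zero_alpha \<longlonglongrightarrow> A"
  shows "has_bochner_integral lborel (\<lambda>u. indicator {0..} u * (u * zeta_N u / (u\<^sup>2 + 1/4)\<^sup>2)) (A / 4)"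
proof -
  define f :: "complex \<Rightarrow> real \<Rightarrow> real" where
    "f = (\<lambda>r u. of_bool (0 < Im r) * (indicator {Im r..} u * (u / (u\<^sup>2 + 1/4)\<^sup>2)))"
  define g :: "complex \<Rightarrow> real" where "g = (\<lambda>r. of_bool (0 < Im r) * (zero_alpha r / 2))"
  have fint: "has_bochner_integral lborel (f r) (g r)" for r
  proof (cases "0 < Im r")
    case True
    define F where "F = (\<lambda>u::real. - (1 / (u\<^sup>2 + 1/4)) / 2)"
    have "(F \<longlongrightarrow> 0) at_top" unfolding F_def by real_asymp
    moreover have "(F has_real_derivative u / (u\<^sup>2 + 1/4)\<^sup>2) (at u)" for u
    proof -
      have nz: "u\<^sup>2 + 1/4 \<noteq> 0" by (simp add: add_nonneg_eq_0_iff)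
      have d: "((\<lambda>u. u\<^sup>2 + 1/4) has_real_derivative 2 * u) (at u)" by (auto intro!: derivative_eq_intros)
      have eq: "- ((0 * w - 1 * (2 * u)) / (w * w)) / 2 = u / w\<^sup>2" for w :: real by (simp add: power2_eq_square)
      show ?thesis unfolding F_def eq[symmetric]
        by (intro DERIV_cdivide DERIV_minus DERIV_divide DERIV_const d nz)
    qed
    ultimately have "has_bochner_integral lborel (\<lambda>u. indicator {Im r..} u * (u / (u\<^sup>2 + 1/4)\<^sup>2)) (0 - F (Im r))"
      using True by (intro has_bochner_integral_FTC_atLeast) auto
    then show ?thesis using True by (simp add: f_def g_def F_def zero_alpha_def)
  qed (simp add: f_def g_def has_bochner_integral_zero)
  have f0: "0 \<le> f r u" for r u unfolding f_def by (auto split: split_indicator)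
  have int: "has_bochner_integral lborel (\<lambda>u. zsum (\<lambda>r. f r u) n) (zsum g n)" for n
    unfolding zsum_def by (intro has_bochner_integral_sum has_bochner_integral_mult_right fint)
  have lim: "(\<lambda>n. zsum (\<lambda>r. f r u) n) \<longlonglongrightarrow> indicator {0..} u * (u * zeta_N u / (u\<^sup>2 + 1/4)\<^sup>2)" for u
  proof -
    have "\<forall>\<^sub>F n in sequentially. indicator {0..} u * (u * zeta_N u / (u\<^sup>2 + 1/4)\<^sup>2) = zsum (\<lambda>r. f r u) n"
      using zeta_N_eventually[of u]
    proof eventually_elim
      case (elim n)
      have "indicator {0..} u * (u * zeta_N u / (u\<^sup>2 + 1/4)\<^sup>2) = (indicator {0..} u * (u / (u\<^sup>2 + 1/4)\<^sup>2)) * zeta_N u" by simp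
      also have "\<dots> = zsum (\<lambda>r. (indicator {0..} u * (u / (u\<^sup>2 + 1/4)\<^sup>2)) * of_bool (0 < Im r \<and> Im r \<le> u)) n"
        unfolding elim zsum_cmult ..
      also have "\<dots> = zsum (\<lambda>r. f r u) n"
        by (rule zsum_cong) (auto simp: f_def split: split_indicator)
      finally show ?case .
    qed
    then show ?thesis by (rule Lim_transform_eventually[OF tendsto_const])
  qed
  show ?thesis
  proof (rule has_bochner_integral_monotone_convergence)
    show i: "integrable lborel (\<lambda>u. zsum (\<lambda>r. f r u) n)" for n using int[of n] by (simp only: has_bochner_integral_iff)
    show "AE u in lborel. mono (\<lambda>n. zsum (\<lambda>r. f r u) n)" by (intro AE_I2 zsum_incseq f0)
    show "AE u in lborel. (\<lambda>n. zsum (\<lambda>r. f r u) n) \<longlonglongrightarrow> indicator {0..} u * (u * zeta_N u / (u\<^sup>2 + 1/4)\<^sup>2)" by (intro AE_I2 lim)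
    have "(LINT u|lborel. zsum (\<lambda>r. f r u) n) = zsum zero_alpha n / 4" for n
    proof -
      have "2 * zsum g n = zsum (\<lambda>r. g r + g (- r)) n" by (rule zsum_symmetrize[symmetric])
      also have "\<dots> = zsum (\<lambda>r. 1/2 * zero_alpha r) n"
      proof (rule zsum_cong)
        fix r assume "xi_even r = 0"
        then have "\<bar>Im r\<bar> > 1/2" by (rule xi_even_zero_strip)
        then show "g r + g (- r) = 1/2 * zero_alpha r" by (auto simp: g_def zero_alpha_def)
      qed
      also have "\<dots> = 1/2 * zsum zero_alpha n" by (rule zsum_cmult)
      finally show ?thesis unfolding has_bochner_integral_integral_eq[OF int] by simp
    qed
    then show "(\<lambda>n. LINT u|lborel. zsum (\<lambda>r. f r u) n) \<longlonglongrightarrow> A / 4"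
      by (simp only:) (intro tendsto_divide A tendsto_const, simp)
    show "(\<lambda>u. indicator {0..} u * (u * zeta_N u / (u\<^sup>2 + 1/4)\<^sup>2)) \<in> borel_measurable lborel"
      by (rule borel_measurable_LIMSEQ_real[OF lim]) (use i in auto)
  qed
qed

text \<open>The constants from the integral of \<open>theta_fun\<close> assemble to ln(4 pi) and can
  be expressed by the limit of \<open>zsum zero_beta\<close>; what exceeds gamma - 1 is then half
  the difference of the sums of \<alpha> and \<beta>.\<close>

lemma argument_integral:
  assumes A: "zsum zero_alpha \<longlonglongrightarrow> A"
  shows "(LBINT u:{0..}. u * (pi * zeta_N u - theta_fun u - 2 * arctan (2 * u)) / (u\<^sup>2 + 1/4)\<^sup>2) =
    pi / 2 * (euler_mascheroni - 1 + (A - (2 + euler_mascheroni - ln (4 * pi))) / 2)"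
proof -
  have h: "has_bochner_integral lborel (\<lambda>u. pi * (indicator {0..} u * (u * zeta_N u / (u\<^sup>2 + 1/4)\<^sup>2))
      - indicator {0..} u * (u * theta_fun u / (u\<^sup>2 + 1/4)\<^sup>2) - 2 * (indicator {0..} u * (u * arctan (2 * u) / (u\<^sup>2 + 1/4)\<^sup>2)))
     (pi * (A / 4) - (- (pi / 2) - (euler_mascheroni + ln pi) / 2 * (pi / 2) + pi / 4 * (2 - 2 * ln 2)) - 2 * (pi / 2))"
    by (intro has_bochner_integral_diff has_bochner_integral_mult_right has_bochner_integral_arctan_half counting_integral[OF A] theta_fun_integral)
  have eq: "indicator {0..} u *\<^sub>R (u * (pi * zeta_N u - theta_fun u - 2 * arctan (2 * u)) / (u\<^sup>2 + 1/4)\<^sup>2) =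
      pi * (indicator {0..} u * (u * zeta_N u / (u\<^sup>2 + 1/4)\<^sup>2))
      - indicator {0..} u * (u * theta_fun u / (u\<^sup>2 + 1/4)\<^sup>2) - 2 * (indicator {0..} u * (u * arctan (2 * u) / (u\<^sup>2 + 1/4)\<^sup>2))" for u
    by (simp add: right_diff_distrib diff_divide_distrib mult_ac)
  have "(LBINT u:{0..}. u * (pi * zeta_N u - theta_fun u - 2 * arctan (2 * u)) / (u\<^sup>2 + 1/4)\<^sup>2) =
     pi * (A / 4) - (- (pi / 2) - (euler_mascheroni + ln pi) / 2 * (pi / 2) + pi / 4 * (2 - 2 * ln 2)) - 2 * (pi / 2)"
    unfolding set_lebesgue_integral_def eq by (rule has_bochner_integral_integral_eq[OF h])
  also have "\<dots> = pi / 2 * (euler_mascheroni - 1 + (A - (2 + euler_mascheroni - ln (4 * pi))) / 2)"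
  proof -
    have "ln (4 * pi) = 2 * ln 2 + ln pi" using ln_realpow[of 2 2] by (simp add: ln_mult)
    then show ?thesis by (simp add: field_simps)
  qed
  finally show ?thesis .
qed

theorem theorem2p4:
  defines "I1 \<equiv> - (1 / pi) * (LBINT u:{0..}. ln (norm (zeta (Complex (1/2) u))) / (u\<^sup>2 + 1/4)\<^sup>2)"
      and "I2 \<equiv> (2 / pi) * (LBINT u:{0..}. u * (pi * zeta_N u - theta_fun u - 2 * arctan (2 * u)) / (u\<^sup>2 + 1/4)\<^sup>2)"
  shows "I1 \<le> euler_mascheroni - 1 \<and> I2 \<ge> euler_mascheroni - 1
         \<and> (I1 = euler_mascheroni - 1 \<longleftrightarrow> RH) \<and> (I2 = euler_mascheroni - 1 \<longleftrightarrow> RH)"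
proof -
  obtain D where D: "zsum (\<lambda>r. zero_gain r + zero_beta r) \<longlonglongrightarrow> D"
    "(LBINT u:{0..}. ln (norm (zeta (Complex (1/2) u))) / (u\<^sup>2 + 1/4)\<^sup>2) = pi * (D / 2 + 1 - euler_mascheroni)"
    using zeta_line_integral by blast
  obtain A where A: "zsum zero_alpha \<longlonglongrightarrow> A" using zsum_zero_alpha by blast
  define E where "E = A - (2 + euler_mascheroni - ln (4 * pi))"
  have E: "zsum (\<lambda>r. zero_alpha r - zero_beta r) \<longlonglongrightarrow> E"
    unfolding E_def zsum_diff by (intro tendsto_diff A zsum_zero_beta)
  have I1: "I1 = euler_mascheroni - 1 - D / 2"
    unfolding I1_def D(2) by simp
  have I2: "I2 = euler_mascheroni - 1 + E / 2"
    unfolding I2_def argument_integral[OF A] E_def[symmetric] by simp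
  have "D \<ge> 0" "D = 0 \<longleftrightarrow> RH"
    unfolding RH_iff_xi using zsum_limit_nonneg[OF D(1)] zero_gain_plus_beta by auto
  moreover have "E \<ge> 0" "E = 0 \<longleftrightarrow> RH"
    unfolding RH_iff_xi using zsum_limit_nonneg[OF E] zero_beta_bounds(2,4) by auto
  ultimately show ?thesis unfolding I1 I2 by auto
qed

end
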